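(* Let $n\ge 1$, $0<p<1$ and $f\in L^p(\mathbb{R}^n)$. Then there exist a constant $A_{np}>0$ depending only on $(n,p)$, and, for each $j=1,\dots,2^n$, a sequence of rational functions $\{R_{k\sigma_j}\}_{k\ge1}\subset H^p(T_{\Gamma_{\sigma_j}})$ and a function $f_{\sigma_j}\in H^p(T_{\Gamma_{\sigma_j}})$, such that: (i) $\sum_{k=1}^\infty\sum_{j=1}^{2^n}\|R_{k\sigma_j}\|_{H^p}^p\le A_{np}\|f\|_p^p$; (ii) $\lim_{m\to\infty}\big\|f-\sum_{k=1}^m\sum_{j=1}^{2^n}R_{k\sigma_j}\big\|_p=0$ (where $R_{k\sigma_j}$ is restricted to $\mathbb{R}^n$); (iii) for every $j$, $\lim_{m\to\infty}\big\|f_{\sigma_j}-\sum_{k=1}^m R_{k\sigma_j}\big\|_{H^p}=0$; (iv) denoting by $f_{\sigma_j}(x)$ the non-tangential boundary limit of $f_{\sigma_j}(z)$, one has $f(x)=\sum_{j=1}^{2^n}f_{\sigma_j}(x)$ for almost every $x\in\mathbb{R}^n$; (v) $\|f\|_p^p\le\sum_{j=1}^{2^n}\|f_{\sigma_j}\|_p^p\le A_{np}\|f\|_p^p$; (vi) consequently $L^p(\mathbb{R}^n)=\sum_{j=1}^{2^n}H^p_{\sigma_j}(\mathbb{R}^n)$.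
   Context: For $k=1,\dots,2^n$ let $\sigma_k=(\sigma_k(1),\dots,\sigma_k(n))\in\{+1,-1\}^n$ enumerate all sign vectors, with $\sigma_1=(1,\dots,1)$. The octant $\Gamma_{\sigma_k}=\{y\in\mathbb{R}^n:\sigma_k(j)y_j>0,\ j=1,\dots,n\}$, and the tube $T_{\Gamma_{\sigma_k}}=\{x+iy\in\mathbb{C}^n: x\in\mathbb{R}^n, y\in\Gamma_{\sigma_k}\}$. For an open $B\subset\mathbb{R}^n$ and $0<p<\infty$, $H^p(T_B)$ is the space of holomorphic $F$ on $T_B$ with $\|F\|_{H^p}=\sup_{y\in B}\left(\int_{\mathbb{R}^n}|F(x+iy)|^p\,dx\right)^{1/p}<\infty$. Every $F\in H^p(T_{\Gamma_{\sigma_k}})$ has a non-tangential boundary limit $F(x)=\lim_{y\in\Gamma_{\sigma_k},y\to0}F(x+iy)$ (taken within products of one-variable cones $\{|x_j-x_0^{(j)}|<\alpha_j\sigma_k(j)y_j\}$) for a.e. $x\in\mathbb{R}^n$. $H^p_{\sigma_k}(\mathbb{R}^n)$ denotes the set of (a.e.-defined) non-tangential boundary limit functions of functions in $H^p(T_{\Gamma_{\sigma_k}})$. $\|\cdot\|_p$ is the $L^p(\mathbb{R}^n)$ quasi-norm. *)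

theory Defs
  imports "HOL-Analysis.Analysis"
begin

text \<open>Sign vectors sigma in {+1,-1}^n (the index set j = 1..2^n).\<close>
definition sign_vectors :: "(real^'n) set" where
  "sign_vectors = {s. \<forall>i. s$i = 1 \<or> s$i = -1}"

definition octant :: "real^'n \<Rightarrow> (real^'n) set" where
  "octant s = {y. \<forall>j. s$j * y$j > 0}"

definition tpt :: "real^'n \<Rightarrow> real^'n \<Rightarrow> complex^'n" where
  "tpt x y = (\<chi> j. Complex (x$j) (y$j))"

definition cvec :: "real^'n \<Rightarrow> complex^'n" where
  "cvec x = (\<chi> j. complex_of_real (x$j))"

definition tube :: "(real^'n) set \<Rightarrow> (complex^'n) set" where
  "tube B = {z. (\<chi> j. Im (z$j)) \<in> B}"

definition holomorphic_n :: "(complex^'n \<Rightarrow> complex) \<Rightarrow> (complex^'n) set \<Rightarrow> bool" where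
  "holomorphic_n F U \<longleftrightarrow>
     (\<forall>z\<in>U. \<exists>D. (F has_derivative D) (at z) \<and> (\<forall>c v. D (c *s v) = c * D v))"

definition Hp_pnorm :: "real \<Rightarrow> (real^'n) set \<Rightarrow> (complex^'n \<Rightarrow> complex) \<Rightarrow> ennreal" where
  "Hp_pnorm p B F = (SUP y\<in>B. \<integral>\<^sup>+ x. ennreal (norm (F (tpt x y)) powr p) \<partial>lebesgue)"

definition Hp :: "real \<Rightarrow> (real^'n) set \<Rightarrow> (complex^'n \<Rightarrow> complex) set" where
  "Hp p B = {F. holomorphic_n F (tube B) \<and> Hp_pnorm p B F < \<infinity>}"

definition Lp_pnorm :: "real \<Rightarrow> (real^'n \<Rightarrow> complex) \<Rightarrow> ennreal" where
  "Lp_pnorm p f = (\<integral>\<^sup>+ x. ennreal (norm (f x) powr p) \<partial>lebesgue)"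

definition Lp :: "real \<Rightarrow> (real^'n \<Rightarrow> complex) set" where
  "Lp p = {f. f \<in> borel_measurable lebesgue \<and> Lp_pnorm p f < \<infinity>}"

definition nt_cone :: "real^'n \<Rightarrow> real^'n \<Rightarrow> real^'n \<Rightarrow> (complex^'n) set" where
  "nt_cone s \<alpha> x0 = {tpt x y | x y. y \<in> octant s \<and> (\<forall>j. \<bar>x$j - x0$j\<bar> < \<alpha>$j * (s$j * y$j))}"

definition nt_limit :: "(complex^'n \<Rightarrow> complex) \<Rightarrow> real^'n \<Rightarrow> real^'n \<Rightarrow> complex \<Rightarrow> bool" where
  "nt_limit F s x0 L \<longleftrightarrow>
     (\<forall>\<alpha>. (\<forall>j. \<alpha>$j > 0) \<longrightarrow> (F \<longlongrightarrow> L) (at (cvec x0) within nt_cone s \<alpha> x0))"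

definition Hp_boundary :: "real \<Rightarrow> real^'n \<Rightarrow> (real^'n \<Rightarrow> complex) set" where
  "Hp_boundary p s = {g. \<exists>F \<in> Hp p (octant s). AE x in lebesgue. nt_limit F s x (g x)}"

definition poly_fun_n :: "(complex^'n \<Rightarrow> complex) \<Rightarrow> bool" where
  "poly_fun_n P \<longleftrightarrow> (\<exists>(S :: ('n \<Rightarrow> nat) set) c. finite S \<and>
      (\<forall>z. P z = (\<Sum>\<alpha>\<in>S. c \<alpha> * (\<Prod>j\<in>UNIV. (z$j) ^ (\<alpha> j)))))"

definition rational_on :: "(complex^'n) set \<Rightarrow> (complex^'n \<Rightarrow> complex) \<Rightarrow> bool" where
  "rational_on U R \<longleftrightarrow> (\<exists>P Q. poly_fun_n P \<and> poly_fun_n Q \<and> (\<forall>z\<in>U. Q z \<noteq> 0) \<and>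
      (\<forall>z. R z = P z / Q z))"

end

theory Submission
  imports Defs "HOL-Complex_Analysis.Cauchy_Integral_Formula"
    "HOL-Computational_Algebra.Fundamental_Theorem_Algebra"
begin

text \<open>
  Put \<open>D(z) = (z - \<i>) ^ j + (z + \<i>) ^ j\<close>, a polynomial with simple real zeros only. On the real line
  \<open>1 / (1 + x\<^sup>2) ^ j = 1 / ((x + \<i>) ^ j D(x)) + 1 / ((x - \<i>) ^ j D(x))\<close>, and the two summands extend
  holomorphically to the upper and lower half plane. Since \<open>p < 1\<close>, the real poles are harmless: on
  every cone with vertex \<open>x\<close> both summands are bounded by a multiple of
  \<open>1 / ((1 + \<bar>x\<bar>) ^ j \<bar>D(x)\<bar>)\<close>, which lies in \<open>L\<^sup>p\<close> once \<open>j p > 1\<close>. Polynomials in \<open>1 / (1 + x\<^sup>2)\<close>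
  approximate the indicator of \<open>[-1, 1]\<close> in \<open>L\<^sup>p\<close>; taking products over the coordinates and rescaling,
  the indicator of any box is, up to a small error in \<open>L\<^sup>p\<close>, a sum over the octants of rational functions
  whose non-tangential maximal functions are controlled in \<open>L\<^sup>p\<close>.

  As \<open>\<parallel>\<cdot>\<parallel>\<^sub>p\<^sup>p\<close> is subadditive, finite combinations of such sums approximate every \<open>f \<in> L\<^sup>p\<close>
  up to half of its norm, with comparable maximal functions. Iterating on the error gives the
  series, and the maximal functions give its convergence in \<open>H\<^sup>p\<close>, locally uniformly in the tubes,
  and non-tangentially almost everywhere, with no appeal to the theory of \<open>H\<^sup>p\<close> spaces.
\<close>

section \<open>Rational functions of several complex variables\<close>

text \<open>The obstacle is decay at infinity. The Cauchy projections of the indicator of an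
  interval decay only like \<open>1/|x|\<close>, which is not p-integrable for p < 1. With A = (x +
  i)^j and B = (x - i)^j, the identity 1/(AB) = 1/(A(A+B)) + 1/(B(A+B)) splits a function decaying
  like |x|^(-2j) into two pieces with the same decay; the price is the zeros of D = A + B. They must
  be simple: a simple zero a costs |x - a|^(-p), integrable exactly for p < 1, whereas a double zero
  would require p < 1/2. The approximating polynomials in t = 1/(1 + x^2) contain only powers t^j
  with j a positive multiple of m, so a single condition m p > 1 makes all their kernels
  p-integrable. The final constant is uniform in f because of scaling: for an arbitrary box, both
  the approximation error and the integral of the maximal function are the unit-box quantities times
  a volume factor. Hence m is chosen once, for the unit box, from n and p alone. Working with p-th
  powers of norms, which add without constants, carries these bounds unchanged from boxes to finite
  sums.\<close>

lemma poly_fun_n_sum_monomials: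
  fixes e :: "'i \<Rightarrow> 'n::finite \<Rightarrow> nat"
  assumes "finite I"
  shows "poly_fun_n (\<lambda>z. \<Sum>i\<in>I. c i * (\<Prod>j\<in>UNIV. (z$j) ^ e i j))"
  unfolding poly_fun_n_def
proof (intro exI conjI allI)
  show "finite (e ` I)" using assms by simp
  fix z
  show "(\<Sum>i\<in>I. c i * (\<Prod>j\<in>UNIV. (z$j) ^ e i j))
      = (\<Sum>\<alpha>\<in>e`I. (\<Sum>i\<in>{i\<in>I. e i = \<alpha>}. c i) * (\<Prod>j\<in>UNIV. (z$j) ^ \<alpha> j))"
    by (subst sum.image_gen[OF assms, of _ e]) (simp add: sum_distrib_right)
qed

lemma poly_fun_n_const: "poly_fun_n (\<lambda>z::complex^'n. c)"
  using poly_fun_n_sum_monomials[of "{()}" "\<lambda>_. c" "\<lambda>_ _. 0"] by simp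

lemma poly_fun_n_coord: "poly_fun_n (\<lambda>z::complex^'n. z$k)"
proof -
  have "(\<Prod>j\<in>UNIV. (z$j) ^ (if j = k then 1 else 0)) = z$k" for z :: "complex^'n"
    by (simp add: if_distrib cong: if_cong)
  then show ?thesis
    using poly_fun_n_sum_monomials[of "{()}" "\<lambda>_. 1" "\<lambda>_ j. if j = k then 1 else 0"] by simp
qed

text \<open>The disjoint sum of the exponent sets serves as index set, so exponents common to both
  need no separate treatment; collecting them is the task of
  \<open>poly_fun_n_sum_monomials\<close>.\<close>

lemma poly_fun_n_add:
  fixes P Q :: "complex^'n \<Rightarrow> complex"
  assumes "poly_fun_n P" "poly_fun_n Q"
  shows "poly_fun_n (\<lambda>z. P z + Q z)"
proof -
  obtain S c where S: "finite S" "\<And>z. P z = (\<Sum>\<alpha>\<in>S. c \<alpha> * (\<Prod>j\<in>UNIV. (z$j) ^ (\<alpha> j)))"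
    using assms(1) unfolding poly_fun_n_def by blast
  obtain T d where T: "finite T" "\<And>z. Q z = (\<Sum>\<alpha>\<in>T. d \<alpha> * (\<Prod>j\<in>UNIV. (z$j) ^ (\<alpha> j)))"
    using assms(2) unfolding poly_fun_n_def by blast
  have "poly_fun_n (\<lambda>z. \<Sum>i\<in>S <+> T. case_sum c d i * (\<Prod>j\<in>UNIV. (z$j) ^ (case_sum id id i j)))"
    using S T by (intro poly_fun_n_sum_monomials) auto
  then show ?thesis using S T by (simp add: sum.Plus)
qed

lemma poly_fun_n_mult:
  fixes P Q :: "complex^'n \<Rightarrow> complex"
  assumes "poly_fun_n P" "poly_fun_n Q"
  shows "poly_fun_n (\<lambda>z. P z * Q z)"
proof -
  obtain S c where S: "finite S" "\<And>z. P z = (\<Sum>\<alpha>\<in>S. c \<alpha> * (\<Prod>j\<in>UNIV. (z$j) ^ (\<alpha> j)))"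
    using assms(1) unfolding poly_fun_n_def by blast
  obtain T d where T: "finite T" "\<And>z. Q z = (\<Sum>\<alpha>\<in>T. d \<alpha> * (\<Prod>j\<in>UNIV. (z$j) ^ (\<alpha> j)))"
    using assms(2) unfolding poly_fun_n_def by blast
  have "P z * Q z = (\<Sum>i\<in>S \<times> T. (c (fst i) * d (snd i)) * (\<Prod>j\<in>UNIV. (z$j) ^ (fst i j + snd i j)))" for z
    unfolding S(2) T(2) sum_product sum.cartesian_product
    by (rule sum.cong) (auto simp: power_add prod.distrib)
  then show ?thesis
    using poly_fun_n_sum_monomials[of "S \<times> T" "\<lambda>i. c (fst i) * d (snd i)" "\<lambda>i j. fst i j + snd i j"] S T
    by simp
qed

section \<open>Closure properties of holomorphic functions of several variables\<close>

lemma holomorphic_n_const: "holomorphic_n (\<lambda>z. c) U"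
  unfolding holomorphic_n_def by (intro ballI exI[of _ "\<lambda>_. 0"]) auto

lemma holomorphic_n_coord: "holomorphic_n (\<lambda>z. z$k) U"
  unfolding holomorphic_n_def
  by (intro ballI exI[of _ "\<lambda>v. v$k"])
     (auto intro: bounded_linear_imp_has_derivative bounded_linear_vec_nth)

lemma holomorphic_n_add:
  assumes "holomorphic_n F U" "holomorphic_n G U"
  shows "holomorphic_n (\<lambda>z. F z + G z) U"
  unfolding holomorphic_n_def
proof
  fix z assume "z \<in> U"
  then obtain D E where "(F has_derivative D) (at z)" "\<forall>c v. D (c *s v) = c * D v"
     "(G has_derivative E) (at z)" "\<forall>c v. E (c *s v) = c * E v"
    using assms unfolding holomorphic_n_def by blast
  then show "\<exists>D. ((\<lambda>z. F z + G z) has_derivative D) (at z) \<and> (\<forall>c v. D (c *s v) = c * D v)"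
    by (intro exI[of _ "\<lambda>v. D v + E v"]) (auto intro!: derivative_eq_intros simp: algebra_simps)
qed

lemma holomorphic_n_mult:
  assumes "holomorphic_n F U" "holomorphic_n G U"
  shows "holomorphic_n (\<lambda>z. F z * G z) U"
  unfolding holomorphic_n_def
proof
  fix z assume "z \<in> U"
  then obtain D E where "(F has_derivative D) (at z)" "\<forall>c v. D (c *s v) = c * D v"
     "(G has_derivative E) (at z)" "\<forall>c v. E (c *s v) = c * E v"
    using assms unfolding holomorphic_n_def by blast
  then show "\<exists>D. ((\<lambda>z. F z * G z) has_derivative D) (at z) \<and> (\<forall>c v. D (c *s v) = c * D v)"
    by (intro exI[of _ "\<lambda>v. F z * E v + D v * G z"]) (auto intro!: derivative_eq_intros simp: algebra_simps)
qed

lemma holomorphic_n_inverse: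
  assumes "holomorphic_n F U" "\<And>z. z \<in> U \<Longrightarrow> F z \<noteq> 0"
  shows "holomorphic_n (\<lambda>z. inverse (F z)) U"
  unfolding holomorphic_n_def
proof
  fix z assume z: "z \<in> U"
  then obtain D where "(F has_derivative D) (at z)" "\<forall>c v. D (c *s v) = c * D v"
    using assms unfolding holomorphic_n_def by blast
  then show "\<exists>D. ((\<lambda>z. inverse (F z)) has_derivative D) (at z) \<and> (\<forall>c v. D (c *s v) = c * D v)"
    using assms(2)[OF z]
    by (intro exI[of _ "\<lambda>v. - (inverse (F z) * D v * inverse (F z))"])
       (auto intro!: derivative_eq_intros simp: algebra_simps)
qed

lemma holomorphic_n_sum:
  "finite I \<Longrightarrow> (\<And>i. i \<in> I \<Longrightarrow> holomorphic_n (F i) U) \<Longrightarrow> holomorphic_n (\<lambda>z. \<Sum>i\<in>I. F i z) U"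
  by (induction I rule: finite_induct) (auto intro: holomorphic_n_const holomorphic_n_add)

lemma holomorphic_n_prod:
  "finite I \<Longrightarrow> (\<And>i. i \<in> I \<Longrightarrow> holomorphic_n (F i) U) \<Longrightarrow> holomorphic_n (\<lambda>z. \<Prod>i\<in>I. F i z) U"
  by (induction I rule: finite_induct) (auto intro: holomorphic_n_const holomorphic_n_mult)

lemma holomorphic_n_power:
  "holomorphic_n F U \<Longrightarrow> holomorphic_n (\<lambda>z. F z ^ k) U"
  by (induction k) (auto intro: holomorphic_n_const holomorphic_n_mult)

lemma holomorphic_n_poly_fun: "poly_fun_n P \<Longrightarrow> holomorphic_n P U"
proof -
  assume "poly_fun_n P"
  then obtain S c where S: "finite S" and P: "\<And>z. P z = (\<Sum>\<alpha>\<in>S. c \<alpha> * (\<Prod>j\<in>UNIV. (z$j) ^ (\<alpha> j)))"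
    unfolding poly_fun_n_def by blast
  have "P = (\<lambda>z. \<Sum>\<alpha>\<in>S. c \<alpha> * (\<Prod>j\<in>UNIV. (z$j) ^ (\<alpha> j)))" using P by auto
  then show ?thesis using S
    by (auto intro!: holomorphic_n_sum holomorphic_n_mult holomorphic_n_const
                     holomorphic_n_prod holomorphic_n_power holomorphic_n_coord)
qed

lemma holomorphic_n_continuous_at:
  "holomorphic_n F U \<Longrightarrow> z \<in> U \<Longrightarrow> continuous (at z) F"
  unfolding holomorphic_n_def using has_derivative_continuous by blast

lemma rational_on_holomorphic_n:
  assumes "rational_on U R" shows "holomorphic_n R U"
proof -
  obtain P Q where PQ: "poly_fun_n P" "poly_fun_n Q" "\<forall>z\<in>U. Q z \<noteq> 0" "\<forall>z. R z = P z / Q z"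
    using assms unfolding rational_on_def by blast
  have "holomorphic_n (\<lambda>z. P z * inverse (Q z)) U"
    using PQ by (intro holomorphic_n_mult holomorphic_n_inverse holomorphic_n_poly_fun) auto
  moreover have "R = (\<lambda>z. P z * inverse (Q z))" using PQ(4) by (auto simp: divide_inverse)
  ultimately show ?thesis by simp
qed

lemma rational_on_mono: "rational_on V R \<Longrightarrow> U \<subseteq> V \<Longrightarrow> rational_on U R"
  unfolding rational_on_def by blast

lemma continuous_on_cvec: "continuous_on UNIV (cvec :: real^'n \<Rightarrow> complex^'n)"
  unfolding cvec_def by (intro continuous_intros)

lemma poly_fun_n_continuous_on: "poly_fun_n P \<Longrightarrow> continuous_on A P"
  by (meson continuous_at_imp_continuous_on holomorphic_n_continuous_at holomorphic_n_poly_fun UNIV_I)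

lemma rational_on_borel_measurable:
  assumes "rational_on U R"
  shows "(\<lambda>x. R (cvec x :: complex^'n)) \<in> borel_measurable borel"
proof -
  obtain P Q where PQ: "poly_fun_n P" "poly_fun_n Q" "\<And>z. R z = P z / Q z"
    using assms unfolding rational_on_def by blast
  have *: "(\<lambda>x. P (cvec x)) \<in> borel_measurable borel" if "poly_fun_n P" for P :: "complex^'n \<Rightarrow> complex"
    by (rule borel_measurable_continuous_onI,
        rule continuous_on_compose2[OF poly_fun_n_continuous_on[OF that] continuous_on_cvec]) auto
  note [measurable] = *[OF PQ(1)] *[OF PQ(2)]
  show ?thesis unfolding PQ(3) by measurable
qed

text \<open>Unlike \<open>rational_on\<close>, the following notion leaves the values at the zeros of the
  denominator free, which makes it stable under sums.\<close>

definition agrees_with_rational_on :: "(complex^'n) set \<Rightarrow> (complex^'n \<Rightarrow> complex) \<Rightarrow> bool" where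
  "agrees_with_rational_on V R \<longleftrightarrow>
     (\<exists>P Q. poly_fun_n P \<and> poly_fun_n Q \<and> (\<forall>z\<in>V. Q z \<noteq> 0 \<and> R z = P z / Q z))"

lemma agrees_with_rational_onE:
  assumes "agrees_with_rational_on V R"
  obtains R' where "rational_on V R'" "\<And>z. z \<in> V \<Longrightarrow> R' z = R z"
proof -
  obtain P Q where "poly_fun_n P" "poly_fun_n Q" "\<forall>z\<in>V. Q z \<noteq> 0 \<and> R z = P z / Q z"
    using assms unfolding agrees_with_rational_on_def by blast
  then show ?thesis by (intro that[of "\<lambda>z. P z / Q z"]) (auto simp: rational_on_def)
qed

lemma agrees_mono:
  "agrees_with_rational_on V R \<Longrightarrow> U \<subseteq> V \<Longrightarrow> agrees_with_rational_on U R"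
  unfolding agrees_with_rational_on_def by blast

lemma agrees_const: "agrees_with_rational_on V (\<lambda>z. c)"
  unfolding agrees_with_rational_on_def
  by (intro exI[of _ "\<lambda>_. c"] exI[of _ "\<lambda>_. 1"]) (auto simp: poly_fun_n_const)

lemma agrees_coord: "agrees_with_rational_on V (\<lambda>z. z$k)"
  unfolding agrees_with_rational_on_def
  by (intro exI[of _ "\<lambda>z. z$k"] exI[of _ "\<lambda>_. 1"]) (auto simp: poly_fun_n_const poly_fun_n_coord)

lemma agrees_add:
  assumes "agrees_with_rational_on V R" "agrees_with_rational_on V S"
  shows "agrees_with_rational_on V (\<lambda>z. R z + S z)"
proof -
  obtain P Q where 1: "poly_fun_n P" "poly_fun_n Q" "\<forall>z\<in>V. Q z \<noteq> 0 \<and> R z = P z / Q z"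
    using assms(1) unfolding agrees_with_rational_on_def by blast
  obtain P' Q' where 2: "poly_fun_n P'" "poly_fun_n Q'" "\<forall>z\<in>V. Q' z \<noteq> 0 \<and> S z = P' z / Q' z"
    using assms(2) unfolding agrees_with_rational_on_def by blast
  show ?thesis unfolding agrees_with_rational_on_def using 1 2
    by (intro exI[of _ "\<lambda>z. P z * Q' z + P' z * Q z"] exI[of _ "\<lambda>z. Q z * Q' z"])
       (auto intro!: poly_fun_n_add poly_fun_n_mult simp: add_frac_eq)
qed

lemma agrees_mult:
  assumes "agrees_with_rational_on V R" "agrees_with_rational_on V S"
  shows "agrees_with_rational_on V (\<lambda>z. R z * S z)"
proof -
  obtain P Q where 1: "poly_fun_n P" "poly_fun_n Q" "\<forall>z\<in>V. Q z \<noteq> 0 \<and> R z = P z / Q z"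
    using assms(1) unfolding agrees_with_rational_on_def by blast
  obtain P' Q' where 2: "poly_fun_n P'" "poly_fun_n Q'" "\<forall>z\<in>V. Q' z \<noteq> 0 \<and> S z = P' z / Q' z"
    using assms(2) unfolding agrees_with_rational_on_def by blast
  show ?thesis unfolding agrees_with_rational_on_def using 1 2
    by (intro exI[of _ "\<lambda>z. P z * P' z"] exI[of _ "\<lambda>z. Q z * Q' z"])
       (auto intro!: poly_fun_n_add poly_fun_n_mult)
qed

lemma agrees_inverse:
  assumes "agrees_with_rational_on V R" "\<And>z. z \<in> V \<Longrightarrow> R z \<noteq> 0"
  shows "agrees_with_rational_on V (\<lambda>z. inverse (R z))"
proof -
  obtain P Q where 1: "poly_fun_n P" "poly_fun_n Q" "\<forall>z\<in>V. Q z \<noteq> 0 \<and> R z = P z / Q z"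
    using assms(1) unfolding agrees_with_rational_on_def by blast
  show ?thesis unfolding agrees_with_rational_on_def using 1 assms(2)
    by (intro exI[of _ Q] exI[of _ P]) fastforce
qed

lemma agrees_sum:
  "finite I \<Longrightarrow> (\<And>i. i \<in> I \<Longrightarrow> agrees_with_rational_on V (R i)) \<Longrightarrow>
     agrees_with_rational_on V (\<lambda>z. \<Sum>i\<in>I. R i z)"
  by (induction I rule: finite_induct) (auto intro: agrees_const agrees_add)

lemma agrees_prod:
  "finite I \<Longrightarrow> (\<And>i. i \<in> I \<Longrightarrow> agrees_with_rational_on V (R i)) \<Longrightarrow>
     agrees_with_rational_on V (\<lambda>z. \<Prod>i\<in>I. R i z)"
  by (induction I rule: finite_induct) (auto intro: agrees_const agrees_mult)

lemma agrees_power: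
  "agrees_with_rational_on V R \<Longrightarrow> agrees_with_rational_on V (\<lambda>z. R z ^ k)"
  by (induction k) (auto intro: agrees_const agrees_mult)

section \<open>Locally uniform limits of holomorphic functions\<close>

lemma norm_cscale: "norm (c *s v) = norm c * norm (v :: complex^'n)"
  unfolding norm_vec_def L2_set_def vector_smult_component norm_mult power_mult_distrib
  by (subst sum_distrib_left[symmetric]) (simp add: real_sqrt_mult)

text \<open>Cauchy's inequality for the restriction of \<open>F\<close> to the complex line through
  \<open>z\<close> in direction \<open>v\<close>. The disc has radius \<open>r/2\<close>, since its
  closure must lie in the open ball; this is the origin of the factor 2.\<close>

lemma holomorphic_n_derivative_bound:
  fixes F :: "complex^'n \<Rightarrow> complex"
  assumes hol: "holomorphic_n F (ball z r)" and r: "r > 0"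
    and bd: "\<And>w. w \<in> ball z r \<Longrightarrow> norm (F w) \<le> M"
    and D: "(F has_derivative D) (at z)" "\<And>c v. D (c *s v) = c * D v"
  shows "norm (D v) \<le> 2 * M / r * norm v"
proof (cases "v = 0")
  case True
  then show ?thesis using D(2)[of 0 0] by simp
next
  case False
  define u where "u = complex_of_real (inverse (norm v)) *s v"
  have nu: "norm u = 1" using False by (simp add: u_def norm_cscale norm_inverse)
  define f where "f = (\<lambda>\<zeta>. F (z + \<zeta> *s u))"
  have lin: "((\<lambda>\<zeta>. z + \<zeta> *s u) has_derivative (\<lambda>h. h *s u)) (at \<zeta>)" for \<zeta>
  proof -
    have "bounded_linear (\<lambda>h::complex. h *s u)"
      by (rule bounded_linear_intro[where K="norm u"])
         (simp_all add: vec_eq_iff algebra_simps norm_cscale)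
    from has_derivative_add[OF has_derivative_const bounded_linear_imp_has_derivative[OF this]]
    show ?thesis by simp
  qed
  have fder: "(f has_field_derivative E u) (at \<zeta>)"
    if "(F has_derivative E) (at (z + \<zeta> *s u))" "\<forall>c v. E (c *s v) = c * E v" for \<zeta> E
  proof -
    from diff_chain_at[OF lin that(1)]
    have "(f has_derivative (\<lambda>h. E (h *s u))) (at \<zeta>)" by (simp add: f_def o_def)
    then show ?thesis unfolding has_field_derivative_def using that(2)
      by (simp add: mult.commute[of _ "E u"])
  qed
  have inb: "z + \<zeta> *s u \<in> ball z r" if "norm \<zeta> < r" for \<zeta>
    using that nu by (simp add: dist_norm norm_cscale)
  have fhol: "f holomorphic_on ball 0 r"
    unfolding holomorphic_on_def
  proof
    fix \<zeta> :: complex assume "\<zeta> \<in> ball 0 r"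
    then have "z + \<zeta> *s u \<in> ball z r" using inb by simp
    then obtain E where "(F has_derivative E) (at (z + \<zeta> *s u))" "\<forall>c v. E (c *s v) = c * E v"
      using hol unfolding holomorphic_n_def by blast
    from fder[OF this] show "f field_differentiable at \<zeta> within ball 0 r"
      by (meson field_differentiable_at_within field_differentiable_def)
  qed
  have "norm ((deriv ^^ 1) f 0) \<le> fact 1 * M / (r/2) ^ 1"
  proof (rule Cauchy_inequality)
    show "f holomorphic_on ball 0 (r/2)" by (rule holomorphic_on_subset[OF fhol]) (use r in auto)
    show "continuous_on (cball 0 (r/2)) f"
      by (rule holomorphic_on_imp_continuous_on, rule holomorphic_on_subset[OF fhol]) (use r in auto)
    show "cmod (f x) \<le> M" if "cmod (0 - x) = r/2" for x
      unfolding f_def using bd inb that r by simp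
  qed (use r in auto)
  moreover have "deriv f 0 = D u"
    using fder[of D 0] D by (simp add: DERIV_imp_deriv)
  ultimately have Du: "norm (D u) \<le> 2 * M / r" by (simp add: mult.commute)
  have "v = complex_of_real (norm v) *s u" using False by (simp add: u_def vec_eq_iff)
  then have "norm (D v) = norm v * norm (D u)" using D(2) by (metis abs_norm_cancel norm_mult norm_of_real)
  then show ?thesis using mult_left_mono[OF Du, of "norm v"] by (simp add: mult.commute)
qed

text \<open>Weierstrass' theorem by termwise differentiation: Cauchy's bound turns the majorant of
  the terms into a summable majorant of their derivatives, and complex homogeneity passes to the
  sum. The centre of the ball is enough, since holomorphy is a pointwise condition and each point of
  a tube can be made a centre.\<close>

lemma holomorphic_n_suminf:
  fixes R :: "nat \<Rightarrow> complex^'n \<Rightarrow> complex"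
  assumes hol: "\<And>k. holomorphic_n (R k) (ball z0 r)" and r: "r > 0"
    and bd: "\<And>k w. w \<in> ball z0 r \<Longrightarrow> norm (R k w) \<le> M k" and M: "summable M"
  shows "holomorphic_n (\<lambda>z. \<Sum>k. R k z) {z0}"
proof -
  have "\<forall>k. \<forall>z\<in>ball z0 r. \<exists>D. (R k has_derivative D) (at z) \<and> (\<forall>c v. D (c *s v) = c * D v)"
    using hol unfolding holomorphic_n_def by blast
  then obtain D where D: "\<And>k z. z \<in> ball z0 r \<Longrightarrow> (R k has_derivative D k z) (at z)"
     "\<And>k z c v. z \<in> ball z0 r \<Longrightarrow> D k z (c *s v) = c * D k z v" by metis
  \<comment> \<open>Every point of the half ball has a ball of radius \<open>r/2\<close> inside the
    given one, so the derivative bound there is \<open>2 * M k / (r/2)\<close>, which is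
    \<open>K k\<close>.\<close>
  define S where "S = ball z0 (r/2)"
  have Sr: "ball z (r/2) \<subseteq> ball z0 r" if "z \<in> S" for z
  proof
    fix x assume "x \<in> ball z (r/2)"
    then show "x \<in> ball z0 r"
      using that dist_triangle[of z0 x z] unfolding S_def by simp
  qed
  have SS: "S \<subseteq> ball z0 r" using r by (auto simp: S_def)
  define K where "K k = 4 * M k / r" for k
  have Dbd: "norm (D k z v) \<le> K k * norm v" if "z \<in> S" for k z v
  proof -
    have "norm (D k z v) \<le> 2 * M k / (r/2) * norm v"
      by (rule holomorphic_n_derivative_bound[where F="R k" and z=z])
         (use hol Sr[OF that] bd D SS that r in \<open>auto simp: holomorphic_n_def\<close>)
    then show ?thesis by (simp add: K_def)
  qed
  have K: "summable K" unfolding K_def using M by (intro summable_divide summable_mult)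
  have sD: "summable (\<lambda>k. D k z v)" if "z \<in> S" for z v
    by (rule summable_comparison_test'[OF summable_mult2[OF K, of "norm v"]]) (use Dbd that in auto)
  define g' where "g' z v = (\<Sum>k. D k z v)" for z v
  have tail: "norm ((\<Sum>i<n. D i z h) - g' z h) \<le> (\<Sum>i. K (i + n)) * norm h" if "z \<in> S" for n z h
  proof -
    have sK: "summable (\<lambda>i. K (i + n) * norm h)" using K by (simp add: summable_mult2)
    have "g' z h - (\<Sum>i<n. D i z h) = (\<Sum>i. D (i + n) z h)"
      unfolding g'_def by (rule suminf_minus_initial_segment[OF sD[OF that], symmetric])
    moreover have "norm (\<Sum>i. D (i + n) z h) \<le> (\<Sum>i. K (i + n) * norm h)"
      by (rule norm_suminf_le[OF _ sK]) (use Dbd that in auto)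
    ultimately show ?thesis using K by (simp add: norm_minus_commute suminf_mult2)
  qed
  have ev: "\<forall>\<^sub>F n in sequentially. \<forall>x\<in>S. \<forall>h. norm ((\<Sum>i<n. D i x h) - g' x h) \<le> e * norm h"
    if e: "e > 0" for e
  proof -
    have "(\<lambda>n. \<Sum>i. K (i + n)) \<longlonglongrightarrow> 0" using suminf_exist_split2[OF K] .
    then have "\<forall>\<^sub>F n in sequentially. (\<Sum>i. K (i + n)) < e" using e order_tendstoD(2) by blast
    then show ?thesis
    proof eventually_elim
      case (elim n)
      then show ?case
        by (intro ballI allI order_trans[OF tail]) (auto intro: mult_right_mono)
    qed
  qed
  have sR: "summable (\<lambda>k. R k z)" if "z \<in> ball z0 r" for z
    by (rule summable_comparison_test'[OF M]) (use bd that in auto)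
  have z0: "z0 \<in> S" using r by (simp add: S_def)
  have "\<exists>g. \<forall>x\<in>S. (\<lambda>n. R n x) sums (g x) \<and> (g has_derivative g' x) (at x within S)"
  proof (rule has_derivative_series[OF _ _ ev])
    show "convex S" by (simp add: S_def)
    show "(R n has_derivative D n x) (at x within S)" if "x \<in> S" for n x
      using D(1) that SS by (blast intro: has_derivative_at_withinI)
    show "z0 \<in> S" by fact
    show "(\<lambda>n. R n z0) sums (\<Sum>n. R n z0)" using sR[of z0] r by (simp add: summable_sums)
  qed
  then obtain g where g: "\<And>x. x \<in> S \<Longrightarrow> (\<lambda>n. R n x) sums (g x)"
     "\<And>x. x \<in> S \<Longrightarrow> (g has_derivative g' x) (at x within S)" by blast
  have "(g has_derivative g' z0) (at z0)"
    using g(2)[OF z0] at_within_open[OF z0] unfolding S_def by (metis open_ball)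
  then have "((\<lambda>z. \<Sum>k. R k z) has_derivative g' z0) (at z0)"
  proof (rule has_derivative_transform_within_open)
    show "open S" by (simp add: S_def)
    show "z0 \<in> S" by fact
    show "g z = (\<Sum>k. R k z)" if "z \<in> S" for z using g(1)[OF that] by (rule sums_unique)
  qed
  moreover have "g' z0 (c *s v) = c * g' z0 v" for c v
  proof -
    have "g' z0 (c *s v) = (\<Sum>k. c * D k z0 v)" unfolding g'_def using D(2)[of z0] r by simp
    also have "\<dots> = c * g' z0 v" unfolding g'_def by (rule suminf_mult[OF sD[OF z0]])
    finally show ?thesis .
  qed
  ultimately show ?thesis unfolding holomorphic_n_def by blast
qed

section \<open>Subadditivity of powers with exponent at most one\<close>

text \<open>After division by \<open>a + b\<close> the two terms lie in [0,1], where
  \<open>x \<le> x powr p\<close>, and they add up to 1.\<close>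

lemma powr_add_le:
  fixes a b p :: real
  assumes "0 < p" "p \<le> 1" "0 \<le> a" "0 \<le> b"
  shows "(a + b) powr p \<le> a powr p + b powr p"
proof (cases "a + b = 0")
  case True
  then show ?thesis using assms by auto
next
  case False
  define s where "s = a + b"
  have s: "s > 0" using False assms by (simp add: s_def)
  have 1: "x \<le> x powr p" if "0 \<le> x" "x \<le> 1" for x :: real
    using powr_mono'[of p 1 x] that assms by (cases "x = 0") auto
  have "1 = a / s + b / s" using s by (simp add: s_def flip: add_divide_distrib)
  also have "\<dots> \<le> (a / s) powr p + (b / s) powr p"
    using assms s by (intro add_mono 1) (auto simp: s_def)
  also have "\<dots> = (a powr p + b powr p) / s powr p"
    using assms s by (simp add: powr_divide add_divide_distrib)
  finally show ?thesis using s by (simp add: s_def field_simps)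
qed

lemma powr_sum_le:
  fixes a :: "'i \<Rightarrow> real"
  assumes "0 < p" "p \<le> 1" "finite I" "\<And>i. i \<in> I \<Longrightarrow> 0 \<le> a i"
  shows "(\<Sum>i\<in>I. a i) powr p \<le> (\<Sum>i\<in>I. a i powr p)"
  using assms(3,4)
proof (induction I rule: finite_induct)
  case (insert i I)
  then show ?case
    using powr_add_le[OF assms(1,2), of "a i" "\<Sum>i\<in>I. a i"] by (force intro: sum_nonneg)
qed simp

section \<open>One-dimensional integrals\<close>

text \<open>Folding the line at \<open>a\<close> reduces integrals in the distance to
  \<open>a\<close> to the half-line, where antiderivatives are available. Only the point
  \<open>a\<close> is counted twice.\<close>

lemma nn_integral_abs_le:
  fixes f :: "real \<Rightarrow> ennreal"
  assumes [measurable]: "f \<in> borel_measurable borel"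
  shows "(\<integral>\<^sup>+x. f \<bar>x - a\<bar> \<partial>lborel) \<le> 2 * (\<integral>\<^sup>+x. f x * indicator {0..} x \<partial>lborel)"
proof -
  let ?g = "\<lambda>x. f x * indicator {0..} x"
  have "(\<integral>\<^sup>+x. f \<bar>x - a\<bar> \<partial>lborel) \<le> (\<integral>\<^sup>+x. ?g (x - a) + ?g (a - x) \<partial>lborel)"
    by (rule nn_integral_mono) (auto split: split_indicator simp: abs_if)
  also have "\<dots> = (\<integral>\<^sup>+x. ?g (x - a) \<partial>lborel) + (\<integral>\<^sup>+x. ?g (a - x) \<partial>lborel)"
    by (rule nn_integral_add) auto
  also have "(\<integral>\<^sup>+x. ?g (x - a) \<partial>lborel) = (\<integral>\<^sup>+x. ?g x \<partial>lborel)"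
    using nn_integral_real_affine[of ?g 1 "-a"] by simp
  also have "(\<integral>\<^sup>+x. ?g (a - x) \<partial>lborel) = (\<integral>\<^sup>+x. ?g x \<partial>lborel)"
    using nn_integral_real_affine[of ?g "-1" a] by simp
  finally show ?thesis by (simp add: mult_2)
qed

lemma nn_integral_powr_decay:
  fixes q :: real
  assumes "q > 1"
  shows "(\<integral>\<^sup>+x. ennreal ((1 + \<bar>x\<bar>) powr (-q)) \<partial>lborel) < \<infinity>"
proof -
  let ?F = "\<lambda>x. (1 + x) powr (1 - q) / (1 - q)"
  have "(\<integral>\<^sup>+x. ennreal (if x < 0 then 0 else (1 + x) powr (-q)) * indicator {0..} x \<partial>lborel) = 0 - ?F 0"
  proof (rule nn_integral_FTC_atLeast[where F="?F"])
    show "(?F \<longlongrightarrow> 0) at_top"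
      using assms
      by (intro tendsto_divide_zero tendsto_neg_powr filterlim_tendsto_add_at_top[OF tendsto_const])
         (auto intro: filterlim_ident)
    show "DERIV ?F x :> (if x < 0 then 0 else (1 + x) powr (-q))" if "0 \<le> x" for x
      using that assms by (auto intro!: derivative_eq_intros)
  qed auto
  then have "(\<integral>\<^sup>+x. ennreal (if x < 0 then 0 else (1 + x) powr (-q)) * indicator {0..} x \<partial>lborel) < \<infinity>"
    by simp
  moreover have "(\<integral>\<^sup>+x. ennreal ((1 + \<bar>x\<bar>) powr (-q)) \<partial>lborel)
     = (\<integral>\<^sup>+x. ennreal (if \<bar>x - 0\<bar> < 0 then 0 else (1 + \<bar>x - 0\<bar>) powr (-q)) \<partial>lborel)"
    by simp
  ultimately show ?thesis
    using nn_integral_abs_le[of "\<lambda>x. ennreal (if x < 0 then 0 else (1 + x) powr (-q))" 0]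
    by (simp add: ennreal_mult_less_top le_less_trans)
qed

text \<open>Within distance 1 of \<open>a\<close> the decaying factor is at most 1 and the
  singularity is integrable because p < 1; farther away the singular factor is at most 1 and the
  decay is integrable because q > 1.\<close>

lemma nn_integral_powr_singularity:
  fixes p q a :: real
  assumes "0 < p" "p < 1" "q > 1"
  shows "(\<integral>\<^sup>+x. ennreal (\<bar>x - a\<bar> powr (-p) * (1 + \<bar>x\<bar>) powr (-q)) \<partial>lborel) < \<infinity>"
proof -
  let ?h = "\<lambda>x::real. ennreal (x powr (-p) * indicator {..1} x)"
  have "(\<integral>\<^sup>+x. ?h x * indicator {0..} x \<partial>lborel) = (\<integral>\<^sup>+x. ennreal (indicator {0..1} x * x powr (-p)) \<partial>lborel)"
    by (rule nn_integral_cong) (auto split: split_indicator)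
  also have "\<dots> = 1 powr (-p + 1) / (-p + 1)"
    using assms by (intro nn_integral_has_integral_lebesgue has_integral_powr_from_0) auto
  also have "\<dots> < \<infinity>" by simp
  finally have 1: "(\<integral>\<^sup>+x. ?h \<bar>x - a\<bar> \<partial>lborel) < \<infinity>"
    using nn_integral_abs_le[of ?h a] by (simp add: ennreal_mult_less_top le_less_trans)
  have "(\<integral>\<^sup>+x. ennreal (\<bar>x - a\<bar> powr (-p) * (1 + \<bar>x\<bar>) powr (-q)) \<partial>lborel)
     \<le> (\<integral>\<^sup>+x. ?h \<bar>x - a\<bar> + ennreal ((1 + \<bar>x\<bar>) powr (-q)) \<partial>lborel)"
  proof (rule nn_integral_mono)
    fix x :: real
    have b: "(1 + \<bar>x\<bar>) powr (-q) \<le> 1" using assms by (auto simp: powr_minus inverse_le_1_iff ge_one_powr_ge_zero)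
    show "ennreal (\<bar>x - a\<bar> powr (-p) * (1 + \<bar>x\<bar>) powr (-q)) \<le> ?h \<bar>x - a\<bar> + ennreal ((1 + \<bar>x\<bar>) powr (-q))"
    proof (cases "\<bar>x - a\<bar> \<le> 1")
      case True
      then have "\<bar>x - a\<bar> powr (-p) * (1 + \<bar>x\<bar>) powr (-q) \<le> \<bar>x - a\<bar> powr (-p) * indicator {..1} \<bar>x - a\<bar>"
        using mult_left_mono[OF b, of "\<bar>x - a\<bar> powr (-p)"] by simp
      then show ?thesis by (metis add_increasing2 ennreal_leI zero_le)
    next
      case False
      then have "\<bar>x - a\<bar> powr (-p) \<le> 1"
        using assms by (auto simp: powr_minus inverse_le_1_iff ge_one_powr_ge_zero)
      then have "\<bar>x - a\<bar> powr (-p) * (1 + \<bar>x\<bar>) powr (-q) \<le> (1 + \<bar>x\<bar>) powr (-q)"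
        by (simp add: mult_left_le_one_le)
      then show ?thesis by (metis add_increasing ennreal_leI zero_le)
    qed
  qed
  also have "\<dots> = (\<integral>\<^sup>+x. ?h \<bar>x - a\<bar> \<partial>lborel) + (\<integral>\<^sup>+x. ennreal ((1 + \<bar>x\<bar>) powr (-q)) \<partial>lborel)"
    by (rule nn_integral_add) auto
  also have "\<dots> < \<infinity>" using 1 nn_integral_powr_decay[OF assms(3)] by simp
  finally show ?thesis .
qed

text \<open>A partial fraction decomposition as an inequality: for distinct poles a and b, the
  triangle inequality gives 1/(uv) \<le> (1/u + 1/v)/|a - b|, where u and v are the distances from
  x. Only first powers of inverse distances survive, which keeps the singularities
  p-integrable.\<close>

lemma inverse_prod_le_sum:
  fixes Z :: "real set"
  assumes "finite Z"
  shows "\<exists>K\<ge>0. \<forall>x. inverse (\<Prod>a\<in>Z. \<bar>x - a\<bar>) \<le> K * (1 + (\<Sum>a\<in>Z. inverse \<bar>x - a\<bar>))"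
  using assms
proof (induction Z rule: finite_induct)
  case empty
  show ?case by (intro exI[of _ 1]) simp
next
  case (insert b Z)
  then obtain K where K: "K \<ge> 0" "\<And>x. inverse (\<Prod>a\<in>Z. \<bar>x - a\<bar>) \<le> K * (1 + (\<Sum>a\<in>Z. inverse \<bar>x - a\<bar>))"
    by blast
  \<comment> \<open>\<open>L\<close> dominates all \<open>inverse \<bar>a - b\<bar>\<close>; the
    summand 1 lets it also absorb the lone term \<open>?i\<close> below. \<open>N\<close> counts the
    occurrences of \<open>?i\<close>: one by itself and one for each element of
    \<open>Z\<close>.\<close>
  define L where "L = 1 + (\<Sum>a\<in>Z. inverse \<bar>a - b\<bar>)"
  have L: "L \<ge> 1" "\<And>a. a \<in> Z \<Longrightarrow> inverse \<bar>a - b\<bar> \<le> L"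
    using insert(1) unfolding L_def
    by (auto intro!: sum_nonneg order_trans[OF member_le_sum[of _ Z "\<lambda>a. inverse \<bar>a - b\<bar>"]])
  define N where "N = 1 + real (card Z)"
  show ?case
  proof (intro exI[of _ "K * (L * N)"] conjI allI)
    show "0 \<le> K * (L * N)" using K L by (simp add: N_def)
    fix x
    let ?S = "\<Sum>a\<in>Z. inverse \<bar>x - a\<bar>" and ?i = "inverse \<bar>x - b\<bar>"
    \<comment> \<open>At \<open>x = a\<close> or \<open>x = b\<close> the left side is 0, because
      \<open>inverse 0 = 0\<close>; elsewhere this is the two-pole case.\<close>
    have summand: "inverse \<bar>x - a\<bar> * ?i \<le> L * (inverse \<bar>x - a\<bar> + ?i)" if a: "a \<in> Z" for a
    proof (cases "x = a \<or> x = b")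
      case True
      then show ?thesis using L by (auto intro!: mult_nonneg_nonneg)
    next
      case False
      have ab: "a \<noteq> b" using a insert by auto
      have "\<bar>a - b\<bar> \<le> \<bar>x - a\<bar> + \<bar>x - b\<bar>" by linarith
      then have "inverse \<bar>x - a\<bar> * ?i \<le> inverse \<bar>a - b\<bar> * (inverse \<bar>x - a\<bar> + ?i)"
        using False ab by (simp add: field_simps)
      also have "\<dots> \<le> L * (inverse \<bar>x - a\<bar> + ?i)" using L(2)[OF a] by (intro mult_right_mono) auto
      finally show ?thesis .
    qed
    have "?S * ?i \<le> (\<Sum>a\<in>Z. L * (inverse \<bar>x - a\<bar> + ?i))"
      unfolding sum_distrib_right by (intro sum_mono summand)
    also have "\<dots> = L * (?S + real (card Z) * ?i)" by (simp add: sum.distrib flip: sum_distrib_left)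
    finally have S: "?S * ?i \<le> L * (?S + real (card Z) * ?i)" .
    have S0: "?S \<ge> 0" by (auto intro: sum_nonneg)
    have "inverse (\<Prod>a\<in>insert b Z. \<bar>x - a\<bar>) = inverse (\<Prod>a\<in>Z. \<bar>x - a\<bar>) * ?i"
      using insert by simp
    also have "\<dots> \<le> (K * (1 + ?S)) * ?i" by (intro mult_right_mono K) auto
    also have "\<dots> = K * (?i + ?S * ?i)" by (simp add: algebra_simps)
    also have "\<dots> \<le> K * (L * ?i + L * (?S + real (card Z) * ?i))"
      using S L(1) by (intro mult_left_mono[OF _ K(1)] add_mono) (auto simp: mult_le_cancel_right1)
    also have "\<dots> = K * (L * (?S + N * ?i))" by (simp add: N_def algebra_simps)
    also have "\<dots> \<le> K * (L * (N * ?S + N * ?i + N))"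
      using K(1) L(1) S0 by (intro mult_left_mono) (auto simp: N_def mult_le_cancel_right1 algebra_simps)
    also have "\<dots> = K * (L * N) * (1 + (\<Sum>a\<in>insert b Z. inverse \<bar>x - a\<bar>))"
      using insert by (simp add: algebra_simps)
    finally show "inverse (\<Prod>a\<in>insert b Z. \<bar>x - a\<bar>) \<le> \<dots>" .
  qed
qed

section \<open>The one-dimensional kernels\<close>

text \<open>On the real line this is twice the real part of (x + i)^j. With x = cot \<theta> it
  equals 2 cos(j \<theta>) / sin(\<theta>)^j, which shows its j simple real zeros.\<close>

definition real_pole_poly :: "nat \<Rightarrow> complex \<Rightarrow> complex" where
  "real_pole_poly j z = (z - \<i>) ^ j + (z + \<i>) ^ j"

text \<open>The sign \<open>\<sigma>\<close> names the half plane of holomorphy: the non-real pole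
  \<open>-\<sigma> * \<i>\<close> lies in the opposite one.\<close>

definition half_plane_kernel :: "real \<Rightarrow> nat \<Rightarrow> complex \<Rightarrow> complex" where
  "half_plane_kernel \<sigma> j z = inverse ((z + complex_of_real \<sigma> * \<i>) ^ j * real_pole_poly j z)"

text \<open>Since |x + i| = |x - i| is comparable to 1 + |x|, this is, up to constants, the modulus
  of both kernels on the real line.\<close>

definition kernel_majorant :: "nat \<Rightarrow> real \<Rightarrow> real" where
  "kernel_majorant j x = inverse ((1 + \<bar>x\<bar>) ^ j * norm (real_pole_poly j (complex_of_real x)))"

text \<open>At a zero the two powers have equal modulus, so z is equidistant from i and -i.\<close>

lemma real_pole_poly_zero_imp_real:
  assumes "j \<ge> 1" "real_pole_poly j z = 0"
  shows "Im z = 0"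
proof -
  have "(z - \<i>) ^ j = - ((z + \<i>) ^ j)"
    using assms(2) by (simp add: real_pole_poly_def add_eq_0_iff2)
  then have "norm (z - \<i>) ^ j = norm (z + \<i>) ^ j"
    by (metis norm_minus_cancel norm_power)
  then have "norm (z - \<i>) = norm (z + \<i>)"
    using assms(1) power_eq_imp_eq_base[of "norm (z - \<i>)" j] by simp
  then have "norm (z - \<i>) ^ 2 = norm (z + \<i>) ^ 2" by simp
  then show ?thesis unfolding cmod_power2 by (simp add: power2_eq_square algebra_simps)
qed

text \<open>The zeros are simple because the derivative of D_j is j D_(j-1). If both vanish at a,
  with k = j - 1, then (a - i)^k = -(a + i)^k, and inserting this into D_j(a) = 0 leaves 2i (a +
  i)^k = 0. So both powers vanish, which would force a = -i and a = i. Real zeros then allow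
  \<open>Z\<close> to be a set of reals.\<close>

lemma real_pole_poly_factor:
  assumes "j \<ge> 1"
  obtains c Z where "c \<noteq> 0" "finite Z" "card Z \<le> j"
    "\<And>z. real_pole_poly j z = c * (\<Prod>a\<in>Z. z - complex_of_real a)"
proof -
  define p :: "complex poly" where "p = [:-\<i>, 1:] ^ j + [:\<i>, 1:] ^ j"
  have pz: "poly p z = real_pole_poly j z" for z by (simp add: p_def real_pole_poly_def add.commute)
  obtain k where k: "j = Suc k" using assms by (cases j) auto
  have "rsquarefree p" unfolding rsquarefree_roots
  proof (intro allI notI)
    fix a assume "poly p a = 0 \<and> poly (pderiv p) a = 0"
    then have 0: "poly p a = 0" "poly (pderiv p) a = 0" by auto
    have 1: "(a - \<i>) ^ k * (a - \<i>) + (a + \<i>) ^ k * (a + \<i>) = 0"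
      using 0(1) unfolding pz by (simp add: real_pole_poly_def k mult.commute)
    have "pderiv p = smult (of_nat (Suc k)) ([:-\<i>, 1:] ^ k + [:\<i>, 1:] ^ k)"
      unfolding p_def k pderiv_add pderiv_power_Suc
      by (simp add: pderiv_pCons smult_add_right del: of_nat_Suc)
    then have "of_nat (Suc k) * ((a - \<i>) ^ k + (a + \<i>) ^ k) = 0"
      using 0(2) by (simp add: add.commute del: of_nat_Suc)
    then have 2: "(a - \<i>) ^ k + (a + \<i>) ^ k = 0" using of_nat_neq_0 mult_eq_0_iff by blast
    then have e: "(a - \<i>) ^ k = - ((a + \<i>) ^ k)" by (simp add: add_eq_0_iff2)
    have "(a + \<i>) ^ k * (2 * \<i>) = 0" using 1 unfolding e by (simp add: algebra_simps)
    then have "(a + \<i>) ^ k = 0" by simp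
    moreover from this e have "(a - \<i>) ^ k = 0" by simp
    ultimately have "a + \<i> = 0" "a - \<i> = 0" using power_eq_0_iff by blast+
    then show False by (simp add: complex_eq_iff)
  qed
  from complex_poly_decompose_rsquarefree[OF this]
  have dec: "p = smult (lead_coeff p) (\<Prod>z|poly p z = 0. [:-z, 1:])" by simp
  have p0: "p \<noteq> 0" using \<open>rsquarefree p\<close> by (simp add: rsquarefree_def)
  let ?Z = "{z. poly p z = 0}"
  have fin: "finite ?Z" using p0 by (rule poly_roots_finite)
  have re: "complex_of_real (Re z) = z" if "z \<in> ?Z" for z
    using real_pole_poly_zero_imp_real[OF assms, of z] that by (simp add: pz complex_eq_iff)
  have inj: "inj_on Re ?Z" by (rule inj_onI) (metis re)
  show ?thesis
  proof
    show "lead_coeff p \<noteq> 0" using p0 by simp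
    show "finite (Re ` ?Z)" using fin by simp
    have "card (Re ` ?Z) \<le> card ?Z" using fin by (rule card_image_le)
    also have "\<dots> \<le> degree p" using p0 by (rule card_poly_roots_bound)
    also have "\<dots> \<le> j" unfolding p_def
      by (rule degree_add_le) (simp_all add: degree_linear_power)
    finally show "card (Re ` ?Z) \<le> j" .
    fix z
    have "(\<Prod>a\<in>Re`?Z. z - complex_of_real a) = (\<Prod>a\<in>?Z. z - complex_of_real (Re a))"
      by (subst prod.reindex[OF inj]) simp
    also have "\<dots> = (\<Prod>a\<in>?Z. z - a)" by (intro prod.cong) (auto simp: re)
    finally show "real_pole_poly j z = lead_coeff p * (\<Prod>a\<in>Re`?Z. z - complex_of_real a)"
      unfolding pz[symmetric] using arg_cong[OF dec, of "\<lambda>q. poly q z"] by (simp add: poly_prod)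
  qed
qed

lemma finite_real_poles:
  assumes "j \<ge> 1"
  shows "finite {x. real_pole_poly j (complex_of_real x) = 0}"
proof -
  obtain c Z where "c \<noteq> 0" "finite Z"
    "\<And>z. real_pole_poly j z = c * (\<Prod>a\<in>Z. z - complex_of_real a)"
    using real_pole_poly_factor[OF assms] by metis
  then show ?thesis by (auto intro: rev_finite_subset)
qed

text \<open>The identity 1/(A(A+B)) + 1/(B(A+B)) = 1/(AB) with A = (x + i)^j and B = (x - i)^j,
  whose product is (1 + x^2)^j.\<close>

lemma half_plane_kernel_sum:
  assumes "real_pole_poly j (complex_of_real x) \<noteq> 0"
  shows "half_plane_kernel 1 j (complex_of_real x) + half_plane_kernel (-1) j (complex_of_real x)
    = complex_of_real (inverse (1 + x\<^sup>2) ^ j)"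
proof -
  let ?A = "(complex_of_real x + \<i>) ^ j" and ?B = "(complex_of_real x - \<i>) ^ j"
  have nz: "complex_of_real x + \<i> \<noteq> 0" "complex_of_real x - \<i> \<noteq> 0"
    by (auto simp: complex_eq_iff)
  have AB: "?A * ?B = complex_of_real ((1 + x\<^sup>2) ^ j)"
    by (simp add: power2_eq_square algebra_simps flip: power_mult_distrib)
  have "half_plane_kernel 1 j x + half_plane_kernel (-1) j x
     = inverse (?A * (?B + ?A)) + inverse (?B * (?B + ?A))"
    by (simp add: half_plane_kernel_def real_pole_poly_def)
  also have "\<dots> = inverse (?A * ?B)"
    using nz assms unfolding real_pole_poly_def by (simp add: divide_simps)
  finally show ?thesis unfolding AB by (simp add: power_inverse)
qed

text \<open>Every linear factor of the denominator shrinks by at most \<open>2 + \<alpha>\<close>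
  when x is replaced by a point of the cone over x. There are j factors from the power and
  \<open>card Z \<le> j\<close> from the zeros, hence the exponent \<open>2 * j\<close>.\<close>

lemma half_plane_kernel_cone_bound:
  assumes j: "j \<ge> 1" and \<sigma>: "\<sigma> = 1 \<or> \<sigma> = -1" and \<alpha>: "\<alpha> > 0"
    and z: "\<sigma> * Im z > 0" "\<bar>Re z - x\<bar> < \<alpha> * (\<sigma> * Im z)"
    and nz: "real_pole_poly j (complex_of_real x) \<noteq> 0"
  shows "norm (half_plane_kernel \<sigma> j z) \<le> (2 + \<alpha>) ^ (2 * j) * kernel_majorant j x"
proof -
  obtain c Z where Z: "c \<noteq> 0" "finite Z" "card Z \<le> j"
    "\<And>z. real_pole_poly j z = c * (\<Prod>a\<in>Z. z - complex_of_real a)"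
    using real_pole_poly_factor[OF j] by metis
  have im: "\<sigma> * Im z = \<bar>Im z\<bar>" using \<sigma> z(1) by auto
  have "Im (z + of_real \<sigma> * \<i>) = Im z + \<sigma>" by simp
  \<comment> \<open>Here the sign matters: \<open>Im z\<close> and \<open>\<sigma>\<close> have the
    same sign, so their moduli add.\<close>
  then have "\<bar>Im z\<bar> + 1 \<le> norm (z + of_real \<sigma> * \<i>)"
    using abs_Im_le_cmod[of "z + of_real \<sigma> * \<i>"] \<sigma> z(1) by auto
  moreover have "\<bar>Re z\<bar> \<le> norm (z + of_real \<sigma> * \<i>)"
    using abs_Re_le_cmod[of "z + of_real \<sigma> * \<i>"] by simp
  moreover have "1 + \<alpha> * \<bar>Im z\<bar> \<le> (1 + \<alpha>) * (\<bar>Im z\<bar> + 1)" using \<alpha> by (simp add: algebra_simps)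
  moreover have "(1 + \<alpha>) * (\<bar>Im z\<bar> + 1) \<le> (1 + \<alpha>) * norm (z + of_real \<sigma> * \<i>)"
    using calculation(1) \<alpha> by (intro mult_left_mono) auto
  ultimately have 1: "1 + \<bar>x\<bar> \<le> (2 + \<alpha>) * norm (z + of_real \<sigma> * \<i>)"
    using z(2) unfolding im by (simp add: algebra_simps)
  \<comment> \<open>The distance from x to Re z is below \<alpha> |Im z|, and both |Im z| and |Re z
    - a| are at most |z - a|.\<close>
  have 2: "\<bar>x - a\<bar> \<le> (2 + \<alpha>) * norm (z - complex_of_real a)" for a
  proof -
    have "\<bar>Im z\<bar> \<le> norm (z - complex_of_real a)" "\<bar>Re z - a\<bar> \<le> norm (z - complex_of_real a)"
      using abs_Im_le_cmod[of "z - complex_of_real a"] abs_Re_le_cmod[of "z - complex_of_real a"] by auto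
    moreover from this(1) have "\<alpha> * \<bar>Im z\<bar> \<le> \<alpha> * norm (z - complex_of_real a)"
      using \<alpha> by (intro mult_left_mono) auto
    moreover have "0 \<le> norm (z - complex_of_real a)" by simp
    ultimately show ?thesis using z(2) unfolding im distrib_right by linarith
  qed
  have "norm (real_pole_poly j (complex_of_real x)) = norm c * (\<Prod>a\<in>Z. \<bar>x - a\<bar>)"
    unfolding Z(4) norm_mult prod_norm[symmetric] by (simp flip: of_real_diff)
  also have "\<dots> \<le> norm c * (\<Prod>a\<in>Z. (2 + \<alpha>) * norm (z - complex_of_real a))"
    by (intro mult_left_mono prod_mono) (auto simp: 2)
  also have "\<dots> = (2 + \<alpha>) ^ card Z * norm (real_pole_poly j z)"
    unfolding Z(4) norm_mult prod_norm[symmetric] prod.distrib by (simp add: Z(2))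
  also have "\<dots> \<le> (2 + \<alpha>) ^ j * norm (real_pole_poly j z)"
    using Z(3) \<alpha> by (intro mult_right_mono power_increasing) auto
  finally have 3: "norm (real_pole_poly j (complex_of_real x)) \<le> (2 + \<alpha>) ^ j * norm (real_pole_poly j z)" .
  let ?m = "(1 + \<bar>x\<bar>) ^ j * norm (real_pole_poly j (complex_of_real x))"
  let ?n = "norm ((z + complex_of_real \<sigma> * \<i>) ^ j * real_pole_poly j z)"
  have "?m \<le> ((2 + \<alpha>) * norm (z + of_real \<sigma> * \<i>)) ^ j * ((2 + \<alpha>) ^ j * norm (real_pole_poly j z))"
    by (intro mult_mono power_mono 1 3) (use \<alpha> in auto)
  also have "\<dots> = (2 + \<alpha>) ^ (2 * j) * ?n"
    by (simp add: norm_mult norm_power power_mult_distrib mult_2 power_add)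
  finally have mn: "?m \<le> (2 + \<alpha>) ^ (2 * j) * ?n" .
  have m: "?m > 0" using nz by auto
  \<comment> \<open>The denominator at z cannot vanish, because a multiple of it dominates the
    positive number \<open>?m\<close>.\<close>
  have n: "?n > 0"
  proof (rule ccontr)
    assume "\<not> ?n > 0"
    then have "?n = 0" using norm_ge_zero by (meson antisym not_less)
    with mn have "?m \<le> 0" by (simp only: mult_zero_right)
    then show False using m by simp
  qed
  have "norm (half_plane_kernel \<sigma> j z) = 1 / ?n"
    unfolding half_plane_kernel_def norm_inverse by (rule inverse_eq_divide)
  also have "\<dots> \<le> (2 + \<alpha>) ^ (2 * j) / ?m"
    using mn m n by (subst frac_le_eq) (auto simp: divide_le_0_iff mult_less_0_iff)
  finally show ?thesis by (simp add: kernel_majorant_def divide_inverse)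
qed

lemma borel_measurable_kernel_majorant [measurable]: "kernel_majorant j \<in> borel_measurable borel"
proof -
  have "continuous_on UNIV (\<lambda>x. norm (real_pole_poly j (complex_of_real x)))"
    unfolding real_pole_poly_def by (intro continuous_intros)
  then have [measurable]: "(\<lambda>x. norm (real_pole_poly j (complex_of_real x))) \<in> borel_measurable borel"
    by (rule borel_measurable_continuous_onI)
  show ?thesis unfolding kernel_majorant_def[abs_def] by measurable
qed

lemma kernel_majorant_nonneg: "kernel_majorant j x \<ge> 0"
  by (simp add: kernel_majorant_def)

text \<open>The factor (1 + |x|)^(-j) supplies all the decay, whence the condition j p > 1. The
  zeros of D enter through a sum of inverse distances, and subadditivity of the p-th power leaves
  integrals with one singularity each.\<close>

lemma kernel_majorant_Lp:
  assumes p: "0 < p" "p < 1" and jp: "real j * p > 1"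
  shows "(\<integral>\<^sup>+x. ennreal (kernel_majorant j x powr p) \<partial>lborel) < \<infinity>"
proof -
  have j: "j \<ge> 1" using jp by (cases j) auto
  obtain c Z where Z: "c \<noteq> 0" "finite Z"
    "\<And>z. real_pole_poly j z = c * (\<Prod>a\<in>Z. z - complex_of_real a)"
    using real_pole_poly_factor[OF j] by metis
  obtain K where K: "K \<ge> 0" "\<And>x. inverse (\<Prod>a\<in>Z. \<bar>x - a\<bar>) \<le> K * (1 + (\<Sum>a\<in>Z. inverse \<bar>x - a\<bar>))"
    using inverse_prod_le_sum[OF Z(2)] by blast
  define q where "q = real j * p"
  define L where "L = (inverse (norm c) * K) powr p"
  have pw: "inverse \<bar>t\<bar> powr p = \<bar>t\<bar> powr (-p)" for t :: real
    by (simp add: powr_minus inverse_powr)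
  have bd: "kernel_majorant j x powr p \<le> L * (1 + \<bar>x\<bar>) powr (-q)
      + (\<Sum>a\<in>Z. L * (\<bar>x - a\<bar> powr (-p) * (1 + \<bar>x\<bar>) powr (-q)))" for x
  proof -
    have "kernel_majorant j x = inverse ((1 + \<bar>x\<bar>) ^ j) * (inverse (norm c) * inverse (\<Prod>a\<in>Z. \<bar>x - a\<bar>))"
      unfolding kernel_majorant_def Z(3) norm_mult prod_norm[symmetric] by (simp flip: of_real_diff)
    also have "\<dots> \<le> inverse ((1 + \<bar>x\<bar>) ^ j) * (inverse (norm c) * (K * (1 + (\<Sum>a\<in>Z. inverse \<bar>x - a\<bar>))))"
      by (intro mult_left_mono K) auto
    finally have "kernel_majorant j x powr p
       \<le> (inverse ((1 + \<bar>x\<bar>) ^ j) * (inverse (norm c) * (K * (1 + (\<Sum>a\<in>Z. inverse \<bar>x - a\<bar>))))) powr p"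
      using p by (intro powr_mono2 kernel_majorant_nonneg) auto
    also have "\<dots> = (inverse ((1 + \<bar>x\<bar>) ^ j) * ((inverse (norm c) * K) * (1 + (\<Sum>a\<in>Z. inverse \<bar>x - a\<bar>)))) powr p"
      by (simp add: mult.assoc)
    also have "\<dots> = inverse ((1 + \<bar>x\<bar>) ^ j) powr p * (L * (1 + (\<Sum>a\<in>Z. inverse \<bar>x - a\<bar>)) powr p)"
      unfolding L_def using K(1) by (simp add: powr_mult sum_nonneg)
    also have "inverse ((1 + \<bar>x\<bar>) ^ j) powr p = (1 + \<bar>x\<bar>) powr (-q)"
      unfolding q_def by (simp add: powr_minus inverse_powr powr_powr flip: powr_realpow)
    also have "(1 + \<bar>x\<bar>) powr (-q) * (L * (1 + (\<Sum>a\<in>Z. inverse \<bar>x - a\<bar>)) powr p)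
       \<le> (1 + \<bar>x\<bar>) powr (-q) * (L * (1 + (\<Sum>a\<in>Z. \<bar>x - a\<bar> powr (-p))))"
    proof (intro mult_left_mono)
      have "(1 + (\<Sum>a\<in>Z. inverse \<bar>x - a\<bar>)) powr p \<le> 1 powr p + (\<Sum>a\<in>Z. inverse \<bar>x - a\<bar>) powr p"
        using p by (intro powr_add_le) (auto intro: sum_nonneg)
      also have "\<dots> \<le> 1 + (\<Sum>a\<in>Z. inverse \<bar>x - a\<bar> powr p)"
        using p Z(2) by (auto intro: powr_sum_le)
      finally show "(1 + (\<Sum>a\<in>Z. inverse \<bar>x - a\<bar>)) powr p \<le> 1 + (\<Sum>a\<in>Z. \<bar>x - a\<bar> powr (-p))"
        by (simp only: pw)
    qed (auto simp: L_def)
    also have "\<dots> = L * (1 + \<bar>x\<bar>) powr (-q)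
      + (\<Sum>a\<in>Z. L * (\<bar>x - a\<bar> powr (-p) * (1 + \<bar>x\<bar>) powr (-q)))"
      by (simp add: distrib_left distrib_right sum_distrib_left mult_ac)
    finally show ?thesis .
  qed
  have L0: "L \<ge> 0" by (simp add: L_def)
  have "(\<integral>\<^sup>+x. ennreal (kernel_majorant j x powr p) \<partial>lborel)
     \<le> (\<integral>\<^sup>+x. ennreal L * ennreal ((1 + \<bar>x\<bar>) powr (-q))
      + (\<Sum>a\<in>Z. ennreal L * ennreal (\<bar>x - a\<bar> powr (-p) * (1 + \<bar>x\<bar>) powr (-q))) \<partial>lborel)"
  proof (rule nn_integral_mono)
    fix x
    show "ennreal (kernel_majorant j x powr p) \<le> ennreal L * ennreal ((1 + \<bar>x\<bar>) powr (-q))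
      + (\<Sum>a\<in>Z. ennreal L * ennreal (\<bar>x - a\<bar> powr (-p) * (1 + \<bar>x\<bar>) powr (-q)))"
      using ennreal_leI[OF bd[of x]] L0
      by (subst (asm) ennreal_plus) (auto intro: sum_nonneg simp: ennreal_mult simp flip: sum_ennreal)
  qed
  also have "\<dots> = ennreal L * (\<integral>\<^sup>+x. ennreal ((1 + \<bar>x\<bar>) powr (-q)) \<partial>lborel)
     + (\<Sum>a\<in>Z. ennreal L * (\<integral>\<^sup>+x. ennreal (\<bar>x - a\<bar> powr (-p) * (1 + \<bar>x\<bar>) powr (-q)) \<partial>lborel))"
    by (subst nn_integral_add) (auto simp: nn_integral_sum nn_integral_cmult)
  also have "\<dots> < \<infinity>"
    using nn_integral_powr_decay[of q] nn_integral_powr_singularity[OF p, of q] jp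
    by (simp add: q_def ennreal_mult_less_top Z(2))
  finally show ?thesis .
qed

section \<open>Approximating the indicator of an interval\<close>

text \<open>With \<open>t = 1 / (1 + x\<^sup>2)\<close>, the functions \<open>1 - (1 - t ^ m) ^ (2 ^ m)\<close> tend to
  \<open>1\<close> for \<open>t > 1/2\<close> and to \<open>0\<close> for \<open>t < 1/2\<close>.\<close>

definition step_fun :: "nat \<Rightarrow> real \<Rightarrow> real" where
  "step_fun m x = 1 - (1 - inverse (1 + x\<^sup>2) ^ m) ^ (2 ^ m)"

text \<open>The binomial expansion of \<open>step_fun\<close> in powers of u = t^m. The constant
  term cancels against the leading 1, so only \<open>i \<ge> 1\<close> occurs and every exponent
  \<open>m * i\<close> is at least m.\<close>

definition step_coeff :: "nat \<Rightarrow> nat \<Rightarrow> real" where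
  "step_coeff m i = - (real (2 ^ m choose i) * (-1) ^ i)"

definition step_kernel :: "real \<Rightarrow> nat \<Rightarrow> complex \<Rightarrow> complex" where
  "step_kernel \<sigma> m z = (\<Sum>i\<in>{1..2^m}. complex_of_real (step_coeff m i) * half_plane_kernel \<sigma> (m * i) z)"

definition step_majorant :: "nat \<Rightarrow> real \<Rightarrow> real" where
  "step_majorant m x = (\<Sum>i\<in>{1..2^m}. \<bar>step_coeff m i\<bar> * kernel_majorant (m * i) x)"

definition step_poles :: "nat \<Rightarrow> real set" where
  "step_poles m = {x. \<exists>i\<in>{1..2^m}. real_pole_poly (m * i) (complex_of_real x) = 0}"

lemma finite_step_poles: "m \<ge> 1 \<Longrightarrow> finite (step_poles m)"
proof -
  assume m: "m \<ge> 1"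
  have "step_poles m = (\<Union>i\<in>{1..2^m}. {x. real_pole_poly (m * i) (complex_of_real x) = 0})"
    by (auto simp: step_poles_def)
  then show ?thesis using m by (auto intro!: finite_real_poles)
qed

lemma step_fun_expand:
  "step_fun m x = (\<Sum>i\<in>{1..2^m}. step_coeff m i * inverse (1 + x\<^sup>2) ^ (m * i))"
proof -
  define u where "u = inverse (1 + x\<^sup>2) ^ m"
  have "(1 - u) ^ (2 ^ m) = (\<Sum>k\<le>2^m. real (2 ^ m choose k) * (- u) ^ k)"
    using binomial_ring[of "-u" 1 "2^m"] by simp
  also have "{..2^m} = insert 0 {1..2^m::nat}" by auto
  also have "(\<Sum>k\<in>insert 0 {1..2^m}. real (2 ^ m choose k) * (- u) ^ k)
     = 1 + (\<Sum>k\<in>{1..2^m}. real (2 ^ m choose k) * (- u) ^ k)"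
    by (subst sum.insert) auto
  finally have "step_fun m x = - (\<Sum>k\<in>{1..2^m}. real (2 ^ m choose k) * (- u) ^ k)"
    unfolding step_fun_def u_def by simp
  also have "\<dots> = (\<Sum>i\<in>{1..2^m}. step_coeff m i * u ^ i)"
    unfolding step_coeff_def sum_negf[symmetric]
    by (intro sum.cong refl) (subst power_minus, simp)
  finally show ?thesis by (simp add: u_def power_mult)
qed

lemma step_kernel_sum:
  assumes "x \<notin> step_poles m"
  shows "step_kernel 1 m (complex_of_real x) + step_kernel (-1) m (complex_of_real x)
    = complex_of_real (step_fun m x)"
proof -
  have "step_kernel 1 m (complex_of_real x) + step_kernel (-1) m (complex_of_real x)
    = (\<Sum>i\<in>{1..2^m}. complex_of_real (step_coeff m i) *
        (half_plane_kernel 1 (m * i) (complex_of_real x) + half_plane_kernel (-1) (m * i) (complex_of_real x)))"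
    by (simp add: step_kernel_def distrib_left sum.distrib)
  also have "\<dots> = (\<Sum>i\<in>{1..2^m}. complex_of_real (step_coeff m i) * complex_of_real (inverse (1 + x\<^sup>2) ^ (m * i)))"
    using assms by (intro sum.cong refl arg_cong2[of _ _ _ _ "(*)"] half_plane_kernel_sum) (auto simp: step_poles_def)
  finally show ?thesis by (simp add: step_fun_expand)
qed

text \<open>The exponent belongs to the largest index \<open>i = 2 ^ m\<close>; smaller ones are
  covered because \<open>2 + \<alpha> \<ge> 1\<close>. The resulting factor depends on the aperture
  and on m only.\<close>

lemma step_kernel_cone_bound:
  assumes m: "m \<ge> 1" and \<sigma>: "\<sigma> = 1 \<or> \<sigma> = -1" and \<alpha>: "\<alpha> > 0"
    and z: "\<sigma> * Im z > 0" "\<bar>Re z - x\<bar> < \<alpha> * (\<sigma> * Im z)"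
    and x: "x \<notin> step_poles m"
  shows "norm (step_kernel \<sigma> m z) \<le> (2 + \<alpha>) ^ (2 * (m * 2 ^ m)) * step_majorant m x"
proof -
  have "norm (step_kernel \<sigma> m z) \<le> (\<Sum>i\<in>{1..2^m}. \<bar>step_coeff m i\<bar> * norm (half_plane_kernel \<sigma> (m * i) z))"
    unfolding step_kernel_def by (rule order_trans[OF norm_sum]) (simp add: norm_mult)
  also have "\<dots> \<le> (\<Sum>i\<in>{1..2^m}. \<bar>step_coeff m i\<bar> * ((2 + \<alpha>) ^ (2 * (m * 2 ^ m)) * kernel_majorant (m * i) x))"
  proof (intro sum_mono mult_left_mono)
    fix i assume i: "i \<in> {1..2^m::nat}"
    have "norm (half_plane_kernel \<sigma> (m * i) z) \<le> (2 + \<alpha>) ^ (2 * (m * i)) * kernel_majorant (m * i) x"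
      by (rule half_plane_kernel_cone_bound) (use i m \<sigma> \<alpha> z x in \<open>auto simp: step_poles_def\<close>)
    also have "\<dots> \<le> (2 + \<alpha>) ^ (2 * (m * 2 ^ m)) * kernel_majorant (m * i) x"
      using i \<alpha> by (intro mult_right_mono power_increasing kernel_majorant_nonneg) auto
    finally show "norm (half_plane_kernel \<sigma> (m * i) z) \<le> (2 + \<alpha>) ^ (2 * (m * 2 ^ m)) * kernel_majorant (m * i) x" .
  qed auto
  also have "\<dots> = (2 + \<alpha>) ^ (2 * (m * 2 ^ m)) * step_majorant m x"
    by (simp add: step_majorant_def sum_distrib_left mult_ac)
  finally show ?thesis .
qed

lemma step_majorant_nonneg: "step_majorant m x \<ge> 0"
  unfolding step_majorant_def by (intro sum_nonneg mult_nonneg_nonneg kernel_majorant_nonneg) auto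

lemma borel_measurable_step_majorant [measurable]: "step_majorant m \<in> borel_measurable borel"
  unfolding step_majorant_def[abs_def] by measurable

lemma step_majorant_Lp:
  assumes p: "0 < p" "p < 1" and mp: "real m * p > 1"
  shows "(\<integral>\<^sup>+x. ennreal (step_majorant m x powr p) \<partial>lborel) < \<infinity>"
proof -
  have "(\<integral>\<^sup>+x. ennreal (step_majorant m x powr p) \<partial>lborel)
    \<le> (\<integral>\<^sup>+x. (\<Sum>i\<in>{1..2^m}. ennreal (\<bar>step_coeff m i\<bar> powr p) * ennreal (kernel_majorant (m * i) x powr p)) \<partial>lborel)"
  proof (rule nn_integral_mono)
    fix x
    have "step_majorant m x powr p \<le> (\<Sum>i\<in>{1..2^m}. (\<bar>step_coeff m i\<bar> * kernel_majorant (m * i) x) powr p)"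
      unfolding step_majorant_def using p by (intro powr_sum_le) (auto simp: kernel_majorant_nonneg)
    also have "\<dots> = (\<Sum>i\<in>{1..2^m}. \<bar>step_coeff m i\<bar> powr p * kernel_majorant (m * i) x powr p)"
      by (intro sum.cong refl powr_mult)
    finally show "ennreal (step_majorant m x powr p)
       \<le> (\<Sum>i\<in>{1..2^m}. ennreal (\<bar>step_coeff m i\<bar> powr p) * ennreal (kernel_majorant (m * i) x powr p))"
      by (simp add: ennreal_leI flip: ennreal_mult)
  qed
  also have "\<dots> = (\<Sum>i\<in>{1..2^m}. ennreal (\<bar>step_coeff m i\<bar> powr p) * (\<integral>\<^sup>+x. ennreal (kernel_majorant (m * i) x powr p) \<partial>lborel))"
    by (simp add: nn_integral_sum nn_integral_cmult)
  also have "\<dots> < \<infinity>"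
  proof -
    have "(\<integral>\<^sup>+x. ennreal (kernel_majorant (m * i) x powr p) \<partial>lborel) < \<infinity>" if "i \<in> {1..2^m}" for i
    proof (rule kernel_majorant_Lp[OF p])
      have "1 * (real m * p) \<le> real i * (real m * p)" using that mp by (intro mult_right_mono) auto
      then show "1 < real (m * i) * p" using mp by (simp add: mult_ac)
    qed
    then show ?thesis by (auto simp: ennreal_mult_less_top)
  qed
  finally show ?thesis .
qed

text \<open>The third bound is (1 + |x|)^2 \<le> 2 (1 + x^2); it makes the decay integrals in 1 +
  |x| applicable.\<close>

lemma inverse_quadratic_bounds:
  fixes x :: real
  shows "0 < inverse (1 + x\<^sup>2)" "inverse (1 + x\<^sup>2) \<le> 1" "2 * inverse (1 + x\<^sup>2) \<le> 4 / (1 + \<bar>x\<bar>)\<^sup>2"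
proof -
  have "0 < 1 + x\<^sup>2" by (simp add: add_pos_nonneg)
  then show "0 < inverse (1 + x\<^sup>2)" by simp
  show "inverse (1 + x\<^sup>2) \<le> 1" by (simp add: inverse_le_1_iff)
  have "(1 + \<bar>x\<bar>)\<^sup>2 \<le> 2 * (1 + x\<^sup>2)"
    using sum_squares_bound[of 1 "\<bar>x\<bar>"] by (simp add: power2_sum)
  then show "2 * inverse (1 + x\<^sup>2) \<le> 4 / (1 + \<bar>x\<bar>)\<^sup>2"
    using \<open>0 < 1 + x\<^sup>2\<close> by (simp add: field_simps add_pos_nonneg)
qed

text \<open>Bernoulli's inequality gives 1 - (1 - u)^N \<le> N u; with N = 2^m and u = t^m the right
  side is exactly (2t)^m. The outer exponent 2^m is what puts the threshold at t = 1/2.\<close>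

lemma step_fun_bounds:
  shows "0 \<le> step_fun m x" "step_fun m x \<le> 1" "step_fun m x \<le> (2 * inverse (1 + x\<^sup>2)) ^ m"
proof -
  define u where "u = inverse (1 + x\<^sup>2) ^ m"
  have u: "0 \<le> u" "u \<le> 1"
    unfolding u_def using inverse_quadratic_bounds[of x] by (auto intro: power_le_one)
  have s: "step_fun m x = 1 - (1 - u) ^ (2 ^ m)" by (simp add: step_fun_def u_def)
  show "0 \<le> step_fun m x" "step_fun m x \<le> 1" unfolding s using u by (auto intro: power_le_one)
  have "1 + of_nat (2 ^ m) * (- u) \<le> (1 + (- u)) ^ (2 ^ m)" using u by (intro Bernoulli_inequality) auto
  then have "step_fun m x \<le> 2 ^ m * u" unfolding s by simp
  then show "step_fun m x \<le> (2 * inverse (1 + x\<^sup>2)) ^ m" by (simp add: u_def power_mult_distrib)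
qed

text \<open>Inside the interval 2t > 1, and 1 - u \<le> exp(-u) bounds the deviation from 1 by
  exp(-(2t)^m). Outside, 2t < 1 and the function is at most (2t)^m. At the endpoints t = 1/2 and the
  limit would be 1 - 1/e.\<close>

lemma step_fun_tendsto:
  assumes "x \<noteq> 1" "x \<noteq> -1"
  shows "(\<lambda>m. step_fun m x) \<longlonglongrightarrow> indicator {-1..1} x"
proof (cases "\<bar>x\<bar> < 1")
  case True
  define t where "t = inverse (1 + x\<^sup>2)"
  have "x\<^sup>2 < 1" using True abs_square_less_1 by blast
  then have t: "2 * t > 1" "t \<le> 1" "t > 0"
    using inverse_quadratic_bounds[of x] by (auto simp: t_def field_simps add_pos_nonneg)
  have ub: "(1 - t ^ m) ^ (2 ^ m) \<le> exp (- ((2 * t) ^ m))" for m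
  proof -
    have "0 \<le> 1 - t ^ m" using t by (simp add: power_le_one)
    moreover have "1 - t ^ m \<le> exp (- (t ^ m))" using exp_ge_add_one_self[of "- (t ^ m)"] by simp
    ultimately have "(1 - t ^ m) ^ (2 ^ m) \<le> exp (- (t ^ m)) ^ (2 ^ m)" by (intro power_mono)
    also have "\<dots> = exp (- ((2 * t) ^ m))"
      by (simp add: power_mult_distrib flip: exp_of_nat_mult)
    finally show ?thesis .
  qed
  have "filterlim (\<lambda>m. (2 * t) ^ m) at_top sequentially"
    using filterlim_at_infinity_imp_norm_at_top[OF filterlim_realpow_sequentially_gt1[of "2 * t"]] t
    by (simp add: norm_power)
  then have "(\<lambda>m. exp (- ((2 * t) ^ m))) \<longlonglongrightarrow> 0"
    by (intro filterlim_compose[OF exp_at_bot] filterlim_compose[OF filterlim_uminus_at_bot_at_top])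
  then have "(\<lambda>m. (1 - t ^ m) ^ (2 ^ m)) \<longlonglongrightarrow> 0"
    by (rule tendsto_sandwich[OF _ _ tendsto_const, rotated 2])
       (use ub t in \<open>auto intro!: always_eventually power_le_one zero_le_power\<close>)
  then have "(\<lambda>m. 1 - (1 - t ^ m) ^ (2 ^ m)) \<longlonglongrightarrow> 1 - 0" by (intro tendsto_intros)
  then show ?thesis using True by (simp add: step_fun_def t_def indicator_def abs_less_iff)
next
  case False
  define t where "t = inverse (1 + x\<^sup>2)"
  have x: "\<bar>x\<bar> > 1" using False assms by (auto simp: abs_if split: if_splits)
  then have "x\<^sup>2 > 1" by (metis one_less_power power2_abs zero_less_numeral)
  then have t: "2 * t < 1" "t > 0"
    using inverse_quadratic_bounds[of x] by (auto simp: t_def field_simps add_pos_nonneg)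
  have "(\<lambda>m. (2 * t) ^ m) \<longlonglongrightarrow> 0" using t by (intro LIMSEQ_realpow_zero) auto
  then have "(\<lambda>m. step_fun m x) \<longlonglongrightarrow> 0"
    by (rule tendsto_sandwich[OF _ _ tendsto_const, rotated 2])
       (use step_fun_bounds in \<open>auto intro!: always_eventually simp: t_def\<close>)
  moreover have "x \<notin> {-1..1}" using x by auto
  ultimately show ?thesis by simp
qed

text \<open>One majorant for all large m: where 2t \<le> 1, the power (2t)^m decreases in m;
  elsewhere the majorant is at least 1.\<close>

lemma step_fun_dominated:
  assumes "M \<le> m"
  shows "step_fun m x \<le> (4 / (1 + \<bar>x\<bar>)\<^sup>2) ^ M"
proof (cases "2 * inverse (1 + x\<^sup>2) \<le> 1")
  case True
  have "step_fun m x \<le> (2 * inverse (1 + x\<^sup>2)) ^ m" by (rule step_fun_bounds)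
  also have "\<dots> \<le> (2 * inverse (1 + x\<^sup>2)) ^ M"
    using True inverse_quadratic_bounds(1)[of x] assms by (intro power_decreasing) auto
  also have "\<dots> \<le> (4 / (1 + \<bar>x\<bar>)\<^sup>2) ^ M"
    using inverse_quadratic_bounds[of x] by (intro power_mono) auto
  finally show ?thesis .
next
  case False
  then have "1 \<le> 4 / (1 + \<bar>x\<bar>)\<^sup>2" using inverse_quadratic_bounds(3)[of x] by linarith
  then have "1 \<le> (4 / (1 + \<bar>x\<bar>)\<^sup>2) ^ M" by (rule one_le_power)
  then show ?thesis using step_fun_bounds(2)[of m x] by linarith
qed

lemma indicator_dominated: "indicator {-1..1} x \<le> (4 / (1 + \<bar>x\<bar>)\<^sup>2) ^ M" for x :: real
proof (cases "x \<in> {-1..1}")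
  case True
  then have "(1 + \<bar>x\<bar>)\<^sup>2 \<le> 2\<^sup>2" by (intro power_mono) auto
  moreover have "0 < (1 + \<bar>x\<bar>)\<^sup>2" by auto
  ultimately have "1 \<le> 4 / (1 + \<bar>x\<bar>)\<^sup>2" by (subst le_divide_eq_1_pos) auto
  then show ?thesis using True by (simp add: one_le_power)
qed auto

lemma dominant_Lp:
  assumes "0 < p" "real M * p > 1"
  shows "(\<integral>\<^sup>+x. ennreal (((4 / (1 + \<bar>x\<bar>)\<^sup>2) ^ M) powr p) \<partial>lborel) < \<infinity>"
proof -
  have "((4 / (1 + \<bar>x\<bar>)\<^sup>2) ^ M) powr p = 4 powr (M * p) * (1 + \<bar>x\<bar>) powr (- (2 * M * p))" for x :: real
  proof -
    have "(4 / (1 + \<bar>x\<bar>)\<^sup>2) ^ M = (4 * (1 + \<bar>x\<bar>) powr (-2)) powr M"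
      by (subst powr_realpow) (auto simp: powr_minus_divide powr_numeral)
    then show ?thesis by (simp add: powr_powr powr_mult)
  qed
  then have "(\<integral>\<^sup>+x. ennreal (((4 / (1 + \<bar>x\<bar>)\<^sup>2) ^ M) powr p) \<partial>lborel)
    = ennreal (4 powr (M * p)) * (\<integral>\<^sup>+x. ennreal ((1 + \<bar>x\<bar>) powr (- (2 * M * p))) \<partial>lborel)"
    by (simp add: ennreal_mult nn_integral_cmult)
  also have "\<dots> < \<infinity>"
    using nn_integral_powr_decay[of "2 * M * p"] assms by (simp add: ennreal_mult_less_top)
  finally show ?thesis .
qed

lemma borel_measurable_step_fun [measurable]: "step_fun m \<in> borel_measurable borel"
  unfolding step_fun_def[abs_def] by measurable

section \<open>Kernels adapted to a box\<close>

lemma prod_Basis_cart: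
  fixes F :: "real^'n \<Rightarrow> 'b::comm_monoid_mult"
  shows "(\<Prod>b\<in>Basis. F b) = (\<Prod>j\<in>UNIV. F (axis j 1))"
proof -
  have "(Basis :: (real^'n) set) = range (\<lambda>j. axis j 1)" by (auto simp: Basis_vec_def)
  moreover have "inj (\<lambda>j::'n. axis j (1::real))" by (auto simp: inj_on_def axis_eq_axis)
  ultimately show ?thesis by (metis (no_types, lifting) prod.reindex_cong)
qed

lemma borel_measurable_nth_real [measurable]: "(\<lambda>x::real^'n. x$j) \<in> borel_measurable borel"
  by (intro borel_measurable_continuous_onI continuous_intros)

lemma nn_integral_prod_cart:
  fixes f :: "real \<Rightarrow> ennreal"
  assumes "f \<in> borel_measurable borel"
  shows "(\<integral>\<^sup>+(x::real^'n). (\<Prod>j\<in>UNIV. f (x$j)) \<partial>lborel) = (\<integral>\<^sup>+x. f x \<partial>lborel) ^ CARD('n)"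
proof -
  have "(\<Prod>b\<in>Basis. f (x \<bullet> b)) = (\<Prod>j\<in>UNIV. f (x$j))" for x :: "real^'n"
    by (simp add: prod_Basis_cart cart_eq_inner_axis)
  then show ?thesis
    using nn_integral_lborel_prod[of "\<lambda>_::real^'n. f"] assms by simp
qed

lemma nn_integral_rescale_cart:
  fixes g :: "real^'n \<Rightarrow> ennreal" and a h :: "real^'n"
  assumes g: "g \<in> borel_measurable borel" and h: "\<And>j. h$j > 0"
  shows "(\<integral>\<^sup>+x. g (\<chi> j. (x$j - a$j) / h$j) \<partial>lborel) = ennreal (\<Prod>j\<in>UNIV. h$j) * (\<integral>\<^sup>+x. g x \<partial>lborel)"
proof -
  \<comment> \<open>\<open>T\<close> is the diagonal affine map with Jacobian the product of the
    \<open>h$j\<close>, and \<open>S\<close> is its inverse.\<close>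
  define T where "T x = a + (\<Sum>b\<in>Basis. ((h \<bullet> b) * (x \<bullet> b)) *\<^sub>R b)" for x :: "real^'n"
  define S where "S x = (\<chi> j. (x$j - a$j) / h$j)" for x :: "real^'n"
  have T: "T x $ j = a$j + h$j * x$j" for x j
  proof -
    have "T x \<bullet> axis j 1 = a \<bullet> axis j 1 + (h \<bullet> axis j 1) * (x \<bullet> axis j 1)"
      unfolding T_def inner_add_left by (subst inner_sum_left_Basis) (auto simp: axis_in_Basis_iff)
    then show ?thesis by (simp add: cart_eq_inner_axis)
  qed
  have ST: "S (T x) = x" for x using h by (simp add: S_def T vec_eq_iff less_imp_neq[symmetric] order.strict_implies_not_eq)
  have nz: "h \<bullet> b \<noteq> 0" if "b \<in> Basis" for b
    using that h by (auto simp: Basis_vec_def cart_eq_inner_axis[symmetric] less_imp_neq[symmetric])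
  have pr: "(\<Prod>b\<in>Basis. \<bar>h \<bullet> b\<bar>) = (\<Prod>j\<in>UNIV. h$j)"
    using h by (simp add: prod_Basis_cart less_imp_le flip: cart_eq_inner_axis)
  have "continuous_on UNIV S" unfolding S_def
    by (intro continuous_intros) (use h in \<open>auto simp: less_imp_neq[symmetric]\<close>)
  then have S[measurable]: "S \<in> borel \<rightarrow>\<^sub>M borel" by (rule borel_measurable_continuous_onI)
  have [measurable]: "T \<in> borel \<rightarrow>\<^sub>M borel" unfolding T_def[abs_def] by measurable
  note g[measurable]
  have eq: "lborel = density (distr lborel borel T) (\<lambda>_. ennreal (\<Prod>j\<in>UNIV. h$j))"
    using lborel_affine_euclidean[of "\<lambda>b. h \<bullet> b" a] nz unfolding T_def[abs_def] pr by simp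
  have "(\<integral>\<^sup>+x. g (S x) \<partial>lborel) = (\<integral>\<^sup>+x. g (S x) \<partial>density (distr lborel borel T) (\<lambda>_. ennreal (\<Prod>j\<in>UNIV. h$j)))"
    using eq by simp
  also have "\<dots> = (\<integral>\<^sup>+x. ennreal (\<Prod>j\<in>UNIV. h$j) * g (S (T x)) \<partial>lborel)"
    by (simp add: nn_integral_density nn_integral_distr)
  also have "\<dots> = ennreal (\<Prod>j\<in>UNIV. h$j) * (\<integral>\<^sup>+x. g x \<partial>lborel)"
    unfolding ST by (rule nn_integral_cmult) simp
  finally show ?thesis unfolding S_def .
qed

lemma sign_vectors_eq_image:
  "(sign_vectors :: (real^'n) set) = vec_lambda ` (UNIV \<rightarrow>\<^sub>E {1, -1})"
proof (intro equalityI subsetI)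
  fix s :: "real^'n" assume "s \<in> sign_vectors"
  then have "s = vec_lambda (\<lambda>j. s$j)" "(\<lambda>j. s$j) \<in> UNIV \<rightarrow>\<^sub>E {1, -1}"
    by (auto simp: sign_vectors_def)
  then show "s \<in> vec_lambda ` (UNIV \<rightarrow>\<^sub>E {1, -1})" by blast
qed (auto simp: sign_vectors_def PiE_iff)

lemma finite_sign_vectors: "finite (sign_vectors :: (real^'n) set)"
  unfolding sign_vectors_eq_image by (intro finite_imageI finite_PiE) auto

text \<open>The distributive law: expanding n two-term factors chooses one sign per coordinate. This
  turns the splitting into two half planes in each variable into a splitting over all
  octants.\<close>

lemma sum_sign_vectors_prod:
  fixes f :: "real \<Rightarrow> 'n::finite \<Rightarrow> complex"
  shows "(\<Sum>s\<in>sign_vectors. \<Prod>j\<in>UNIV. f (s$j) j) = (\<Prod>j\<in>UNIV. f 1 j + f (-1) j)"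
proof -
  have "(\<Prod>j\<in>UNIV. f 1 j + f (-1) j) = (\<Prod>j\<in>UNIV. \<Sum>\<sigma>\<in>{1,-1}. f \<sigma> j)" by simp
  also have "\<dots> = (\<Sum>g\<in>UNIV \<rightarrow>\<^sub>E {1,-1}. \<Prod>j\<in>UNIV. f (g j) j)"
    by (rule prod_sum_PiE) auto
  also have "\<dots> = (\<Sum>s\<in>sign_vectors. \<Prod>j\<in>UNIV. f (s$j) j)"
    unfolding sign_vectors_eq_image
    by (subst sum.reindex) (auto intro: inj_onI simp: vec_lambda_inject)
  finally show ?thesis by simp
qed

text \<open>Here \<open>a\<close> is the centre of the box and \<open>h\<close> the vector of its
  half side lengths.\<close>

definition box_kernel :: "nat \<Rightarrow> real^'n \<Rightarrow> real^'n \<Rightarrow> real^'n \<Rightarrow> complex^'n \<Rightarrow> complex" where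
  "box_kernel m a h s z =
     (\<Prod>j\<in>UNIV. step_kernel (s$j) m ((z$j - complex_of_real (a$j)) / complex_of_real (h$j)))"

definition box_majorant :: "nat \<Rightarrow> real^'n \<Rightarrow> real^'n \<Rightarrow> real^'n \<Rightarrow> real" where
  "box_majorant m a h x = (\<Prod>j\<in>UNIV. step_majorant m ((x$j - a$j) / h$j))"

text \<open>For \<open>m \<ge> 1\<close> and positive \<open>h\<close> this is a finite union of
  coordinate hyperplanes, hence a null set.\<close>

definition box_poles :: "nat \<Rightarrow> real^'n \<Rightarrow> real^'n \<Rightarrow> (real^'n) set" where
  "box_poles m a h = {x. \<exists>j. (x$j - a$j) / h$j \<in> step_poles m}"

lemma negligible_coordinate_hyperplane: "negligible {x::real^'n. x$j = c}"
  using negligible_standard_hyperplane[of "axis j (1::real)" c]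
  by (simp add: axis_in_Basis_iff cart_eq_inner_axis)

lemma negligible_box_poles:
  fixes a h :: "real^'n"
  assumes "m \<ge> 1" "\<And>j. h$j > 0"
  shows "negligible (box_poles m a h)"
proof (rule negligible_subset)
  show "negligible (\<Union>j\<in>UNIV. \<Union>t\<in>step_poles m. {x::real^'n. x$j = a$j + h$j * t})"
    by (intro negligible_Union finite_imageI ballI)
       (auto intro!: negligible_Union finite_step_poles assms negligible_coordinate_hyperplane)
  show "box_poles m a h \<subseteq> (\<Union>j\<in>UNIV. \<Union>t\<in>step_poles m. {x::real^'n. x$j = a$j + h$j * t})"
  proof
    fix x assume "x \<in> box_poles m a h"
    then obtain j where "(x$j - a$j) / h$j \<in> step_poles m" by (auto simp: box_poles_def)
    moreover have "x$j = a$j + h$j * ((x$j - a$j) / h$j)" using assms(2)[of j] by simp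
    ultimately show "x \<in> (\<Union>j\<in>UNIV. \<Union>t\<in>step_poles m. {x::real^'n. x$j = a$j + h$j * t})" by blast
  qed
qed

text \<open>Positive dilations and real translations preserve half planes, so on the tube the j-th
  rescaled variable stays on the side given by \<open>s$j\<close>: away from the real zeros of D and
  from the pole \<open>- s$j * \<i>\<close>. At real points only the zeros of D are dangerous, and
  these make up \<open>box_poles\<close>.\<close>

lemma box_kernel_agrees:
  fixes a h s :: "real^'n"
  assumes m: "m \<ge> 1" and h: "\<And>j. h$j > 0" and s: "s \<in> sign_vectors"
  shows "agrees_with_rational_on (tube (octant s) \<union> cvec ` (- box_poles m a h)) (box_kernel m a h s)"
    (is "agrees_with_rational_on ?V _")
proof -
  have nz1: "w + complex_of_real (s$j) * \<i> \<noteq> 0" if "Im w = 0 \<or> s$j * Im w > 0" for w j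
  proof
    assume "w + complex_of_real (s$j) * \<i> = 0"
    then have "Im w = - s$j" by (simp add: complex_eq_iff)
    then show False using that s by (auto simp: sign_vectors_def dest: spec[of _ j])
  qed
  have agree: "agrees_with_rational_on ?V (\<lambda>z. half_plane_kernel (s$j) (m * i)
      ((z$j - complex_of_real (a$j)) / complex_of_real (h$j)))"
    if i: "i \<in> {1..2^m}" for i j
  proof -
    let ?w = "\<lambda>z::complex^'n. (z$j - complex_of_real (a$j)) / complex_of_real (h$j)"
    have "agrees_with_rational_on ?V (\<lambda>z. (z$j + - complex_of_real (a$j)) * inverse (complex_of_real (h$j)))"
      by (intro agrees_mult agrees_add agrees_coord agrees_const)
    then have w: "agrees_with_rational_on ?V ?w" by (simp add: divide_inverse)
    then have "agrees_with_rational_on ?V (\<lambda>z. (?w z + complex_of_real (s$j) * \<i>) ^ (m * i) *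
        ((?w z + - \<i>) ^ (m * i) + (?w z + \<i>) ^ (m * i)))"
      by (intro agrees_mult agrees_add agrees_power agrees_const)
    then have "agrees_with_rational_on ?V (\<lambda>z. (?w z + complex_of_real (s$j) * \<i>) ^ (m * i) * real_pole_poly (m * i) (?w z))"
      by (simp add: real_pole_poly_def)
    then show ?thesis unfolding half_plane_kernel_def
    proof (rule agrees_inverse)
      fix z assume "z \<in> ?V"
      then consider "s$j * Im (?w z) > 0" | x where "z = cvec x" "x \<notin> box_poles m a h"
        using h[of j] by (auto simp: tube_def octant_def Im_divide_of_real)
      then have "?w z + complex_of_real (s$j) * \<i> \<noteq> 0 \<and> real_pole_poly (m * i) (?w z) \<noteq> 0"
      proof cases
        case 1
        then show ?thesis using nz1[of "?w z" j] real_pole_poly_zero_imp_real[of "m * i" "?w z"] m i by auto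
      next
        case (2 x)
        have wx: "?w z = complex_of_real ((x$j - a$j) / h$j)" by (simp add: 2 cvec_def)
        have "(x$j - a$j) / h$j \<notin> step_poles m" using 2 by (auto simp: box_poles_def)
        then show ?thesis using i nz1[of "?w z" j] unfolding wx by (auto simp: step_poles_def)
      qed
      then show "(?w z + complex_of_real (s$j) * \<i>) ^ (m * i) * real_pole_poly (m * i) (?w z) \<noteq> 0" by simp
    qed
  qed
  show ?thesis
    unfolding box_kernel_def[abs_def] step_kernel_def
    by (intro agrees_prod agrees_sum agrees_mult agrees_const agree) auto
qed

text \<open>The cone is a product of one-variable cones, and dividing real and imaginary parts by
  the same \<open>h$j\<close> does not change the aperture; the one-variable bounds
  multiply.\<close>

lemma box_kernel_cone_bound:
  fixes a h s :: "real^'n"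
  assumes m: "m \<ge> 1" and h: "\<And>j. h$j > 0" and s: "s \<in> sign_vectors" and \<alpha>: "\<alpha> > 0"
    and x: "x \<notin> box_poles m a h" and z: "z \<in> nt_cone s (vec \<alpha>) x"
  shows "norm (box_kernel m a h s z) \<le> ((2 + \<alpha>) ^ (2 * (m * 2 ^ m))) ^ CARD('n) * box_majorant m a h x"
proof -
  obtain u v where uv: "z = tpt u v" "v \<in> octant s" "\<And>j. \<bar>u$j - x$j\<bar> < \<alpha> * (s$j * v$j)"
    using z by (auto simp: nt_cone_def)
  have "norm (step_kernel (s$j) m ((z$j - complex_of_real (a$j)) / complex_of_real (h$j)))
     \<le> (2 + \<alpha>) ^ (2 * (m * 2 ^ m)) * step_majorant m ((x$j - a$j) / h$j)" for j
  proof (rule step_kernel_cone_bound[OF m _ \<alpha>])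
    let ?w = "(z$j - complex_of_real (a$j)) / complex_of_real (h$j)"
    show "s$j = 1 \<or> s$j = -1" using s by (simp add: sign_vectors_def)
    have im: "Im ?w = v$j / h$j" and re: "Re ?w = (u$j - a$j) / h$j"
      by (simp_all add: uv tpt_def Im_divide_of_real Re_divide_of_real)
    show "s$j * Im ?w > 0" unfolding im using uv(2) h[of j] by (simp add: octant_def)
    have "Re ?w - (x$j - a$j) / h$j = (u$j - x$j) / h$j" unfolding re by (simp add: diff_divide_distrib)
    then have "\<bar>Re ?w - (x$j - a$j) / h$j\<bar> = \<bar>u$j - x$j\<bar> / h$j" using h[of j] by simp
    also have "\<dots> < \<alpha> * (s$j * v$j) / h$j" using uv(3)[of j] h[of j] by (simp add: divide_strict_right_mono)
    finally show "\<bar>Re ?w - (x$j - a$j) / h$j\<bar> < \<alpha> * (s$j * Im ?w)" unfolding im by simp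
    show "(x$j - a$j) / h$j \<notin> step_poles m" using x by (auto simp: box_poles_def)
  qed
  then have "norm (box_kernel m a h s z) \<le> (\<Prod>j\<in>(UNIV::'n set). (2 + \<alpha>) ^ (2 * (m * 2 ^ m)) * step_majorant m ((x$j - a$j) / h$j))"
    unfolding box_kernel_def prod_norm[symmetric] by (intro prod_mono) auto
  then show ?thesis by (simp add: prod.distrib box_majorant_def)
qed

lemma box_kernel_sum:
  fixes a h :: "real^'n"
  assumes "x \<notin> box_poles m a h"
  shows "(\<Sum>s\<in>sign_vectors. box_kernel m a h s (cvec x))
     = complex_of_real (\<Prod>j\<in>UNIV. step_fun m ((x$j - a$j) / h$j))"
proof -
  have "(\<Sum>s\<in>sign_vectors. box_kernel m a h s (cvec x))
    = (\<Prod>j\<in>UNIV. step_kernel 1 m (complex_of_real ((x$j - a$j) / h$j))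
         + step_kernel (-1) m (complex_of_real ((x$j - a$j) / h$j)))"
    unfolding box_kernel_def cvec_def
    using sum_sign_vectors_prod[of "\<lambda>\<sigma> j. step_kernel \<sigma> m (complex_of_real ((x$j - a$j) / h$j))"]
    by simp
  also have "\<dots> = (\<Prod>j\<in>UNIV. complex_of_real (step_fun m ((x$j - a$j) / h$j)))"
    by (intro prod.cong refl step_kernel_sum) (use assms in \<open>auto simp: box_poles_def\<close>)
  finally show ?thesis by simp
qed

lemma box_majorant_nonneg: "box_majorant m a h x \<ge> 0"
  unfolding box_majorant_def by (intro prod_nonneg step_majorant_nonneg ballI)

lemma borel_measurable_box_majorant: "box_majorant m a h \<in> borel_measurable borel"
  unfolding box_majorant_def[abs_def] by measurable

lemma powr_prod:
  fixes f :: "'i \<Rightarrow> real"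
  assumes "finite I" shows "(\<Prod>i\<in>I. f i) powr p = (\<Prod>i\<in>I. f i powr p)"
  using assms by (induction I rule: finite_induct) (auto simp: powr_mult)

text \<open>The box enters only through the product of the \<open>h$j\<close>; the other factor
  depends on n, p and m. Together with the same scaling in \<open>box_error\<close>, this makes the
  final constants independent of the function being approximated.\<close>

lemma box_majorant_Lp:
  fixes a h :: "real^'n"
  assumes h: "\<And>j. h$j > 0"
  shows "(\<integral>\<^sup>+x. ennreal (box_majorant m a h x powr p) \<partial>lborel)
    = ennreal (\<Prod>j\<in>UNIV. h$j) * (\<integral>\<^sup>+x. ennreal (step_majorant m x powr p) \<partial>lborel) ^ CARD('n)"
proof -
  let ?g = "\<lambda>x::real^'n. \<Prod>j\<in>UNIV. ennreal (step_majorant m (x$j) powr p)"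
  have "ennreal (box_majorant m a h x powr p) = ?g (\<chi> j. (x$j - a$j) / h$j)" for x
    unfolding box_majorant_def by (simp add: powr_prod prod_ennreal)
  then show ?thesis
    using nn_integral_rescale_cart[of ?g h a] h
      nn_integral_prod_cart[where 'n='n, of "\<lambda>x. ennreal (step_majorant m x powr p)"] by simp
qed

text \<open>The type argument fixes the dimension, which \<open>p\<close> and \<open>m\<close> do
  not determine.\<close>

definition unit_box_error :: "'n::finite itself \<Rightarrow> real \<Rightarrow> nat \<Rightarrow> ennreal" where
  "unit_box_error _ p m = (\<integral>\<^sup>+(x::real^'n). ennreal (\<bar>(\<Prod>j\<in>UNIV. indicator {-1..1} (x$j))
      - (\<Prod>j\<in>UNIV. step_fun m (x$j))\<bar> powr p) \<partial>lborel)"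

lemma box_error:
  fixes a h :: "real^'n"
  assumes h: "\<And>j. h$j > 0" and p: "p > 0"
  shows "(\<integral>\<^sup>+x. ennreal (\<bar>indicator (cbox (a - h) (a + h)) x
        - (\<Prod>j\<in>UNIV. step_fun m ((x$j - a$j) / h$j))\<bar> powr p) \<partial>lborel)
    = ennreal (\<Prod>j\<in>UNIV. h$j) * unit_box_error TYPE('n) p m"
proof -
  let ?g = "\<lambda>x::real^'n. ennreal (\<bar>(\<Prod>j\<in>UNIV. indicator {-1..1} (x$j))
      - (\<Prod>j\<in>UNIV. step_fun m (x$j))\<bar> powr p)"
  have ind: "indicator (cbox (a - h) (a + h)) x = (\<Prod>j\<in>UNIV. indicator {-1..1} ((x$j - a$j) / h$j) :: real)" for x
  proof -
    have "x \<in> cbox (a - h) (a + h) \<longleftrightarrow> (\<forall>j. (x$j - a$j) / h$j \<in> {-1..1})"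
      using h by (auto simp: mem_box_cart field_simps)
    then show ?thesis by (auto simp: indicator_def prod_zero_iff)
  qed
  show ?thesis unfolding ind unit_box_error_def
    using nn_integral_rescale_cart[of ?g h a] h by simp
qed

text \<open>Dominated convergence with a product majorant. Both functions lie between 0 and the
  majorant, so their difference does as well in modulus.\<close>

lemma unit_box_error_tendsto:
  assumes p: "0 < p"
  shows "(\<lambda>m. unit_box_error TYPE('n::finite) p m) \<longlonglongrightarrow> 0"
proof -
  obtain M :: nat where M: "real M * p > 1" using p ex_less_of_nat_mult[of p 1] by auto
  define d :: "real \<Rightarrow> real" where "d x = (4 / (1 + \<bar>x\<bar>)\<^sup>2) ^ M" for x
  let ?I = "\<lambda>x::real^'n. \<Prod>j\<in>UNIV. indicator {-1..1} (x$j) :: real"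
  let ?S = "\<lambda>m (x::real^'n). \<Prod>j\<in>UNIV. step_fun m (x$j)"
  \<comment> \<open>The majorant is valid only for indices from \<open>M\<close> on, hence the
    shift.\<close>
  let ?u = "\<lambda>m (x::real^'n). ennreal (\<bar>?I x - ?S (m + M) x\<bar> powr p)"
  have "(\<lambda>m. \<integral>\<^sup>+x. ?u m x \<partial>lborel) \<longlonglongrightarrow> (\<integral>\<^sup>+x. 0 \<partial>(lborel :: (real^'n) measure))"
  proof (rule nn_integral_dominated_convergence[where w="\<lambda>x::real^'n. \<Prod>j\<in>UNIV. ennreal (d (x$j) powr p)"])
    have "(\<integral>\<^sup>+(x::real^'n). (\<Prod>j\<in>UNIV. ennreal (d (x$j) powr p)) \<partial>lborel)
       = (\<integral>\<^sup>+x. ennreal (d x powr p) \<partial>lborel) ^ CARD('n)"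
      by (rule nn_integral_prod_cart) (simp add: d_def)
    also have "\<dots> < \<infinity>" using dominant_Lp[OF p M] by (simp add: d_def power_less_top_ennreal)
    finally show "(\<integral>\<^sup>+(x::real^'n). (\<Prod>j\<in>UNIV. ennreal (d (x$j) powr p)) \<partial>lborel) < \<infinity>" .
    show "AE x::real^'n in lborel. ?u m x \<le> (\<Prod>j\<in>UNIV. ennreal (d (x$j) powr p))" for m
    proof (intro AE_I2)
      fix x :: "real^'n"
      have "0 \<le> ?I x" "?I x \<le> (\<Prod>j\<in>UNIV. d (x$j))"
        unfolding d_def by (auto intro!: prod_nonneg prod_mono indicator_dominated)
      moreover have "0 \<le> ?S (m + M) x" "?S (m + M) x \<le> (\<Prod>j\<in>UNIV. d (x$j))"
        unfolding d_def by (auto intro!: prod_nonneg prod_mono step_fun_dominated step_fun_bounds)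
      ultimately have "\<bar>?I x - ?S (m + M) x\<bar> \<le> (\<Prod>j\<in>UNIV. d (x$j))" by linarith
      then have "\<bar>?I x - ?S (m + M) x\<bar> powr p \<le> (\<Prod>j\<in>UNIV. d (x$j)) powr p"
        using p by (intro powr_mono2) auto
      also have "\<dots> = (\<Prod>j\<in>UNIV. d (x$j) powr p)" by (simp add: powr_prod)
      finally show "?u m x \<le> (\<Prod>j\<in>UNIV. ennreal (d (x$j) powr p))"
        by (simp add: prod_ennreal ennreal_leI)
    qed
    \<comment> \<open>Pointwise convergence is available only where no coordinate is 1 or -1, the
      values excluded in \<open>step_fun_tendsto\<close>.\<close>
    have "negligible (\<Union>j\<in>UNIV. \<Union>t\<in>{1,-1}. {x::real^'n. x$j = t})"
      by (intro negligible_Union finite_imageI ballI)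
         (auto intro!: negligible_Union negligible_coordinate_hyperplane)
    then have "(\<Union>j\<in>UNIV. \<Union>t\<in>{1,-1}. {x::real^'n. x$j = t}) \<in> null_sets lebesgue"
      by (simp add: negligible_iff_null_sets)
    then have "AE x in lborel. x \<notin> (\<Union>j\<in>UNIV. \<Union>t\<in>{1,-1}. {x::real^'n. x$j = t})"
      using AE_not_in AE_completion_iff by blast
    then show "AE x in lborel. (\<lambda>m. ?u m x) \<longlonglongrightarrow> 0"
    proof eventually_elim
      case (elim x)
      then have "x$j \<noteq> 1" "x$j \<noteq> -1" for j by auto
      then have "(\<lambda>m. ?S m x) \<longlonglongrightarrow> ?I x" by (intro tendsto_prod step_fun_tendsto)
      then have "(\<lambda>m. ?S (m + M) x) \<longlonglongrightarrow> ?I x" by (rule LIMSEQ_ignore_initial_segment)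
      then have "(\<lambda>m. \<bar>?I x - ?S (m + M) x\<bar>) \<longlonglongrightarrow> \<bar>?I x - ?I x\<bar>"
        by (intro tendsto_rabs tendsto_diff tendsto_const)
      then have "(\<lambda>m. \<bar>?I x - ?S (m + M) x\<bar> powr p) \<longlonglongrightarrow> 0 powr p"
        using p by (intro tendsto_powr') auto
      then show ?case using p tendsto_ennrealI by fastforce
    qed
  qed (auto simp: d_def)
  then have "(\<lambda>m. unit_box_error TYPE('n) p (m + M)) \<longlonglongrightarrow> 0"
    by (simp add: unit_box_error_def)
  then show ?thesis by (rule LIMSEQ_offset)
qed

section \<open>The quasi-norm of \<open>L\<^sup>p\<close>\<close>

lemma Lp_pnorm_cong_AE:
  "AE x in lebesgue. f x = g x \<Longrightarrow> Lp_pnorm p f = Lp_pnorm p g"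
  unfolding Lp_pnorm_def by (rule nn_integral_cong_AE) auto

lemma Lp_pnorm_add_le:
  assumes p: "0 < p" "p \<le> 1"
    and [measurable]: "f \<in> borel_measurable lebesgue" "g \<in> borel_measurable lebesgue"
  shows "Lp_pnorm p (\<lambda>x. f x + g x) \<le> Lp_pnorm p f + Lp_pnorm p g"
proof -
  have "norm (f x + g x) powr p \<le> norm (f x) powr p + norm (g x) powr p" for x
    using p by (intro order_trans[OF powr_mono2 powr_add_le] norm_triangle_ineq) auto
  then have "Lp_pnorm p (\<lambda>x. f x + g x) \<le> (\<integral>\<^sup>+x. ennreal (norm (f x) powr p) + ennreal (norm (g x) powr p) \<partial>lebesgue)"
    unfolding Lp_pnorm_def by (intro nn_integral_mono) (simp add: ennreal_leI flip: ennreal_plus)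
  also have "\<dots> = Lp_pnorm p f + Lp_pnorm p g"
    unfolding Lp_pnorm_def by (rule nn_integral_add) auto
  finally show ?thesis .
qed

lemma Lp_pnorm_sum_le:
  assumes p: "0 < p" "p \<le> 1" and "finite I"
    and "\<And>i. i \<in> I \<Longrightarrow> f i \<in> borel_measurable lebesgue"
  shows "Lp_pnorm p (\<lambda>x. \<Sum>i\<in>I. f i x) \<le> (\<Sum>i\<in>I. Lp_pnorm p (f i))"
  using assms(3,4)
proof (induction I rule: finite_induct)
  case empty
  then show ?case by (simp add: Lp_pnorm_def)
next
  case (insert i I)
  have "Lp_pnorm p (\<lambda>x. f i x + (\<Sum>i\<in>I. f i x)) \<le> Lp_pnorm p (f i) + Lp_pnorm p (\<lambda>x. \<Sum>i\<in>I. f i x)"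
    using insert by (intro Lp_pnorm_add_le p borel_measurable_sum) auto
  also have "\<dots> \<le> Lp_pnorm p (f i) + (\<Sum>i\<in>I. Lp_pnorm p (f i))"
    using insert by (intro add_left_mono) auto
  finally show ?case using insert by simp
qed

lemma Lp_pnorm_cmult:
  assumes [measurable]: "f \<in> borel_measurable lebesgue"
  shows "Lp_pnorm p (\<lambda>x. c * f x) = ennreal (norm c powr p) * Lp_pnorm p f"
  unfolding Lp_pnorm_def norm_mult powr_mult
  by (simp add: ennreal_mult nn_integral_cmult)

lemma borel_measurable_lebesgueI: "f \<in> borel_measurable borel \<Longrightarrow> f \<in> borel_measurable lebesgue"
  by (rule measurable_completion) simp

section \<open>Families of rational functions with a common maximal function\<close>

text \<open>\<open>G\<close> plays the role of a non-tangential maximal function, common to all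
  octants and all apertures. The factor \<open>C\<close> is a parameter rather than existentially
  bound, so that it does not deteriorate under sums; only the null set \<open>N\<close> may vary.
  Rationality at real points off \<open>N\<close> gives continuity up to the boundary there.\<close>

definition controlled ::
    "(real \<Rightarrow> real) \<Rightarrow> (real^'n \<Rightarrow> complex^'n \<Rightarrow> complex) \<Rightarrow> (real^'n \<Rightarrow> real) \<Rightarrow> bool" where
  "controlled C R G \<longleftrightarrow> G \<in> borel_measurable borel \<and> (\<forall>x. 0 \<le> G x) \<and>
     (\<exists>N. negligible N \<and> (\<forall>s\<in>sign_vectors.
        agrees_with_rational_on (tube (octant s) \<union> cvec ` (- N)) (R s) \<and>
        (\<forall>x \<alpha> z. x \<notin> N \<longrightarrow> \<alpha> > 0 \<longrightarrow> z \<in> nt_cone s (vec \<alpha>) x \<longrightarrow> norm (R s z) \<le> C \<alpha> * G x)))"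

definition boundary_sum :: "(real^'n \<Rightarrow> complex^'n \<Rightarrow> complex) \<Rightarrow> real^'n \<Rightarrow> complex" where
  "boundary_sum R x = (\<Sum>s\<in>sign_vectors. R s (cvec x))"

lemma AE_notin_negligible: "negligible N \<Longrightarrow> AE x in lebesgue. x \<notin> N"
  by (intro AE_not_in) (simp add: negligible_iff_null_sets)

lemma controlled_measurable:
  assumes "controlled C R G" "s \<in> sign_vectors"
  shows "(\<lambda>x. R s (cvec x)) \<in> borel_measurable lebesgue"
proof -
  obtain N where N: "negligible N" "agrees_with_rational_on (tube (octant s) \<union> cvec ` (- N)) (R s)"
    using assms unfolding controlled_def by blast
  obtain R' where R': "rational_on (tube (octant s) \<union> cvec ` (- N)) R'"
     "\<And>z. z \<in> tube (octant s) \<union> cvec ` (- N) \<Longrightarrow> R' z = R s z"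
    using agrees_with_rational_onE[OF N(2)] by blast
  show ?thesis
  proof (rule borel_measurable_AE)
    show "(\<lambda>x. R' (cvec x)) \<in> borel_measurable lebesgue"
      by (intro borel_measurable_lebesgueI rational_on_borel_measurable[OF R'(1)])
    show "AE x in lebesgue. R' (cvec x) = R s (cvec x)"
      using AE_notin_negligible[OF N(1)] by eventually_elim (auto intro: R'(2))
  qed
qed

lemma boundary_sum_measurable:
  "controlled C R G \<Longrightarrow> boundary_sum R \<in> borel_measurable lebesgue"
  unfolding boundary_sum_def[abs_def] by (intro borel_measurable_sum controlled_measurable)

lemma controlled_zero: "controlled C (\<lambda>s z. 0) (\<lambda>x. 0)"
  unfolding controlled_def by (auto intro: exI[of _ "{}"] agrees_const)

lemma controlled_add:
  fixes R S :: "real^'n \<Rightarrow> complex^'n \<Rightarrow> complex"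
  assumes "controlled C R G" "controlled C S H"
  shows "controlled C (\<lambda>s z. R s z + S s z) (\<lambda>x. G x + H x)"
proof -
  obtain N where N: "negligible N" "\<forall>s\<in>sign_vectors.
        agrees_with_rational_on (tube (octant s) \<union> cvec ` (- N)) (R s) \<and>
        (\<forall>x \<alpha> z. x \<notin> N \<longrightarrow> \<alpha> > 0 \<longrightarrow> z \<in> nt_cone s (vec \<alpha>) x \<longrightarrow> norm (R s z) \<le> C \<alpha> * G x)"
    using assms(1) unfolding controlled_def by blast
  obtain M where M: "negligible M" "\<forall>s\<in>sign_vectors.
        agrees_with_rational_on (tube (octant s) \<union> cvec ` (- M)) (S s) \<and>
        (\<forall>x \<alpha> z. x \<notin> M \<longrightarrow> \<alpha> > 0 \<longrightarrow> z \<in> nt_cone s (vec \<alpha>) x \<longrightarrow> norm (S s z) \<le> C \<alpha> * H x)"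
    using assms(2) unfolding controlled_def by blast
  show ?thesis unfolding controlled_def
  proof (intro conjI exI[of _ "N \<union> M"] ballI allI impI)
    show "(\<lambda>x. G x + H x) \<in> borel_measurable borel"
      using assms by (auto simp: controlled_def)
    show "0 \<le> G x + H x" for x using assms by (auto simp: controlled_def)
    show "negligible (N \<union> M)" using N M by (simp add: negligible_Un)
    fix s :: "real^'n" assume s: "s \<in> sign_vectors"
    show "agrees_with_rational_on (tube (octant s) \<union> cvec ` (- (N \<union> M))) (\<lambda>z. R s z + S s z)"
      by (rule agrees_add; rule agrees_mono) (use s N M in blast)+
    fix x \<alpha> z assume x: "x \<notin> N \<union> M" "0 < \<alpha>" "z \<in> nt_cone s (vec \<alpha>) x"
    then have "norm (R s z) \<le> C \<alpha> * G x" "norm (S s z) \<le> C \<alpha> * H x" using N M s by auto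
    then show "norm (R s z + S s z) \<le> C \<alpha> * (G x + H x)"
      using norm_triangle_ineq[of "R s z" "S s z"] by (simp add: distrib_left)
  qed
qed

lemma controlled_cmult:
  fixes R :: "real^'n \<Rightarrow> complex^'n \<Rightarrow> complex"
  assumes "controlled C R G"
  shows "controlled C (\<lambda>s z. c * R s z) (\<lambda>x. norm c * G x)"
proof -
  obtain N where N: "negligible N" "\<forall>s\<in>sign_vectors.
        agrees_with_rational_on (tube (octant s) \<union> cvec ` (- N)) (R s) \<and>
        (\<forall>x \<alpha> z. x \<notin> N \<longrightarrow> \<alpha> > 0 \<longrightarrow> z \<in> nt_cone s (vec \<alpha>) x \<longrightarrow> norm (R s z) \<le> C \<alpha> * G x)"
    using assms(1) unfolding controlled_def by blast
  show ?thesis unfolding controlled_def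
  proof (intro conjI exI[of _ N] ballI allI impI)
    show "(\<lambda>x. norm c * G x) \<in> borel_measurable borel"
      using assms by (auto simp: controlled_def)
    show "0 \<le> norm c * G x" for x using assms by (auto simp: controlled_def)
    show "negligible N" by fact
    fix s :: "real^'n" assume s: "s \<in> sign_vectors"
    show "agrees_with_rational_on (tube (octant s) \<union> cvec ` (- N)) (\<lambda>z. c * R s z)"
      using N s by (intro agrees_mult agrees_const) blast
    fix x \<alpha> z assume x: "x \<notin> N" "0 < \<alpha>" "z \<in> nt_cone s (vec \<alpha>) x"
    then have "norm (R s z) \<le> C \<alpha> * G x" using N s by auto
    then show "norm (c * R s z) \<le> C \<alpha> * (norm c * G x)"
      using mult_left_mono[of "norm (R s z)" "C \<alpha> * G x" "norm c"] by (simp add: norm_mult mult_ac)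
  qed
qed

text \<open>\<open>B\<close> stands in for \<open>Lp_pnorm p f\<close> but is kept free, because it
  adds up under sums of functions while the norm is only subadditive. The slack
  \<open>\<epsilon>\<close> makes the notion stable under limits in
  \<open>L\<^sup>p\<close>.\<close>

definition approximable ::
    "real \<Rightarrow> (real \<Rightarrow> real) \<Rightarrow> real \<Rightarrow> real \<Rightarrow> (real^'n \<Rightarrow> complex) \<Rightarrow> real \<Rightarrow> bool" where
  "approximable p C \<eta> A f B \<longleftrightarrow> f \<in> borel_measurable lebesgue \<and>
     (\<forall>\<epsilon>>0. \<exists>R G. controlled C R G \<and>
        Lp_pnorm p (\<lambda>x. f x - boundary_sum R x) \<le> ennreal (\<eta> * B + \<epsilon>) \<and>
        (\<integral>\<^sup>+x. ennreal (G x powr p) \<partial>lebesgue) \<le> ennreal (A * B + \<epsilon>))"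

lemma approximableE:
  assumes "approximable p C \<eta> A f B" "\<epsilon> > 0"
  obtains R G where "controlled C R G"
    "Lp_pnorm p (\<lambda>x. f x - boundary_sum R x) \<le> ennreal (\<eta> * B + \<epsilon>)"
    "(\<integral>\<^sup>+x. ennreal (G x powr p) \<partial>lebesgue) \<le> ennreal (A * B + \<epsilon>)"
  using assms unfolding approximable_def by blast

lemma approximable_cong_AE:
  fixes f g :: "real^'n \<Rightarrow> complex"
  assumes "approximable p C \<eta> A f B" and ae: "AE x in lebesgue. f x = g x"
  shows "approximable p C \<eta> A g B"
proof -
  have "Lp_pnorm p (\<lambda>x. f x - boundary_sum R x) = Lp_pnorm p (\<lambda>x. g x - boundary_sum R x)" for R
    by (rule Lp_pnorm_cong_AE) (use ae in auto)
  then show ?thesis using assms borel_measurable_AE[OF _ ae] unfolding approximable_def by auto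
qed

lemma approximable_mono:
  assumes "approximable p C \<eta> A f B" "B \<le> B'" "\<eta> \<ge> 0" "A \<ge> 0"
  shows "approximable p C \<eta> A f B'"
  unfolding approximable_def
proof (intro conjI allI impI)
  show "f \<in> borel_measurable lebesgue" using assms by (simp add: approximable_def)
  fix \<epsilon> :: real assume "\<epsilon> > 0"
  then obtain R G where 1: "controlled C R G"
    "Lp_pnorm p (\<lambda>x. f x - boundary_sum R x) \<le> ennreal (\<eta> * B + \<epsilon>)"
    "(\<integral>\<^sup>+x. ennreal (G x powr p) \<partial>lebesgue) \<le> ennreal (A * B + \<epsilon>)"
    by (rule approximableE[OF assms(1)])
  have "\<eta> * B \<le> \<eta> * B'" "A * B \<le> A * B'" using assms by (auto intro: mult_left_mono)
  then have "ennreal (\<eta> * B + \<epsilon>) \<le> ennreal (\<eta> * B' + \<epsilon>)" "ennreal (A * B + \<epsilon>) \<le> ennreal (A * B' + \<epsilon>)"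
    by (auto intro: ennreal_leI)
  then show "\<exists>R G. controlled C R G \<and>
        Lp_pnorm p (\<lambda>x. f x - boundary_sum R x) \<le> ennreal (\<eta> * B' + \<epsilon>) \<and>
        (\<integral>\<^sup>+x. ennreal (G x powr p) \<partial>lebesgue) \<le> ennreal (A * B' + \<epsilon>)"
    using 1 order_trans by blast
qed

lemma approximable_zero: "approximable p C \<eta> A (\<lambda>x. 0) 0"
  unfolding approximable_def
  by (auto intro!: exI[of _ "\<lambda>s z. 0"] exI[of _ "\<lambda>x. 0"] controlled_zero simp: Lp_pnorm_def boundary_sum_def)

lemma approximable_add:
  assumes p: "0 < p" "p \<le> 1" and pos: "\<eta> \<ge> 0" "A \<ge> 0" "B \<ge> 0" "B' \<ge> 0"
    and f: "approximable p C \<eta> A f B" and g: "approximable p C \<eta> A g B'"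
  shows "approximable p C \<eta> A (\<lambda>x. f x + g x) (B + B')"
  unfolding approximable_def
proof (intro conjI allI impI)
  have fm[measurable]: "f \<in> borel_measurable lebesgue" and gm[measurable]: "g \<in> borel_measurable lebesgue"
    using f g by (auto simp: approximable_def)
  show "(\<lambda>x. f x + g x) \<in> borel_measurable lebesgue" by simp
  fix \<epsilon> :: real assume e: "\<epsilon> > 0"
  then have e2: "\<epsilon>/2 > 0" by simp
  obtain R G where 1: "controlled C R G"
    "Lp_pnorm p (\<lambda>x. f x - boundary_sum R x) \<le> ennreal (\<eta> * B + \<epsilon>/2)"
    "(\<integral>\<^sup>+x. ennreal (G x powr p) \<partial>lebesgue) \<le> ennreal (A * B + \<epsilon>/2)"
    by (rule approximableE[OF f e2])
  obtain S H where 2: "controlled C S H"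
    "Lp_pnorm p (\<lambda>x. g x - boundary_sum S x) \<le> ennreal (\<eta> * B' + \<epsilon>/2)"
    "(\<integral>\<^sup>+x. ennreal (H x powr p) \<partial>lebesgue) \<le> ennreal (A * B' + \<epsilon>/2)"
    by (rule approximableE[OF g e2])
  note [measurable] = boundary_sum_measurable[OF 1(1)] boundary_sum_measurable[OF 2(1)]
  have G: "G \<in> borel_measurable borel" "H \<in> borel_measurable borel" "\<And>x. 0 \<le> G x" "\<And>x. 0 \<le> H x"
    using 1 2 by (auto simp: controlled_def)
  note [measurable] = borel_measurable_lebesgueI[OF G(1)] borel_measurable_lebesgueI[OF G(2)]
  let ?T = "\<lambda>s z. R s z + S s z"
  have "boundary_sum ?T x = boundary_sum R x + boundary_sum S x" for x
    by (simp add: boundary_sum_def sum.distrib)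
  then have "Lp_pnorm p (\<lambda>x. f x + g x - boundary_sum ?T x)
     = Lp_pnorm p (\<lambda>x. (f x - boundary_sum R x) + (g x - boundary_sum S x))"
    by (simp add: algebra_simps)
  also have "\<dots> \<le> Lp_pnorm p (\<lambda>x. f x - boundary_sum R x) + Lp_pnorm p (\<lambda>x. g x - boundary_sum S x)"
    by (rule Lp_pnorm_add_le[OF p]) auto
  also have "\<dots> \<le> ennreal (\<eta> * B + \<epsilon>/2) + ennreal (\<eta> * B' + \<epsilon>/2)"
    by (intro add_mono 1 2)
  also have "\<dots> = ennreal (\<eta> * (B + B') + \<epsilon>)"
    using pos e by (subst ennreal_plus[symmetric]) (auto simp: algebra_simps)
  finally have 3: "Lp_pnorm p (\<lambda>x. f x + g x - boundary_sum ?T x) \<le> ennreal (\<eta> * (B + B') + \<epsilon>)" .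
  have "(\<integral>\<^sup>+x. ennreal ((G x + H x) powr p) \<partial>lebesgue)
     \<le> (\<integral>\<^sup>+x. ennreal (G x powr p) + ennreal (H x powr p) \<partial>lebesgue)"
    using G by (intro nn_integral_mono) (simp add: ennreal_leI powr_add_le[OF p] flip: ennreal_plus)
  also have "\<dots> = (\<integral>\<^sup>+x. ennreal (G x powr p) \<partial>lebesgue) + (\<integral>\<^sup>+x. ennreal (H x powr p) \<partial>lebesgue)"
    by (rule nn_integral_add) auto
  also have "\<dots> \<le> ennreal (A * B + \<epsilon>/2) + ennreal (A * B' + \<epsilon>/2)"
    by (intro add_mono 1 2)
  also have "\<dots> = ennreal (A * (B + B') + \<epsilon>)"
    using pos e by (subst ennreal_plus[symmetric]) (auto simp: algebra_simps)
  finally show "\<exists>R G. controlled C R G \<and>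
        Lp_pnorm p (\<lambda>x. f x + g x - boundary_sum R x) \<le> ennreal (\<eta> * (B + B') + \<epsilon>) \<and>
        (\<integral>\<^sup>+x. ennreal (G x powr p) \<partial>lebesgue) \<le> ennreal (A * (B + B') + \<epsilon>)"
    using 3 controlled_add[OF 1(1) 2(1)] by blast
qed

lemma approximable_cmult:
  assumes pos: "\<eta> \<ge> 0" "A \<ge> 0" "B \<ge> 0" and f: "approximable p C \<eta> A f B"
  shows "approximable p C \<eta> A (\<lambda>x. c * f x) (norm c powr p * B)"
  unfolding approximable_def
proof (intro conjI allI impI)
  have fm[measurable]: "f \<in> borel_measurable lebesgue" using f by (auto simp: approximable_def)
  show "(\<lambda>x. c * f x) \<in> borel_measurable lebesgue" by simp
  fix \<epsilon> :: real assume e: "\<epsilon> > 0"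
  define k where "k = norm c powr p"
  have k: "k \<ge> 0" by (simp add: k_def)
  \<comment> \<open>The denominator \<open>k + 1\<close> gives \<open>k * d \<le> \<epsilon>\<close>
    and stays positive for \<open>c = 0\<close>.\<close>
  define d where "d = \<epsilon> / (k + 1)"
  have d: "d > 0" "k * d \<le> \<epsilon>" using e k by (auto simp: d_def field_simps)
  obtain R G where 1: "controlled C R G"
    "Lp_pnorm p (\<lambda>x. f x - boundary_sum R x) \<le> ennreal (\<eta> * B + d)"
    "(\<integral>\<^sup>+x. ennreal (G x powr p) \<partial>lebesgue) \<le> ennreal (A * B + d)"
    by (rule approximableE[OF f d(1)])
  note [measurable] = boundary_sum_measurable[OF 1(1)]
  have G: "G \<in> borel_measurable borel" "\<And>x. 0 \<le> G x" using 1 by (auto simp: controlled_def)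
  note [measurable] = borel_measurable_lebesgueI[OF G(1)]
  have up: "ennreal k * ennreal (t * B + d) \<le> ennreal (t * (k * B) + \<epsilon>)" if "t \<ge> 0" for t
  proof -
    have "k * (t * B + d) \<le> t * (k * B) + \<epsilon>" using d(2) by (simp add: algebra_simps)
    then show ?thesis using that k d pos by (subst ennreal_mult[symmetric]) (auto intro!: ennreal_leI)
  qed
  have "boundary_sum (\<lambda>s z. c * R s z) x = c * boundary_sum R x" for x
    by (simp add: boundary_sum_def sum_distrib_left)
  then have "Lp_pnorm p (\<lambda>x. c * f x - boundary_sum (\<lambda>s z. c * R s z) x)
      = Lp_pnorm p (\<lambda>x. c * (f x - boundary_sum R x))" by (simp add: right_diff_distrib)
  also have "\<dots> = ennreal k * Lp_pnorm p (\<lambda>x. f x - boundary_sum R x)"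
    unfolding k_def by (rule Lp_pnorm_cmult) simp
  also have "\<dots> \<le> ennreal (\<eta> * (k * B) + \<epsilon>)"
    by (rule order_trans[OF mult_left_mono[OF 1(2)] up]) (use pos in auto)
  finally have 2: "Lp_pnorm p (\<lambda>x. c * f x - boundary_sum (\<lambda>s z. c * R s z) x) \<le> ennreal (\<eta> * (k * B) + \<epsilon>)" .
  have "(\<integral>\<^sup>+x. ennreal ((norm c * G x) powr p) \<partial>lebesgue) = ennreal k * (\<integral>\<^sup>+x. ennreal (G x powr p) \<partial>lebesgue)"
    by (simp add: powr_mult k_def ennreal_mult nn_integral_cmult)
  also have "\<dots> \<le> ennreal (A * (k * B) + \<epsilon>)"
    by (rule order_trans[OF mult_left_mono[OF 1(3)] up]) (use pos in auto)
  finally show "\<exists>R G. controlled C R G \<and>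
        Lp_pnorm p (\<lambda>x. c * f x - boundary_sum R x) \<le> ennreal (\<eta> * (norm c powr p * B) + \<epsilon>) \<and>
        (\<integral>\<^sup>+x. ennreal (G x powr p) \<partial>lebesgue) \<le> ennreal (A * (norm c powr p * B) + \<epsilon>)"
    using 2 controlled_cmult[OF 1(1), of c] unfolding k_def by blast
qed

lemma approximable_sum:
  assumes p: "0 < p" "p \<le> 1" and pos: "\<eta> \<ge> 0" "A \<ge> 0" and I: "finite I"
    and "\<And>i. i \<in> I \<Longrightarrow> B i \<ge> 0" "\<And>i. i \<in> I \<Longrightarrow> approximable p C \<eta> A (f i) (B i)"
  shows "approximable p C \<eta> A (\<lambda>x. \<Sum>i\<in>I. f i x) (\<Sum>i\<in>I. B i)"
  using I assms(6,7)
proof (induction I rule: finite_induct)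
  case empty
  then show ?case by (simp add: approximable_zero)
next
  case (insert i I)
  then show ?case using approximable_add[OF p pos, of "B i" "\<Sum>i\<in>I. B i" C "f i" "\<lambda>x. \<Sum>i\<in>I. f i x"]
    by (simp add: sum_nonneg)
qed

text \<open>Replacing f by a nearby g costs the distance itself and a slightly larger
  \<open>B\<close>; both disappear in the slack.\<close>

lemma approximable_limit:
  assumes p: "0 < p" "p \<le> 1" and pos: "\<eta> \<ge> 0" "A \<ge> 0" "B \<ge> 0"
    and f: "f \<in> borel_measurable lebesgue"
    and ap: "\<And>\<delta>. \<delta> > 0 \<Longrightarrow> \<exists>g. approximable p C \<eta> A g (B + \<delta>) \<and> Lp_pnorm p (\<lambda>x. f x - g x) \<le> ennreal \<delta>"
  shows "approximable p C \<eta> A f B"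
  unfolding approximable_def
proof (intro conjI allI impI)
  show "f \<in> borel_measurable lebesgue" by fact
  note f[measurable]
  fix \<epsilon> :: real assume e: "\<epsilon> > 0"
  \<comment> \<open>Chosen so that half of \<open>\<epsilon>\<close> covers
    \<open>d + \<eta> * d\<close> in the error and \<open>A * d\<close> in the maximal function at
    once.\<close>
  define d where "d = \<epsilon> / (2 * (\<eta> + A + 1))"
  have d: "d > 0" using e pos by (simp add: d_def)
  have ds: "(\<eta> + A + 1) * d = \<epsilon>/2" using pos unfolding d_def by (simp add: field_simps)
  obtain g where g: "approximable p C \<eta> A g (B + d)" "Lp_pnorm p (\<lambda>x. f x - g x) \<le> ennreal d"
    using ap[OF d] by blast
  have [measurable]: "g \<in> borel_measurable lebesgue" using g by (simp add: approximable_def)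
  have e2: "\<epsilon>/2 > 0" using e by simp
  obtain R G where 1: "controlled C R G"
    "Lp_pnorm p (\<lambda>x. g x - boundary_sum R x) \<le> ennreal (\<eta> * (B + d) + \<epsilon>/2)"
    "(\<integral>\<^sup>+x. ennreal (G x powr p) \<partial>lebesgue) \<le> ennreal (A * (B + d) + \<epsilon>/2)"
    by (rule approximableE[OF g(1) e2])
  note [measurable] = boundary_sum_measurable[OF 1(1)]
  have "Lp_pnorm p (\<lambda>x. f x - boundary_sum R x) = Lp_pnorm p (\<lambda>x. (f x - g x) + (g x - boundary_sum R x))"
    by simp
  also have "\<dots> \<le> Lp_pnorm p (\<lambda>x. f x - g x) + Lp_pnorm p (\<lambda>x. g x - boundary_sum R x)"
    by (rule Lp_pnorm_add_le[OF p]) auto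
  also have "\<dots> \<le> ennreal d + ennreal (\<eta> * (B + d) + \<epsilon>/2)" by (intro add_mono 1 g)
  also have "\<dots> = ennreal (d + (\<eta> * (B + d) + \<epsilon>/2))"
    using pos d e by (subst ennreal_plus) auto
  also have "\<dots> \<le> ennreal (\<eta> * B + \<epsilon>)"
  proof (rule ennreal_leI)
    have "A * d \<ge> 0" using pos d by simp
    then show "d + (\<eta> * (B + d) + \<epsilon>/2) \<le> \<eta> * B + \<epsilon>" using ds by (simp add: algebra_simps)
  qed
  finally have 2: "Lp_pnorm p (\<lambda>x. f x - boundary_sum R x) \<le> ennreal (\<eta> * B + \<epsilon>)" .
  have "ennreal (A * (B + d) + \<epsilon>/2) \<le> ennreal (A * B + \<epsilon>)"
  proof (rule ennreal_leI)
    have "\<eta> * d \<ge> 0" using pos d by simp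
    then show "A * (B + d) + \<epsilon>/2 \<le> A * B + \<epsilon>" using ds d by (simp add: algebra_simps)
  qed
  then show "\<exists>R G. controlled C R G \<and>
        Lp_pnorm p (\<lambda>x. f x - boundary_sum R x) \<le> ennreal (\<eta> * B + \<epsilon>) \<and>
        (\<integral>\<^sup>+x. ennreal (G x powr p) \<partial>lebesgue) \<le> ennreal (A * B + \<epsilon>)"
    using 1 2 order_trans by blast
qed

section \<open>Approximation of arbitrary functions\<close>

text \<open>The hypotheses on m concern the unit box only, and scaling transfers them to every box
  with the same \<open>C\<close>, \<open>\<eta>\<close> and \<open>A\<close>.\<close>

lemma approximable_box:
  fixes c d :: "real^'n"
  assumes m: "m \<ge> 1" and p: "0 < p" and pos: "\<eta> \<ge> 0" "A \<ge> 0"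
    and err: "unit_box_error TYPE('n) p m \<le> ennreal \<eta>"
    and maj: "(\<integral>\<^sup>+x. ennreal (step_majorant m x powr p) \<partial>lborel) ^ CARD('n) \<le> ennreal A"
    and ne: "box c d \<noteq> {}"
  shows "approximable p (\<lambda>\<alpha>. ((2 + \<alpha>) ^ (2 * (m * 2 ^ m))) ^ CARD('n)) \<eta> A
     (indicator (cbox c d)) (measure lebesgue (cbox c d))"
proof -
  define a where "a = (1/2) *\<^sub>R (c + d)"
  define h where "h = (1/2) *\<^sub>R (d - c)"
  have h: "h$j > 0" for j using ne by (simp add: h_def interval_ne_empty_cart)
  have ah: "a - h = c" "a + h = d" by (simp_all add: a_def h_def vec_eq_iff field_simps)
  define B where "B = measure lebesgue (cbox c d)"
  define k where "k = (\<Prod>j\<in>UNIV. h$j)"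
  have k0: "k \<ge> 0" unfolding k_def using h by (auto intro: prod_nonneg less_imp_le)
  \<comment> \<open>The scaling factor is the product of the half side lengths. Enlarging it to the
    volume of the box loses a factor 2^n but puts the bounds in terms of the measure.\<close>
  have "k \<le> (\<Prod>j\<in>UNIV. d$j - c$j)" unfolding k_def using h
    by (intro prod_mono) (auto simp: h_def less_imp_le)
  also have "\<dots> = B"
  proof -
    have "cbox c d \<noteq> {}" using ne box_subset_cbox[of c d] by blast
    then show ?thesis unfolding B_def using content_cbox_cart[of c d] by (simp add: measure_completion)
  qed
  finally have kB: "k \<le> B" .
  let ?R = "box_kernel m a h" and ?G = "box_majorant m a h"
  have ctl: "controlled (\<lambda>\<alpha>. ((2 + \<alpha>) ^ (2 * (m * 2 ^ m))) ^ CARD('n)) ?R ?G"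
    unfolding controlled_def
  proof (intro conjI allI exI[of _ "box_poles m a h"] ballI impI)
    show "?G \<in> borel_measurable borel" by (rule borel_measurable_box_majorant)
    show "0 \<le> ?G x" for x by (rule box_majorant_nonneg)
    show "negligible (box_poles m a h)" using m h by (rule negligible_box_poles)
    show "agrees_with_rational_on (tube (octant s) \<union> cvec ` (- box_poles m a h)) (?R s)"
      if "s \<in> sign_vectors" for s using box_kernel_agrees[OF m h that] .
    show "norm (?R s z) \<le> ((2 + \<alpha>) ^ (2 * (m * 2 ^ m))) ^ CARD('n) * ?G x"
      if "s \<in> sign_vectors" "x \<notin> box_poles m a h" "0 < \<alpha>" "z \<in> nt_cone s (vec \<alpha>) x" for s x \<alpha> z
      using box_kernel_cone_bound[OF m h that(1,3,2,4)] .
  qed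
  have "Lp_pnorm p (\<lambda>x. indicator (cbox c d) x - boundary_sum ?R x)
     = (\<integral>\<^sup>+x. ennreal (\<bar>indicator (cbox (a - h) (a + h)) x
        - (\<Prod>j\<in>UNIV. step_fun m ((x$j - a$j) / h$j))\<bar> powr p) \<partial>lebesgue)"
    unfolding Lp_pnorm_def
  proof (rule nn_integral_cong_AE)
    show "AE x in lebesgue. ennreal (norm (indicator (cbox c d) x - boundary_sum ?R x) powr p)
      = ennreal (\<bar>indicator (cbox (a - h) (a + h)) x - (\<Prod>j\<in>UNIV. step_fun m ((x$j - a$j) / h$j))\<bar> powr p)"
      using AE_notin_negligible[OF negligible_box_poles[OF m h, of a]]
    proof eventually_elim
      case (elim x)
      have "(indicator (cbox c d) x :: complex) = complex_of_real (indicator (cbox c d) x)"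
        by (simp add: indicator_def)
      then have "norm (indicator (cbox c d) x - boundary_sum ?R x)
         = \<bar>indicator (cbox c d) x - (\<Prod>j\<in>UNIV. step_fun m ((x$j - a$j) / h$j))\<bar>"
        using box_kernel_sum[of x m a h] elim unfolding boundary_sum_def
        by (metis norm_of_real of_real_diff)
      then show ?case by (simp add: ah)
    qed
  qed
  also have "\<dots> = ennreal k * unit_box_error TYPE('n) p m"
    unfolding nn_integral_completion k_def by (rule box_error[OF h p])
  also have "\<dots> \<le> ennreal B * ennreal \<eta>" using kB by (intro mult_mono err ennreal_leI) auto
  also have "\<dots> = ennreal (\<eta> * B)" using pos kB k0 by (simp add: ennreal_mult mult.commute)
  finally have 1: "Lp_pnorm p (\<lambda>x. indicator (cbox c d) x - boundary_sum ?R x) \<le> ennreal (\<eta> * B)" .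
  have "(\<integral>\<^sup>+x. ennreal (?G x powr p) \<partial>lebesgue)
     = ennreal k * (\<integral>\<^sup>+x. ennreal (step_majorant m x powr p) \<partial>lborel) ^ CARD('n)"
    unfolding nn_integral_completion k_def by (rule box_majorant_Lp[OF h])
  also have "\<dots> \<le> ennreal B * ennreal A" using kB by (intro mult_mono maj ennreal_leI) auto
  also have "\<dots> = ennreal (A * B)" using pos kB k0 by (simp add: ennreal_mult mult.commute)
  finally have 2: "(\<integral>\<^sup>+x. ennreal (?G x powr p) \<partial>lebesgue) \<le> ennreal (A * B)" .
  show ?thesis unfolding approximable_def B_def[symmetric]
  proof (intro conjI allI impI)
    show "(indicator (cbox c d) :: real^'n \<Rightarrow> complex) \<in> borel_measurable lebesgue"
      by (intro borel_measurable_lebesgueI borel_measurable_indicator) simp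
    fix \<epsilon> :: real assume "\<epsilon> > 0"
    then have "ennreal (\<eta> * B) \<le> ennreal (\<eta> * B + \<epsilon>)" "ennreal (A * B) \<le> ennreal (A * B + \<epsilon>)"
      by (auto intro: ennreal_leI)
    then show "\<exists>R G. controlled (\<lambda>\<alpha>. ((2 + \<alpha>) ^ (2 * (m * 2 ^ m))) ^ CARD('n)) R G \<and>
        Lp_pnorm p (\<lambda>x. indicator (cbox c d) x - boundary_sum R x) \<le> ennreal (\<eta> * B + \<epsilon>) \<and>
        (\<integral>\<^sup>+x. ennreal (G x powr p) \<partial>lebesgue) \<le> ennreal (A * B + \<epsilon>)"
      using ctl 1 2 order_trans by blast
  qed
qed

text \<open>The difference of two indicators has modulus 0 or 1, so its p-th power integrates to the
  measure of the symmetric difference.\<close>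

lemma Lp_pnorm_indicator_diff_le:
  fixes S T :: "(real^'n) set"
  assumes "S \<in> lmeasurable" "T \<in> lmeasurable" "measure lebesgue (S - T) \<le> a" "measure lebesgue (T - S) \<le> b"
    and p: "0 < p"
  shows "Lp_pnorm p (\<lambda>x. indicator S x - indicator T x) \<le> ennreal (a + b)"
proof -
  have ST: "S - T \<in> lmeasurable" "T - S \<in> lmeasurable" using assms by auto
  have "Lp_pnorm p (\<lambda>x. indicator S x - indicator T x)
      = (\<integral>\<^sup>+x. indicator (S - T) x + indicator (T - S) x \<partial>lebesgue)"
    unfolding Lp_pnorm_def using p by (intro nn_integral_cong) (auto simp: indicator_def)
  also have "\<dots> = emeasure lebesgue (S - T) + emeasure lebesgue (T - S)"
    using ST by (subst nn_integral_add) (auto simp: fmeasurableD)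
  also have "\<dots> = ennreal (measure lebesgue (S - T)) + ennreal (measure lebesgue (T - S))"
    using ST by (simp add: emeasure_eq_measure2)
  also have "\<dots> = ennreal (measure lebesgue (S - T) + measure lebesgue (T - S))"
    by (rule ennreal_plus[symmetric]) auto
  also have "\<dots> \<le> ennreal (a + b)" using assms by (intro ennreal_leI add_mono)
  finally show ?thesis .
qed

text \<open>Boxes with disjoint interiors overlap only in their boundaries, which are null sets. So
  the indicator of the union is almost everywhere the sum of the indicators, the measures add
  exactly, and nothing is lost in \<open>B\<close>.\<close>

lemma approximable_finite_boxes:
  fixes \<F> :: "(real^'n) set set"
  assumes p: "0 < p" "p \<le> 1" and pos: "\<eta> \<ge> 0" "A \<ge> 0"
    and box: "\<And>c d::real^'n. box c d \<noteq> {} \<Longrightarrow>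
       approximable p C \<eta> A (indicator (cbox c d)) (measure lebesgue (cbox c d))"
    and F: "finite \<F>" "\<And>K. K \<in> \<F> \<Longrightarrow> \<exists>c d. K = cbox c d \<and> box c d \<noteq> {}"
    and disj: "pairwise (\<lambda>A B. interior A \<inter> interior B = {}) \<F>"
  shows "approximable p C \<eta> A (indicator (\<Union>\<F>)) (measure lebesgue (\<Union>\<F>))"
proof -
  have negl: "negligible (K - interior K)" if "K \<in> \<F>" for K
    using F(2)[OF that] negligible_frontier_interval by (metis interior_cbox)
  have "pairwise (\<lambda>S T. negligible (S \<inter> T)) \<F>"
  proof (rule pairwiseI)
    fix S T assume ST: "S \<in> \<F>" "T \<in> \<F>" "S \<noteq> T"
    then have "interior S \<inter> interior T = {}" using disj by (simp add: pairwise_def)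
    then have "S \<inter> T \<subseteq> (S - interior S) \<union> (T - interior T)" by blast
    then show "negligible (S \<inter> T)"
      using negl[OF ST(1)] negl[OF ST(2)] by (meson negligible_Un negligible_subset)
  qed
  then have meas: "measure lebesgue (\<Union>\<F>) = (\<Sum>K\<in>\<F>. measure lebesgue K)"
    using F by (intro measure_negligible_finite_Union) auto
  have "approximable p C \<eta> A (\<lambda>x. \<Sum>K\<in>\<F>. indicator K x) (\<Sum>K\<in>\<F>. measure lebesgue K)"
    by (rule approximable_sum[OF p pos F(1)]) (use F(2) box in force)+
  moreover have "AE x in lebesgue. (\<Sum>K\<in>\<F>. indicator K x) = (indicator (\<Union>\<F>) x :: complex)"
  proof -
    have "negligible (\<Union>K\<in>\<F>. K - interior K)"
      using F(1) negl by (intro negligible_Union) auto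
    from AE_notin_negligible[OF this] show ?thesis
    proof eventually_elim
      case (elim x)
      show ?case
      proof (cases "x \<in> \<Union>\<F>")
        case True
        then obtain K where K: "K \<in> \<F>" "x \<in> K" by blast
        have other: "x \<notin> K'" if "K' \<in> \<F>" "K' \<noteq> K" for K'
        proof
          assume "x \<in> K'"
          then have "x \<in> interior K'" "x \<in> interior K" using elim K that by auto
          then show False using disj K that unfolding pairwise_def by blast
        qed
        have "(\<Sum>K'\<in>\<F>. indicator K' x) = (\<Sum>K'\<in>\<F>. if K' = K then 1 else (0::complex))"
          using K other by (intro sum.cong) (auto simp: indicator_def)
        also have "\<dots> = 1" using F(1) K by simp
        finally show ?thesis using True by (simp only: indicator_simps(1))
      qed (auto intro!: sum.neutral simp: indicator_def)
    qed
  qed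
  ultimately show ?thesis unfolding meas by (rule approximable_cong_AE)
qed

text \<open>Cover \<open>E\<close> by countably many non-overlapping boxes of total measure at most
  \<open>\<delta>/2\<close> above that of \<open>E\<close>, then keep finitely many and lose at most
  another \<open>\<delta>/2\<close>.\<close>

lemma approximable_bounded_set:
  fixes E :: "(real^'n) set"
  assumes p: "0 < p" "p \<le> 1" and pos: "\<eta> \<ge> 0" "A \<ge> 0"
    and box: "\<And>c d::real^'n. box c d \<noteq> {} \<Longrightarrow>
       approximable p C \<eta> A (indicator (cbox c d)) (measure lebesgue (cbox c d))"
    and E: "E \<in> lmeasurable" "bounded E"
  shows "approximable p C \<eta> A (indicator E) (measure lebesgue E)"
proof (rule approximable_limit[OF p pos])
  show "measure lebesgue E \<ge> 0" by simp
  show "indicator E \<in> borel_measurable lebesgue" using E by (simp add: fmeasurableD)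
  fix \<delta> :: real assume d: "\<delta> > 0"
  then have d2: "\<delta>/2 > 0" by simp
  obtain r where r: "r > 0" "E \<subseteq> cbox (vec (-r)) (vec r)"
  proof -
    obtain r where "E \<subseteq> ball 0 r" "r > 0" using bounded_subset_ballD[OF E(2)] by blast
    moreover have "ball 0 r \<subseteq> cbox (vec (-r)) (vec r :: real^'n)"
    proof
      fix x :: "real^'n" assume "x \<in> ball 0 r"
      then have "\<bar>x$j\<bar> \<le> r" for j using component_le_norm_cart[of x j] by auto
      then show "x \<in> cbox (vec (-r)) (vec r)" by (auto simp: mem_box_cart abs_le_iff minus_le_iff)
    qed
    ultimately show ?thesis using that by blast
  qed
  have ne: "box (vec (-r)) (vec r :: real^'n) \<noteq> {}" using r by (simp add: interval_ne_empty_cart)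
  obtain \<D> where D: "countable \<D>" "\<And>K. K \<in> \<D> \<Longrightarrow> \<exists>c d. K = cbox c d"
     "pairwise (\<lambda>A B. interior A \<inter> interior B = {}) \<D>" "\<And>K. K \<in> \<D> \<Longrightarrow> interior K \<noteq> {}"
     "E \<subseteq> \<Union>\<D>" "\<Union>\<D> \<in> lmeasurable" "measure lebesgue (\<Union>\<D>) \<le> measure lebesgue E + \<delta>/2"
    using measurable_outer_intervals_bounded[OF E(1) r(2) d2] ne by metis
  \<comment> \<open>Initial segments of an enumeration; \<open>to_nat_on\<close> works for finite
    and infinite \<open>\<D>\<close> alike.\<close>
  define F where "F n = {K\<in>\<D>. to_nat_on \<D> K < n}" for n
  have finF: "finite (F n)" for n
  proof (rule finite_imageD)
    show "finite (to_nat_on \<D> ` F n)" by (rule finite_subset[of _ "{..<n}"]) (auto simp: F_def)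
    show "inj_on (to_nat_on \<D>) (F n)"
      using inj_on_to_nat_on[OF D(1)] by (rule inj_on_subset) (auto simp: F_def)
  qed
  have Fb: "\<exists>c d. K = cbox c d \<and> box c d \<noteq> {}" if "K \<in> F n" for K n
    using D(2,4) that unfolding F_def by (metis (mono_tags, lifting) interior_cbox mem_Collect_eq)
  have Fm: "\<Union>(F n) \<in> lmeasurable" for n
    using finF Fb by (intro fmeasurable.finite_Union) (auto dest: Fb)
  have UF: "(\<Union>n. \<Union>(F n)) = \<Union>\<D>" unfolding F_def by blast
  have "(\<lambda>n. measure lebesgue (\<Union>(F n))) \<longlonglongrightarrow> measure lebesgue (\<Union>n. \<Union>(F n))"
  proof (rule Lim_measure_incseq)
    show "range (\<lambda>n. \<Union>(F n)) \<subseteq> sets lebesgue" using Fm by (auto simp: fmeasurableD)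
    show "incseq (\<lambda>n. \<Union>(F n))" by (rule incseq_SucI) (auto simp: F_def)
    show "emeasure lebesgue (\<Union>n. \<Union>(F n)) \<noteq> \<infinity>" 
      unfolding UF infinity_ennreal_def by (rule fmeasurableD2[OF D(6)])
  qed
  then have "\<forall>\<^sub>F n in sequentially. measure lebesgue (\<Union>\<D>) - \<delta>/2 < measure lebesgue (\<Union>(F n))"
    unfolding UF using d by (intro order_tendstoD(1)) auto
  then obtain n where n: "measure lebesgue (\<Union>\<D>) - \<delta>/2 < measure lebesgue (\<Union>(F n))"
    by (meson eventually_happens trivial_limit_sequentially)
  have sub: "\<Union>(F n) \<subseteq> \<Union>\<D>" by (auto simp: F_def)
  show "\<exists>g. approximable p C \<eta> A g (measure lebesgue E + \<delta>) \<and>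
      Lp_pnorm p (\<lambda>x. indicator E x - g x) \<le> ennreal \<delta>"
  proof (intro exI conjI)
    have ap: "approximable p C \<eta> A (indicator (\<Union>(F n))) (measure lebesgue (\<Union>(F n)))"
    proof (rule approximable_finite_boxes[OF p pos box finF Fb])
      show "pairwise (\<lambda>A B. interior A \<inter> interior B = {}) (F n)"
        using D(3) by (rule pairwise_subset) (auto simp: F_def)
    qed auto
    have "measure lebesgue (\<Union>(F n)) \<le> measure lebesgue (\<Union>\<D>)"
      using sub Fm D(6) by (intro measure_mono_fmeasurable) (auto simp: fmeasurableD)
    then show "approximable p C \<eta> A (indicator (\<Union>(F n))) (measure lebesgue E + \<delta>)"
      by (intro approximable_mono[OF ap _ pos]) (use D(7) d in linarith)
    have 1: "measure lebesgue (E - \<Union>(F n)) \<le> \<delta>/2"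
    proof -
      have "measure lebesgue (E - \<Union>(F n)) \<le> measure lebesgue (\<Union>\<D> - \<Union>(F n))"
        using D E Fm by (intro measure_mono_fmeasurable) (auto simp: fmeasurableD fmeasurable.Diff)
      also have "\<dots> = measure lebesgue (\<Union>\<D>) - measure lebesgue (\<Union>(F n))"
        using D Fm sub by (intro measurable_measure_Diff) (auto simp: fmeasurableD)
      finally show ?thesis using n by linarith
    qed
    have 2: "measure lebesgue (\<Union>(F n) - E) \<le> \<delta>/2"
    proof -
      have "measure lebesgue (\<Union>(F n) - E) \<le> measure lebesgue (\<Union>\<D> - E)"
        using D E Fm sub by (intro measure_mono_fmeasurable) (auto simp: fmeasurableD fmeasurable.Diff)
      also have "\<dots> = measure lebesgue (\<Union>\<D>) - measure lebesgue E"
        using D E by (intro measurable_measure_Diff) (auto simp: fmeasurableD)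
      finally show ?thesis using D(7) by linarith
    qed
    show "Lp_pnorm p (\<lambda>x. indicator E x - indicator (\<Union>(F n)) x) \<le> ennreal \<delta>"
      using Lp_pnorm_indicator_diff_le[OF E(1) Fm 1 2 p(1)] by simp
  qed
qed

text \<open>The level sets are disjoint, so the p-th power of the norm is exactly the sum of
  \<open>norm y powr p\<close> times their measures, and adding up the level sets loses nothing.
  Bounded support makes them bounded sets of finite measure.\<close>

lemma approximable_simple:
  fixes s :: "real^'n \<Rightarrow> complex"
  assumes p: "0 < p" "p \<le> 1" and pos: "\<eta> \<ge> 0" "A \<ge> 0"
    and box: "\<And>c d::real^'n. box c d \<noteq> {} \<Longrightarrow>
       approximable p C \<eta> A (indicator (cbox c d)) (measure lebesgue (cbox c d))"
    and s: "simple_function lebesgue s" and bd: "bounded {x. s x \<noteq> 0}"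
  shows "approximable p C \<eta> A s (enn2real (Lp_pnorm p s))"
proof -
  define Y where "Y = range s - {0}"
  have Y: "finite Y" using s by (simp add: Y_def simple_function_def)
  define E where "E y = s -` {y}" for y
  have Em: "E y \<in> sets lebesgue" for y using simple_functionD(2)[OF s, of "{y}"] by (simp add: E_def)
  have Eb: "bounded (E y)" if "y \<in> Y" for y
    using bd by (rule bounded_subset) (use that in \<open>auto simp: E_def Y_def\<close>)
  have El: "E y \<in> lmeasurable" if "y \<in> Y" for y
    using Em Eb[OF that] by (metis bounded_set_imp_lmeasurable)
  have rep: "s x = (\<Sum>y\<in>Y. y * indicator (E y) x)" for x
  proof -
    have "(\<Sum>y\<in>Y. y * indicator (E y) x) = (\<Sum>y\<in>Y. if y = s x then y else 0)"
      by (rule sum.cong) (auto simp: E_def)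
    also have "\<dots> = s x" using Y by (simp add: Y_def)
    finally show ?thesis by simp
  qed
  have ap: "approximable p C \<eta> A (\<lambda>x. y * indicator (E y) x) (norm y powr p * measure lebesgue (E y))"
    if "y \<in> Y" for y
    by (rule approximable_cmult[OF pos _ approximable_bounded_set[OF p pos box El[OF that] Eb[OF that]]]) auto
  have "approximable p C \<eta> A (\<lambda>x. \<Sum>y\<in>Y. y * indicator (E y) x) (\<Sum>y\<in>Y. norm y powr p * measure lebesgue (E y))"
    by (rule approximable_sum[OF p pos Y _ ap]) auto
  then have 1: "approximable p C \<eta> A s (\<Sum>y\<in>Y. norm y powr p * measure lebesgue (E y))"
    using rep by presburger
  have pt: "ennreal (norm (s x) powr p) = (\<Sum>y\<in>Y. ennreal (norm y powr p) * indicator (E y) x)" for x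
  proof -
    have "(\<Sum>y\<in>Y. ennreal (norm y powr p) * indicator (E y) x) = (\<Sum>y\<in>Y. if y = s x then ennreal (norm y powr p) else 0)"
      by (rule sum.cong) (auto simp: E_def)
    also have "\<dots> = ennreal (norm (s x) powr p)" using Y p by (simp add: Y_def)
    finally show ?thesis by simp
  qed
  have "Lp_pnorm p s = (\<Sum>y\<in>Y. ennreal (norm y powr p) * emeasure lebesgue (E y))"
    unfolding Lp_pnorm_def pt using Em by (subst nn_integral_sum) (auto simp: nn_integral_cmult)
  also have "\<dots> = (\<Sum>y\<in>Y. ennreal (norm y powr p * measure lebesgue (E y)))"
    using El by (intro sum.cong) (auto simp: emeasure_eq_measure2 ennreal_mult)
  also have "\<dots> = ennreal (\<Sum>y\<in>Y. norm y powr p * measure lebesgue (E y))"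
    by (rule sum_ennreal) auto
  finally have "enn2real (Lp_pnorm p s) = (\<Sum>y\<in>Y. norm y powr p * measure lebesgue (E y))"
    by (simp add: sum_nonneg)
  with 1 show ?thesis by simp
qed

text \<open>Simple functions of bounded support converge to f under the majorant
  \<open>3 * norm (f x)\<close>; their norms exceed that of f by at most the distance, which is the
  \<open>\<delta>\<close> granted by \<open>approximable_limit\<close>.\<close>

lemma approximable_Lp:
  fixes f :: "real^'n \<Rightarrow> complex"
  assumes p: "0 < p" "p \<le> 1" and pos: "\<eta> \<ge> 0" "A \<ge> 0"
    and box: "\<And>c d::real^'n. box c d \<noteq> {} \<Longrightarrow>
       approximable p C \<eta> A (indicator (cbox c d)) (measure lebesgue (cbox c d))"
    and f: "f \<in> Lp p"
  shows "approximable p C \<eta> A f (enn2real (Lp_pnorm p f))"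
proof (rule approximable_limit[OF p pos])
  show "enn2real (Lp_pnorm p f) \<ge> 0" by simp
  show fm[measurable]: "f \<in> borel_measurable lebesgue" using f by (simp add: Lp_def)
  have fin: "Lp_pnorm p f < \<infinity>" using f by (simp add: Lp_def)
  obtain S where S: "\<And>i. simple_function lebesgue (S i)" "\<And>x. (\<lambda>i. S i x) \<longlonglongrightarrow> f x"
     "\<And>i x. norm (S i x) \<le> 2 * norm (f x)"
    using borel_measurable_implies_sequence_metric[OF fm, of 0] by auto
  \<comment> \<open>Cutting off outside a ball secures the bounded support and does not affect the
    pointwise limit.\<close>
  define T where "T i x = (if norm x \<le> real i then S i x else 0)" for i x
  have Ts: "simple_function lebesgue (T i)" for i
  proof -
    have "simple_function lebesgue (\<lambda>x. if x \<in> cball 0 (real i) then S i x else 0)"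
      by (rule simple_function_If_set) (use S(1) in auto)
    then show ?thesis by (simp add: T_def[abs_def])
  qed
  have Tl: "(\<lambda>i. T i x) \<longlonglongrightarrow> f x" for x
  proof (rule Lim_transform_eventually[OF S(2)])
    obtain n where "norm x \<le> real n" using real_arch_simple by blast
    then show "\<forall>\<^sub>F i in sequentially. S i x = T i x"
      by (auto simp: T_def eventually_sequentially intro!: exI[of _ n])
  qed
  have Tb: "norm (T i x) \<le> 2 * norm (f x)" for i x using S(3)[of i x] by (auto simp: T_def)
  have Tm[measurable]: "T i \<in> borel_measurable lebesgue" for i
    using Ts by (rule borel_measurable_simple_function)
  have "(\<lambda>i. \<integral>\<^sup>+x. ennreal (norm (f x - T i x) powr p) \<partial>lebesgue) \<longlonglongrightarrow> (\<integral>\<^sup>+x. 0 \<partial>(lebesgue :: (real^'n) measure))"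
  proof (rule nn_integral_dominated_convergence[where w="\<lambda>x. ennreal (3 powr p) * ennreal (norm (f x) powr p)"])
    show "AE x in lebesgue. ennreal (norm (f x - T i x) powr p) \<le> ennreal (3 powr p) * ennreal (norm (f x) powr p)" for i
    proof (intro AE_I2)
      fix x
      have "norm (f x - T i x) \<le> 3 * norm (f x)" using norm_triangle_ineq4[of "f x" "T i x"] Tb[of i x] by linarith
      then have "norm (f x - T i x) powr p \<le> (3 * norm (f x)) powr p" using p by (intro powr_mono2) auto
      then show "ennreal (norm (f x - T i x) powr p) \<le> ennreal (3 powr p) * ennreal (norm (f x) powr p)"
        by (simp add: powr_mult ennreal_leI flip: ennreal_mult)
    qed
    show "(\<integral>\<^sup>+x. ennreal (3 powr p) * ennreal (norm (f x) powr p) \<partial>lebesgue) < \<infinity>"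
      using fin by (simp add: nn_integral_cmult Lp_pnorm_def ennreal_mult_less_top)
    show "AE x in lebesgue. (\<lambda>i. ennreal (norm (f x - T i x) powr p)) \<longlonglongrightarrow> 0"
    proof (intro AE_I2)
      fix x
      have "(\<lambda>i. norm (f x - T i x)) \<longlonglongrightarrow> norm (f x - f x)" by (intro tendsto_norm tendsto_diff tendsto_const Tl)
      then have "(\<lambda>i. norm (f x - T i x) powr p) \<longlonglongrightarrow> 0 powr p" using p by (intro tendsto_powr') auto
      then show "(\<lambda>i. ennreal (norm (f x - T i x) powr p)) \<longlonglongrightarrow> 0" using p tendsto_ennrealI by fastforce
    qed
  qed auto
  then have lim: "(\<lambda>i. Lp_pnorm p (\<lambda>x. f x - T i x)) \<longlonglongrightarrow> 0" by (simp add: Lp_pnorm_def)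
  fix \<delta> :: real assume d: "\<delta> > 0"
  then have "\<forall>\<^sub>F i in sequentially. Lp_pnorm p (\<lambda>x. f x - T i x) < ennreal \<delta>"
    using lim by (intro order_tendstoD(2)) auto
  then obtain i where i: "Lp_pnorm p (\<lambda>x. f x - T i x) < ennreal \<delta>"
    by (meson eventually_happens trivial_limit_sequentially)
  have "bounded {x. T i x \<noteq> 0}"
    by (rule bounded_subset[of "cball 0 (real i)"]) (auto simp: T_def split: if_splits)
  then have ap: "approximable p C \<eta> A (T i) (enn2real (Lp_pnorm p (T i)))"
    by (intro approximable_simple[OF p pos box Ts]) auto
  have "Lp_pnorm p (T i) = Lp_pnorm p (\<lambda>x. f x + - 1 * (f x - T i x))" by simp
  also have "\<dots> \<le> Lp_pnorm p f + Lp_pnorm p (\<lambda>x. - 1 * (f x - T i x))"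
    by (rule Lp_pnorm_add_le[OF p]) auto
  also have "Lp_pnorm p (\<lambda>x. - 1 * (f x - T i x)) = Lp_pnorm p (\<lambda>x. f x - T i x)"
    by (subst Lp_pnorm_cmult) auto
  also have "Lp_pnorm p f + Lp_pnorm p (\<lambda>x. f x - T i x) \<le> ennreal (enn2real (Lp_pnorm p f)) + ennreal \<delta>"
    using i fin by (intro add_mono) auto
  also have "\<dots> = ennreal (enn2real (Lp_pnorm p f) + \<delta>)" using d by (subst ennreal_plus) auto
  finally have "enn2real (Lp_pnorm p (T i)) \<le> enn2real (Lp_pnorm p f) + \<delta>"
    using d by (intro enn2real_leI) auto
  then have "approximable p C \<eta> A (T i) (enn2real (Lp_pnorm p f) + \<delta>)"
    by (rule approximable_mono[OF ap _ pos])
  then show "\<exists>g. approximable p C \<eta> A g (enn2real (Lp_pnorm p f) + \<delta>) \<and>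
       Lp_pnorm p (\<lambda>x. f x - g x) \<le> ennreal \<delta>"
    using i less_imp_le by blast
qed

text \<open>The unit-box error is made smaller than 1/4, leaving another quarter of the norm for the
  slack. \<open>C\<close> and \<open>A\<close> are fixed before f: they come from a single m
  determined by n and p.\<close>

proposition half_approximation:
  fixes p :: real
  assumes p: "0 < p" "p < 1"
  obtains C :: "real \<Rightarrow> real" and A :: real where "\<And>\<alpha>. \<alpha> > 0 \<Longrightarrow> C \<alpha> > 0" "A > 0"
    "\<And>f :: real^'n \<Rightarrow> complex. f \<in> Lp p \<Longrightarrow> \<exists>R G. controlled C R G \<and>
       Lp_pnorm p (\<lambda>x. f x - boundary_sum R x) \<le> ennreal (1/2) * Lp_pnorm p f \<and>
       (\<integral>\<^sup>+x. ennreal (G x powr p) \<partial>lebesgue) \<le> ennreal A * Lp_pnorm p f"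
proof -
  have "\<forall>\<^sub>F m in sequentially. unit_box_error TYPE('n) p m < ennreal (1/4)"
    using unit_box_error_tendsto[OF p(1), where 'n='n] by (intro order_tendstoD(2)) auto
  moreover have "\<forall>\<^sub>F m in sequentially. real m * p > 1"
  proof -
    obtain M :: nat where M: "real M * p > 1" using p ex_less_of_nat_mult[of p 1] by auto
    show ?thesis unfolding eventually_sequentially
    proof (intro exI[of _ M] allI impI)
      fix n assume "M \<le> n"
      then have "real M * p \<le> real n * p" using p by (intro mult_right_mono) auto
      then show "1 < real n * p" using M by linarith
    qed
  qed
  moreover have "\<forall>\<^sub>F m in sequentially. m \<ge> (1::nat)" by (rule eventually_ge_at_top)
  ultimately have "\<forall>\<^sub>F m in sequentially. unit_box_error TYPE('n) p m < ennreal (1/4) \<and> real m * p > 1 \<and> m \<ge> 1"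
    by eventually_elim auto
  from eventually_happens[OF this]
  obtain m where m: "unit_box_error TYPE('n) p m < ennreal (1/4)" "real m * p > 1" "m \<ge> 1"
    by auto
  define I where "I = (\<integral>\<^sup>+x. ennreal (step_majorant m x powr p) \<partial>lborel) ^ CARD('n)"
  have I: "I < \<infinity>" using step_majorant_Lp[OF p m(2)] by (simp add: I_def power_less_top_ennreal)
  define A where "A = enn2real I"
  have A: "A \<ge> 0" "I \<le> ennreal A" using I by (auto simp: A_def)
  define C :: "real \<Rightarrow> real" where "C = (\<lambda>\<alpha>. ((2 + \<alpha>) ^ (2 * (m * 2 ^ m))) ^ CARD('n))"
  have box: "approximable p C (1/4) A (indicator (cbox c d)) (measure lebesgue (cbox c d))"
    if "box c d \<noteq> {}" for c d :: "real^'n"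
    unfolding C_def using m A that by (intro approximable_box p) (auto simp: I_def)
  show ?thesis
  \<comment> \<open>Raising \<open>A\<close> by 1 makes it positive and absorbs the slack
    \<open>b/4\<close>.\<close>
  proof (rule that[of C "A + 1"])
    show "C \<alpha> > 0" if "\<alpha> > 0" for \<alpha> using that by (simp add: C_def)
    show "A + 1 > 0" using A by simp
    fix f :: "real^'n \<Rightarrow> complex" assume f: "f \<in> Lp p"
    have ap: "approximable p C (1/4) A f (enn2real (Lp_pnorm p f))"
      by (rule approximable_Lp[OF _ _ _ _ box f]) (use p A in auto)
    have fin: "Lp_pnorm p f < \<infinity>" using f by (simp add: Lp_def)
    show "\<exists>R G. controlled C R G \<and>
       Lp_pnorm p (\<lambda>x. f x - boundary_sum R x) \<le> ennreal (1/2) * Lp_pnorm p f \<and>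
       (\<integral>\<^sup>+x. ennreal (G x powr p) \<partial>lebesgue) \<le> ennreal (A + 1) * Lp_pnorm p f"
    proof (cases "Lp_pnorm p f = 0")
      \<comment> \<open>For norm 0 there is no room for a positive slack, so the zero family is
        taken.\<close>
      case True
      then show ?thesis
        by (intro exI[of _ "\<lambda>s z. 0"] exI[of _ "\<lambda>x. 0"]) (simp add: controlled_zero boundary_sum_def)
    next
      case False
      define b where "b = enn2real (Lp_pnorm p f)"
      have b: "Lp_pnorm p f = ennreal b" "b > 0"
        using False fin by (auto simp: b_def enn2real_positive_iff zero_less_iff_neq_zero)
      have b4: "b/4 > 0" using b by simp
      obtain R G where RG: "controlled C R G"
        "Lp_pnorm p (\<lambda>x. f x - boundary_sum R x) \<le> ennreal (1/4 * b + b/4)"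
        "(\<integral>\<^sup>+x. ennreal (G x powr p) \<partial>lebesgue) \<le> ennreal (A * b + b/4)"
        by (rule approximableE[OF ap[folded b_def] b4])
      have "ennreal (1/4 * b + b/4) = ennreal (1/2) * ennreal b"
        using b by (subst ennreal_mult[symmetric]) auto
      moreover have "ennreal (A * b + b/4) \<le> ennreal (A + 1) * ennreal b"
        using b A by (auto intro!: ennreal_leI simp: distrib_right simp flip: ennreal_mult)
      ultimately show ?thesis using RG unfolding b(1)
        by (intro exI[of _ R] exI[of _ G] conjI) (auto intro: order_trans)
    qed
  qed
qed

section \<open>Boundary behaviour\<close>

lemma tpt_Re_Im: "tpt (\<chi> j. Re (z$j)) (\<chi> j. Im (z$j)) = z"
  by (simp add: tpt_def vec_eq_iff)

lemma nt_cone_subset_tube: "nt_cone s \<alpha> x \<subseteq> tube (octant s)"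
  by (auto simp: nt_cone_def tube_def tpt_def)

text \<open>Non-tangential limits use one aperture per coordinate, the maximal bounds a common one;
  this inclusion links them. The summand 1 keeps the common aperture positive for every
  \<open>\<alpha>\<close>.\<close>

lemma nt_cone_subset_uniform:
  fixes \<alpha> :: "real^'n"
  shows "nt_cone s \<alpha> x \<subseteq> nt_cone s (vec (norm \<alpha> + 1)) x"
proof
  fix z assume "z \<in> nt_cone s \<alpha> x"
  then obtain u v where uv: "z = tpt u v" "v \<in> octant s" "\<And>j. \<bar>u$j - x$j\<bar> < \<alpha>$j * (s$j * v$j)"
    by (auto simp: nt_cone_def)
  have "\<bar>u$j - x$j\<bar> < (norm \<alpha> + 1) * (s$j * v$j)" for j
  proof -
    have "\<alpha>$j \<le> norm \<alpha> + 1" using component_le_norm_cart[of \<alpha> j] by linarith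
    moreover have "s$j * v$j > 0" using uv(2) by (simp add: octant_def)
    ultimately have "\<alpha>$j * (s$j * v$j) \<le> (norm \<alpha> + 1) * (s$j * v$j)" by (intro mult_right_mono) auto
    then show ?thesis using uv(3)[of j] by linarith
  qed
  then show "z \<in> nt_cone s (vec (norm \<alpha> + 1)) x" using uv by (auto simp: nt_cone_def)
qed

lemma tpt_in_nt_cone: "y \<in> octant s \<Longrightarrow> \<alpha> > 0 \<Longrightarrow> tpt x y \<in> nt_cone s (vec \<alpha>) x"
  by (force simp: nt_cone_def octant_def)

lemma scaled_sign_vector_in_octant:
  "s \<in> sign_vectors \<Longrightarrow> t > 0 \<Longrightarrow> t *\<^sub>R s \<in> octant s"
  by (auto simp: octant_def sign_vectors_def) (metis minus_mult_minus mult_1 mult_minus_left zero_less_mult_iff mult_1_right)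

text \<open>A concrete sequence inside every cone over x: it transports cone bounds to boundary
  values and reduces boundary functions to countable limits.\<close>

lemma filterlim_radial_approach:
  assumes "s \<in> sign_vectors" "\<alpha> > 0"
  shows "filterlim (\<lambda>k. tpt x ((1 / real (Suc k)) *\<^sub>R s)) (at (cvec x) within nt_cone s (vec \<alpha>) x) sequentially"
  unfolding filterlim_at
proof
  have "(\<lambda>k. tpt x ((1 / real (Suc k)) *\<^sub>R s)) \<longlonglongrightarrow> tpt x (0 *\<^sub>R s)"
    unfolding tpt_def
  proof (rule vec_tendstoI)
    fix j
    have "(\<lambda>k. Complex (x$j) (1 / real (Suc k) * s$j)) \<longlonglongrightarrow> Complex (x$j) (0 * s$j)"
      using LIMSEQ_inverse_real_of_nat by (intro tendsto_intros) (simp add: inverse_eq_divide)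
    then show "(\<lambda>k. (\<chi> j. Complex (x$j) (((1 / real (Suc k)) *\<^sub>R s)$j)) $ j)
        \<longlonglongrightarrow> (\<chi> j. Complex (x$j) ((0 *\<^sub>R s)$j)) $ j" by simp
  qed
  moreover have "tpt x (0 *\<^sub>R s) = cvec x" by (simp add: tpt_def cvec_def vec_eq_iff complex_eq_iff)
  ultimately show "(\<lambda>k. tpt x ((1 / real (Suc k)) *\<^sub>R s)) \<longlonglongrightarrow> cvec x" by simp
  have "tpt x ((1 / real (Suc k)) *\<^sub>R s) \<noteq> cvec x" for k
  proof
    assume *: "tpt x ((1 / real (Suc k)) *\<^sub>R s) = cvec x"
    \<comment> \<open>Any coordinate will do; \<open>undefined\<close> names an arbitrary
      index.\<close>
    have "Im (tpt x ((1 / real (Suc k)) *\<^sub>R s) $ undefined) = 0"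
      unfolding * by (simp add: cvec_def)
    then have "s$undefined = 0" by (simp add: tpt_def)
    then show False using assms(1) by (auto simp: sign_vectors_def dest: spec[of _ undefined])
  qed
  moreover have "tpt x ((1 / real (Suc k)) *\<^sub>R s) \<in> nt_cone s (vec \<alpha>) x" for k
    using assms by (intro tpt_in_nt_cone scaled_sign_vector_in_octant) auto
  ultimately show "\<forall>\<^sub>F k in sequentially. tpt x ((1 / real (Suc k)) *\<^sub>R s) \<in> nt_cone s (vec \<alpha>) x \<and>
      tpt x ((1 / real (Suc k)) *\<^sub>R s) \<noteq> cvec x"
    by (intro always_eventually allI conjI)
qed

text \<open>The version for honest quotients. \<open>N\<close> is a parameter, so that the null sets
  of a whole sequence can be excluded together, and the bound at real points is listed separately
  because \<open>cvec x\<close> lies in no cone.\<close>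

definition rationally_controlled ::
    "(real \<Rightarrow> real) \<Rightarrow> (real^'n \<Rightarrow> complex^'n \<Rightarrow> complex) \<Rightarrow> (real^'n \<Rightarrow> real) \<Rightarrow> (real^'n) set \<Rightarrow> bool" where
  "rationally_controlled C R G N \<longleftrightarrow> G \<in> borel_measurable borel \<and> (\<forall>x. 0 \<le> G x) \<and> negligible N \<and>
     (\<forall>s\<in>sign_vectors. rational_on (tube (octant s) \<union> cvec ` (- N)) (R s) \<and>
        (\<forall>x. x \<notin> N \<longrightarrow> norm (R s (cvec x)) \<le> C 1 * G x \<and>
           (\<forall>\<alpha> z. \<alpha> > 0 \<longrightarrow> z \<in> nt_cone s (vec \<alpha>) x \<longrightarrow> norm (R s z) \<le> C \<alpha> * G x)))"

text \<open>Passing to a true quotient leaves the values on the tube and at real points off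
  \<open>N\<close> unchanged, so all bounds survive. Being continuous at those real points, it
  inherits the aperture-1 bound along the radial approach.\<close>

lemma controlled_imp_rationally_controlled:
  fixes R :: "real^'n \<Rightarrow> complex^'n \<Rightarrow> complex"
  assumes "controlled C R G"
  obtains R' N where "rationally_controlled C R' G N"
    "AE x in lebesgue. boundary_sum R' x = boundary_sum R x"
proof -
  obtain N where N: "negligible N" "\<And>s. s \<in> sign_vectors \<Longrightarrow>
        agrees_with_rational_on (tube (octant s) \<union> cvec ` (- N)) (R s)"
     "\<And>s x \<alpha> z. s \<in> sign_vectors \<Longrightarrow> x \<notin> N \<Longrightarrow> \<alpha> > 0 \<Longrightarrow> z \<in> nt_cone s (vec \<alpha>) x \<Longrightarrow> norm (R s z) \<le> C \<alpha> * G x"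
    using assms(1) unfolding controlled_def by blast
  have "\<forall>s. \<exists>R'. s \<in> sign_vectors \<longrightarrow> rational_on (tube (octant s) \<union> cvec ` (- N)) R' \<and>
      (\<forall>z\<in>tube (octant s) \<union> cvec ` (- N). R' z = R s z)"
    by (meson N(2) agrees_with_rational_onE)
  then obtain R' where R': "\<And>s. s \<in> sign_vectors \<Longrightarrow> rational_on (tube (octant s) \<union> cvec ` (- N)) (R' s)"
     "\<And>s z. s \<in> sign_vectors \<Longrightarrow> z \<in> tube (octant s) \<union> cvec ` (- N) \<Longrightarrow> R' s z = R s z"
    by metis
  have cone: "norm (R' s z) \<le> C \<alpha> * G x"
    if "s \<in> sign_vectors" "x \<notin> N" "\<alpha> > 0" "z \<in> nt_cone s (vec \<alpha>) x" for s x \<alpha> z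
    using N(3)[OF that] R'(2)[OF that(1), of z] that nt_cone_subset_tube by fastforce
  have bdry: "norm (R' s (cvec x)) \<le> C 1 * G x" if s: "s \<in> sign_vectors" and x: "x \<notin> N" for s x
  proof -
    have "continuous (at (cvec x)) (R' s)"
      by (rule holomorphic_n_continuous_at[OF rational_on_holomorphic_n[OF R'(1)[OF s]]]) (use x in auto)
    then have "(R' s \<longlongrightarrow> R' s (cvec x)) (at (cvec x) within nt_cone s (vec 1) x)"
      by (meson continuous_at_imp_continuous_at_within continuous_within)
    from filterlim_compose[OF this filterlim_radial_approach[OF s]]
    have "(\<lambda>k. R' s (tpt x ((1 / real (Suc k)) *\<^sub>R s))) \<longlonglongrightarrow> R' s (cvec x)" by simp
    then have "(\<lambda>k. norm (R' s (tpt x ((1 / real (Suc k)) *\<^sub>R s)))) \<longlonglongrightarrow> norm (R' s (cvec x))"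
      by (rule tendsto_norm)
    moreover have "norm (R' s (tpt x ((1 / real (Suc k)) *\<^sub>R s))) \<le> C 1 * G x" for k
      by (intro cone[OF s x] tpt_in_nt_cone scaled_sign_vector_in_octant s) auto
    ultimately show ?thesis by (blast intro: LIMSEQ_le_const2)
  qed
  show ?thesis
  proof
    show "rationally_controlled C R' G N"
      unfolding rationally_controlled_def
      using assms N(1) R'(1) cone bdry by (auto simp: controlled_def)
    show "AE x in lebesgue. boundary_sum R' x = boundary_sum R x"
      using AE_notin_negligible[OF N(1)]
    proof eventually_elim
      case (elim x)
      then show ?case unfolding boundary_sum_def by (intro sum.cong refl R'(2)) auto
    qed
  qed
qed

lemma boundary_sum_borel:
  assumes "rationally_controlled C R G N"
  shows "boundary_sum R \<in> borel_measurable lebesgue"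
  unfolding boundary_sum_def[abs_def]
  using assms by (intro borel_measurable_lebesgueI borel_measurable_sum rational_on_borel_measurable)
     (auto simp: rationally_controlled_def)

text \<open>The half-approximation is applied to the remainder again and again. The remainders halve
  each time, so the integrals of the maximal functions decay geometrically.\<close>

lemma iterated_approximation:
  fixes f :: "real^'n \<Rightarrow> complex"
  assumes p: "0 < p" "p < 1" and A: "A > 0"
    and half: "\<And>f :: real^'n \<Rightarrow> complex. f \<in> Lp p \<Longrightarrow> \<exists>R G. controlled C R G \<and>
       Lp_pnorm p (\<lambda>x. f x - boundary_sum R x) \<le> ennreal (1/2) * Lp_pnorm p f \<and>
       (\<integral>\<^sup>+x. ennreal (G x powr p) \<partial>lebesgue) \<le> ennreal A * Lp_pnorm p f"
    and f: "f \<in> Lp p"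
  obtains R G N where "\<And>k::nat. rationally_controlled C (R k) (G k) (N k)"
    "\<And>k. (\<integral>\<^sup>+x. ennreal (G k x powr p) \<partial>lebesgue) \<le> ennreal (A * (1/2) ^ k) * Lp_pnorm p f"
    "\<And>m. Lp_pnorm p (\<lambda>x. f x - (\<Sum>k<m. boundary_sum (R k) x)) \<le> ennreal ((1/2) ^ m) * Lp_pnorm p f"
proof -
  define Q where "Q g R G N \<longleftrightarrow> rationally_controlled C R G N \<and>
       Lp_pnorm p (\<lambda>x. g x - boundary_sum R x) \<le> ennreal (1/2) * Lp_pnorm p g \<and>
       (\<integral>\<^sup>+x. ennreal (G x powr p) \<partial>lebesgue) \<le> ennreal A * Lp_pnorm p g"
    for g :: "real^'n \<Rightarrow> complex" and R G N
  have "\<forall>g\<in>Lp p. \<exists>R G N. Q g R G N"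
  proof
    fix g :: "real^'n \<Rightarrow> complex" assume g: "g \<in> Lp p"
    obtain R G where RG: "controlled C R G"
       "Lp_pnorm p (\<lambda>x. g x - boundary_sum R x) \<le> ennreal (1/2) * Lp_pnorm p g"
       "(\<integral>\<^sup>+x. ennreal (G x powr p) \<partial>lebesgue) \<le> ennreal A * Lp_pnorm p g"
      using half[OF g] by blast
    obtain R' N where R': "rationally_controlled C R' G N"
      "AE x in lebesgue. boundary_sum R' x = boundary_sum R x"
      by (rule controlled_imp_rationally_controlled[OF RG(1)])
    have "Lp_pnorm p (\<lambda>x. g x - boundary_sum R' x) = Lp_pnorm p (\<lambda>x. g x - boundary_sum R x)"
      by (rule Lp_pnorm_cong_AE) (use R'(2) in auto)
    then have "Q g R' G N" unfolding Q_def using R'(1) RG(2,3) by metis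
    then show "\<exists>R G N. Q g R G N" by blast
  qed
  then obtain RR GG NN where "\<And>g. g \<in> Lp p \<Longrightarrow> Q g (RR g) (GG g) (NN g)" by metis
  then have *: "\<And>g :: real^'n \<Rightarrow> complex. g \<in> Lp p \<Longrightarrow> rationally_controlled C (RR g) (GG g) (NN g) \<and>
       Lp_pnorm p (\<lambda>x. g x - boundary_sum (RR g) x) \<le> ennreal (1/2) * Lp_pnorm p g \<and>
       (\<integral>\<^sup>+x. ennreal (GG g x powr p) \<partial>lebesgue) \<le> ennreal A * Lp_pnorm p g"
    unfolding Q_def by blast
  \<comment> \<open>\<open>F k\<close> is the remainder after k steps, a function of f alone once
    \<open>RR\<close> has been chosen.\<close>
  define F where "F k = ((\<lambda>g x. g x - boundary_sum (RR g) x) ^^ k) f" for k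
  have F0: "F 0 = f" and FS: "F (Suc k) = (\<lambda>x. F k x - boundary_sum (RR (F k)) x)" for k
    by (simp_all add: F_def)
  have FL: "F k \<in> Lp p \<and> Lp_pnorm p (F k) \<le> ennreal ((1/2) ^ k) * Lp_pnorm p f" for k
  proof (induction k)
    case 0
    then show ?case using f by (simp add: F0)
  next
    case (Suc k)
    note k = *[OF conjunct1[OF Suc]]
    have "Lp_pnorm p (F (Suc k)) \<le> ennreal (1/2) * Lp_pnorm p (F k)" unfolding FS using k by blast
    also have "\<dots> \<le> ennreal (1/2) * (ennreal ((1/2) ^ k) * Lp_pnorm p f)"
      using Suc by (intro mult_left_mono) auto
    also have "\<dots> = ennreal ((1/2) ^ Suc k) * Lp_pnorm p f"
      unfolding power_Suc by (subst ennreal_mult) (auto simp: mult.assoc)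
    finally have le: "Lp_pnorm p (F (Suc k)) \<le> ennreal ((1/2) ^ Suc k) * Lp_pnorm p f" .
    have "Lp_pnorm p f < \<infinity>" using f by (simp add: Lp_def)
    then have "Lp_pnorm p (F (Suc k)) < \<infinity>"
      using le by (metis ennreal_less_top ennreal_mult_less_top infinity_ennreal_def le_less_trans)
    moreover have "F (Suc k) \<in> borel_measurable lebesgue"
      unfolding FS using Suc boundary_sum_borel[OF conjunct1[OF k]]
      by (intro borel_measurable_diff) (auto simp: Lp_def)
    ultimately show ?case using le by (simp add: Lp_def)
  qed
  show ?thesis
  proof (rule that[of "\<lambda>k. RR (F k)" "\<lambda>k. GG (F k)" "\<lambda>k. NN (F k)"])
    fix k
    note k = *[OF conjunct1[OF FL[of k]]]
    show "rationally_controlled C (RR (F k)) (GG (F k)) (NN (F k))" using k by blast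
    have "(\<integral>\<^sup>+x. ennreal (GG (F k) x powr p) \<partial>lebesgue) \<le> ennreal A * Lp_pnorm p (F k)" using k by blast
    also have "\<dots> \<le> ennreal A * (ennreal ((1/2) ^ k) * Lp_pnorm p f)"
      using FL[of k] by (intro mult_left_mono) auto
    also have "\<dots> = ennreal (A * (1/2) ^ k) * Lp_pnorm p f"
      using A by (subst ennreal_mult) (auto simp: mult.assoc)
    finally show "(\<integral>\<^sup>+x. ennreal (GG (F k) x powr p) \<partial>lebesgue) \<le> ennreal (A * (1/2) ^ k) * Lp_pnorm p f" .
  next
    fix m
    have "F m x = f x - (\<Sum>k<m. boundary_sum (RR (F k)) x)" for x
      by (induction m) (simp_all add: F0 FS algebra_simps)
    then have "F m = (\<lambda>x. f x - (\<Sum>k<m. boundary_sum (RR (F k)) x))" by auto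
    then show "Lp_pnorm p (\<lambda>x. f x - (\<Sum>k<m. boundary_sum (RR (F k)) x)) \<le> ennreal ((1/2) ^ m) * Lp_pnorm p f"
      using FL[of m] by simp
  qed
qed

section \<open>Series of p-th powers, points of full measure and boundary functions\<close>

lemma powr_suminf_le:
  fixes a :: "nat \<Rightarrow> real"
  assumes p: "0 < p" "p \<le> 1" and a: "\<And>k. 0 \<le> a k" "summable a"
  shows "ennreal ((\<Sum>k. a k) powr p) \<le> (\<Sum>k. ennreal (a k powr p))"
proof (rule LIMSEQ_le_const2)
  have "(\<lambda>n. (\<Sum>k<n. a k) powr p) \<longlonglongrightarrow> (\<Sum>k. a k) powr p"
    using p a by (intro tendsto_powr' summable_LIMSEQ tendsto_const) (auto intro!: always_eventually sum_nonneg)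
  then show "(\<lambda>n. ennreal ((\<Sum>k<n. a k) powr p)) \<longlonglongrightarrow> ennreal ((\<Sum>k. a k) powr p)"
    by (rule tendsto_ennrealI)
  have "ennreal ((\<Sum>k<n. a k) powr p) \<le> (\<Sum>k. ennreal (a k powr p))" for n
  proof -
    have "ennreal ((\<Sum>k<n. a k) powr p) \<le> ennreal (\<Sum>k<n. a k powr p)"
      using p a by (intro ennreal_leI powr_sum_le) auto
    also have "\<dots> = (\<Sum>k<n. ennreal (a k powr p))" by (rule sum_ennreal[symmetric]) auto
    also have "\<dots> \<le> (\<Sum>k. ennreal (a k powr p))" by (intro sum_le_suminf) auto
    finally show ?thesis .
  qed
  then show "\<exists>N. \<forall>n\<ge>N. ennreal ((\<Sum>k<n. a k) powr p) \<le> (\<Sum>k. ennreal (a k powr p))" by blast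
qed

text \<open>The terms are eventually below 1, where \<open>a \<le> a powr p\<close>.\<close>

lemma summable_of_summable_powr:
  fixes a :: "nat \<Rightarrow> real"
  assumes p: "0 < p" "p \<le> 1" and a: "\<And>k. 0 \<le> a k" and s: "summable (\<lambda>k. a k powr p)"
  shows "summable a"
proof (rule summable_comparison_test_ev[OF _ s])
  have "\<forall>\<^sub>F k in sequentially. a k powr p < 1"
    using summable_LIMSEQ_zero[OF s] by (intro order_tendstoD(2)) auto
  then show "\<forall>\<^sub>F k in sequentially. norm (a k) \<le> a k powr p"
  proof eventually_elim
    case (elim k)
    have "a k \<le> 1"
    proof (rule ccontr)
      assume "\<not> a k \<le> 1"
      then have "1 \<le> a k powr p" using p by (intro ge_one_powr_ge_zero) auto
      then show False using elim by simp
    qed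
    then show ?case using powr_mono'[of p 1 "a k"] p a[of k] by (cases "a k = 0") auto
  qed
qed

text \<open>A ball is not a null set. This supplies good vertices arbitrarily close to the real part
  of any point of a tube.\<close>

lemma AE_lebesgue_dense:
  fixes x0 :: "real^'n"
  assumes "AE x in lebesgue. P x" "e > 0"
  shows "\<exists>x\<in>ball x0 e. P x"
proof (rule ccontr)
  assume "\<not> (\<exists>x\<in>ball x0 e. P x)"
  then have "ball x0 e \<subseteq> {x. \<not> P x}" by auto
  moreover have "{x. \<not> P x} \<in> null_sets lebesgue"
    using assms(1) unfolding completion.AE_iff_null_sets by simp
  ultimately have "negligible (ball x0 e)"
    using negligible_subset negligible_iff_null_sets by blast
  then show False using open_not_negligible[of "ball x0 e"] assms(2) by simp
qed

text \<open>Fatou's lemma along the radial sequence: each slice has p-norm at most the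
  \<open>H\<^sup>p\<close> norm. Measurability of h follows because it is almost everywhere a limit
  of continuous functions.\<close>

lemma Hp_boundary_subset_Lp:
  fixes s :: "real^'n"
  assumes p: "0 < p" and s: "s \<in> sign_vectors"
  shows "Hp_boundary p s \<subseteq> Lp p"
proof
  fix h assume "h \<in> Hp_boundary p s"
  then obtain F where F: "F \<in> Hp p (octant s)" and lim: "AE x in lebesgue. nt_limit F s x (h x)"
    by (auto simp: Hp_boundary_def)
  define y where "y k = (1 / real (Suc k)) *\<^sub>R s" for k
  have y: "y k \<in> octant s" for k unfolding y_def using s by (intro scaled_sign_vector_in_octant) auto
  have conv: "AE x in lebesgue. (\<lambda>k. F (tpt x (y k))) \<longlonglongrightarrow> h x"
    using lim
  proof eventually_elim
    case (elim x)
    then have "(F \<longlongrightarrow> h x) (at (cvec x) within nt_cone s (vec 1) x)" by (simp add: nt_limit_def)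
    from filterlim_compose[OF this filterlim_radial_approach[OF s]] show ?case by (simp add: y_def)
  qed
  have Fm: "(\<lambda>x. F (tpt x (y k))) \<in> borel_measurable lebesgue" for k
  proof (intro borel_measurable_lebesgueI borel_measurable_continuous_onI continuous_at_imp_continuous_on ballI)
    fix x :: "real^'n"
    have tx: "tpt x (y k) \<in> tube (octant s)" using y[of k] by (simp add: tube_def tpt_def)
    have "continuous (at (tpt x (y k))) F"
      by (rule holomorphic_n_continuous_at[OF _ tx]) (use F in \<open>simp add: Hp_def\<close>)
    moreover have "continuous_on UNIV (\<lambda>x. tpt x (y k))"
      unfolding tpt_def Complex_eq by (intro continuous_intros)
    then have "continuous (at x) (\<lambda>x. tpt x (y k))"
      by (simp add: continuous_on_eq_continuous_at)
    ultimately show "continuous (at x) (\<lambda>x. F (tpt x (y k)))" by (rule continuous_at_compose[unfolded o_def, rotated])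
  qed
  note [measurable] = Fm
  have hm: "h \<in> borel_measurable lebesgue"
  proof (rule borel_measurable_AE)
    show "(\<lambda>x. lim (\<lambda>k. F (tpt x (y k)))) \<in> borel_measurable lebesgue"
      by (rule borel_measurable_lim_metric) (rule Fm)
    show "AE x in lebesgue. lim (\<lambda>k. F (tpt x (y k))) = h x"
      using conv by eventually_elim (rule limI)
  qed
  have "Lp_pnorm p h = (\<integral>\<^sup>+x. liminf (\<lambda>k. ennreal (norm (F (tpt x (y k))) powr p)) \<partial>lebesgue)"
    unfolding Lp_pnorm_def
  proof (rule nn_integral_cong_AE)
    show "AE x in lebesgue. ennreal (norm (h x) powr p) = liminf (\<lambda>k. ennreal (norm (F (tpt x (y k))) powr p))"
      using conv
    proof eventually_elim
      case (elim x)
      then have "(\<lambda>k. ennreal (norm (F (tpt x (y k))) powr p)) \<longlonglongrightarrow> ennreal (norm (h x) powr p)"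
        using p by (intro tendsto_ennrealI tendsto_powr' tendsto_norm tendsto_const) auto
      then show ?case by (rule lim_imp_Liminf[OF trivial_limit_sequentially, symmetric])
    qed
  qed
  also have "\<dots> \<le> liminf (\<lambda>k. \<integral>\<^sup>+x. ennreal (norm (F (tpt x (y k))) powr p) \<partial>lebesgue)"
    by (rule nn_integral_liminf) simp
  also have "\<dots> \<le> liminf (\<lambda>k::nat. Hp_pnorm p (octant s) F)"
    unfolding Hp_pnorm_def by (intro Liminf_mono always_eventually allI SUP_upper y)
  also have "\<dots> = Hp_pnorm p (octant s) F" by (simp add: Liminf_const)
  also have "\<dots> < \<infinity>" using F by (simp add: Hp_def)
  finally show "h \<in> Lp p" using hm by (simp add: Lp_def)
qed

section \<open>Summation of the approximations\<close>

text \<open>With d the distance of z0 to the walls of the tube and radius d/4, horizontal offsets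
  stay below d/2 while the heights exceed 3d/4. So one good real vertex bounds all terms of the
  series uniformly near z0.\<close>

lemma octant_neighbourhood_in_cone:
  fixes s :: "real^'n" and z0 :: "complex^'n"
  assumes s: "s \<in> sign_vectors" and z0: "z0 \<in> tube (octant s)"
  obtains r where "r > 0" "\<And>x1. x1 \<in> ball (\<chi> j. Re (z0$j)) r \<Longrightarrow> ball z0 r \<subseteq> nt_cone s (vec 1) x1"
proof -
  define d where "d = Min (range (\<lambda>j. s$j * Im (z0$j)))"
  have d: "d > 0" "\<And>j. d \<le> s$j * Im (z0$j)"
    using z0 by (auto simp: d_def tube_def octant_def)
  show ?thesis
  proof (rule that[of "d/4"])
    show "d/4 > 0" using d by simp
    fix x1 assume x1: "x1 \<in> ball (\<chi> j. Re (z0$j)) (d/4)"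
    show "ball z0 (d/4) \<subseteq> nt_cone s (vec 1) x1"
    proof
      fix z assume z: "z \<in> ball z0 (d/4)"
      have b: "\<bar>Re (z$j) - x1$j\<bar> < s$j * Im (z$j)" for j
      proof -
        have "norm (z0$j - z$j) < d/4"
          using z Finite_Cartesian_Product.norm_nth_le[of "z0 - z" j] by (simp add: dist_norm)
        then have 1: "\<bar>Re (z0$j) - Re (z$j)\<bar> < d/4" "\<bar>Im (z0$j) - Im (z$j)\<bar> < d/4"
          using abs_Re_le_cmod[of "z0$j - z$j"] abs_Im_le_cmod[of "z0$j - z$j"] by auto
        have "norm ((\<chi> j. Re (z0$j)) - x1) < d/4" using x1 by (simp add: dist_norm)
        then have 2: "\<bar>Re (z0$j) - x1$j\<bar> < d/4"
          using component_le_norm_cart[of "(\<chi> j. Re (z0$j)) - x1" j] by simp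
        have "s$j = 1 \<or> s$j = -1" using s by (simp add: sign_vectors_def)
        then show ?thesis
        proof
          assume sj: "s$j = 1"
          then have "s$j * Im (z$j) = Im (z$j)" "s$j * Im (z0$j) = Im (z0$j)" by simp_all
          then show ?thesis using 1 2 d(2)[of j] by linarith
        next
          assume sj: "s$j = -1"
          then have "s$j * Im (z$j) = - Im (z$j)" "s$j * Im (z0$j) = - Im (z0$j)" by simp_all
          then show ?thesis using 1 2 d(2)[of j] by linarith
        qed
      qed
      then have "s$j * Im (z$j) > 0" for j using b[of j] by linarith
      then show "z \<in> nt_cone s (vec 1) x1"
        unfolding nt_cone_def
        using b by (intro CollectI exI[of _ "\<chi> j. Re (z$j)"] exI[of _ "\<chi> j. Im (z$j)"])
           (simp add: tpt_Re_Im octant_def)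
    qed
  qed
qed

text \<open>In \<open>K\<close>, the factor \<open>C 1 powr p\<close> is the cost of passing from
  \<open>G\<close> to the kernels, and \<open>2 * A\<close> is the sum of the geometric series of
  the \<open>A * (1/2) ^ k\<close>. Aperture 1 suffices for all norms, since x + iy lies in the
  aperture-1 cone over x; larger apertures serve the non-tangential limits.\<close>

lemma rational_decomposition:
  fixes f :: "real^'n \<Rightarrow> complex"
    and R :: "nat \<Rightarrow> real^'n \<Rightarrow> complex^'n \<Rightarrow> complex"
  assumes p: "0 < p" "p < 1" and C1: "C 1 > 0" and A: "A > 0"
    and f: "f \<in> Lp p"
    and ctl: "\<And>k. rationally_controlled C (R k) (G k) (N k)"
    and Gp: "\<And>k. (\<integral>\<^sup>+x. ennreal (G k x powr p) \<partial>lebesgue) \<le> ennreal (A * (1/2) ^ k) * Lp_pnorm p f"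
    and err: "\<And>m. Lp_pnorm p (\<lambda>x. f x - (\<Sum>k<m. boundary_sum (R k) x)) \<le> ennreal ((1/2) ^ m) * Lp_pnorm p f"
    and K: "K = C 1 powr p * (2 * A)"
  defines "F \<equiv> \<lambda>s z. \<Sum>k. R k s z" and "g \<equiv> \<lambda>s x. \<Sum>k. R k s (cvec x)"
  shows "\<And>k s. s \<in> sign_vectors \<Longrightarrow> rational_on (tube (octant s)) (R k s)"
    and "\<And>k s. s \<in> sign_vectors \<Longrightarrow> R k s \<in> Hp p (octant s)"
    and "\<And>s. s \<in> sign_vectors \<Longrightarrow> F s \<in> Hp p (octant s)"
    and "(\<Sum>k. \<Sum>s\<in>sign_vectors. Hp_pnorm p (octant s) (R k s))
       \<le> ennreal (real (card (sign_vectors :: (real^'n) set)) * K) * Lp_pnorm p f"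
    and "(\<lambda>m. Lp_pnorm p (\<lambda>x. f x - (\<Sum>k<m. \<Sum>s\<in>sign_vectors. R k s (cvec x)))) \<longlonglongrightarrow> 0"
    and "\<And>s. s \<in> sign_vectors \<Longrightarrow> (\<lambda>m. Hp_pnorm p (octant s) (\<lambda>z. F s z - (\<Sum>k<m. R k s z))) \<longlonglongrightarrow> 0"
    and "\<And>s. s \<in> sign_vectors \<Longrightarrow> AE x in lebesgue. nt_limit (F s) s x (g s x)"
    and "AE x in lebesgue. f x = (\<Sum>s\<in>sign_vectors. g s x)"
    and "Lp_pnorm p f \<le> (\<Sum>s\<in>sign_vectors. Lp_pnorm p (g s))"
    and "(\<Sum>s\<in>sign_vectors. Lp_pnorm p (g s))
       \<le> ennreal (real (card (sign_vectors :: (real^'n) set)) * K) * Lp_pnorm p f"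
proof -
  have p1: "p \<le> 1" using p by simp
  have fm[measurable]: "f \<in> borel_measurable lebesgue" and fin: "Lp_pnorm p f < \<infinity>"
    using f by (auto simp: Lp_def)
  have G0: "0 \<le> G k x" and Gm[measurable]: "G k \<in> borel_measurable lebesgue"
    and Nn: "negligible (N k)" for k x
    using ctl[of k] by (auto simp: rationally_controlled_def intro: borel_measurable_lebesgueI)
  have rat: "rational_on (tube (octant s) \<union> cvec ` (- N k)) (R k s)" if "s \<in> sign_vectors" for k s
    using ctl[of k] that by (auto simp: rationally_controlled_def)
  have bdry: "norm (R k s (cvec x)) \<le> C 1 * G k x" if "s \<in> sign_vectors" "x \<notin> N k" for k s x
    using ctl[of k] that by (auto simp: rationally_controlled_def)
  have cone: "norm (R k s z) \<le> C \<alpha> * G k x"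
    if "s \<in> sign_vectors" "x \<notin> N k" "\<alpha> > 0" "z \<in> nt_cone s (vec \<alpha>) x" for k s x \<alpha> z
    using ctl[of k] that by (auto simp: rationally_controlled_def)
  show ratt: "rational_on (tube (octant s)) (R k s)" if "s \<in> sign_vectors" for k s
    using rat[OF that] by (rule rational_on_mono) auto
  have Rm: "(\<lambda>x. R k s (cvec x)) \<in> borel_measurable lebesgue" if "s \<in> sign_vectors" for k s
    by (intro borel_measurable_lebesgueI rational_on_borel_measurable[OF ratt[OF that]])

  have em: "ennreal a * (ennreal b * L) = ennreal (a * b) * L" if "a \<ge> 0" "b \<ge> 0" for a b and L :: ennreal
    using that by (simp add: ennreal_mult mult.assoc)
  have geo: "(\<Sum>k. ennreal (c * (1/2) ^ (k + m)) * L) = ennreal (c * 2 * (1/2) ^ m) * L"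
    if "c \<ge> 0" for c m and L :: ennreal
  proof -
    have "(\<lambda>k. (1/2::real) ^ k) sums 2" using geometric_sums[of "1/2::real"] by simp
    then have "(\<lambda>k. (c * (1/2) ^ m) * (1/2) ^ k) sums ((c * (1/2) ^ m) * 2)" by (rule sums_mult)
    then have "(\<lambda>k. c * (1/2) ^ (k + m)) sums (c * 2 * (1/2) ^ m)" by (simp add: power_add mult_ac)
    then have "(\<Sum>k. ennreal (c * (1/2) ^ (k + m))) = ennreal (c * 2 * (1/2) ^ m)"
      using that by (intro suminf_ennreal_eq) auto
    then show ?thesis by (simp add: ennreal_suminf_multc)
  qed
  have Gsum: "(\<Sum>k. \<integral>\<^sup>+x. ennreal (G (k + m) x powr p) \<partial>lebesgue) \<le> ennreal (A * 2 * (1/2) ^ m) * Lp_pnorm p f" for m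
    unfolding geo[OF less_imp_le[OF A], symmetric] by (intro suminf_le Gp) auto
  have Gfin: "(\<Sum>k. \<integral>\<^sup>+x. ennreal (G k x powr p) \<partial>lebesgue) < \<infinity>"
    using Gsum[of 0] fin by (simp add: ennreal_mult_less_top le_less_trans)

  \<comment> \<open>The good points: off all poles and with convergent maximal series. Almost every
    point is good, because the p-th powers of the \<open>G k\<close> have a finite total
    integral.\<close>
  define P where "P x \<longleftrightarrow> (\<forall>k. x \<notin> N k) \<and> summable (\<lambda>k. G k x)" for x
  have AEP: "AE x in lebesgue. P x"
  proof -
    have "(\<integral>\<^sup>+x. (\<Sum>k. ennreal (G k x powr p)) \<partial>lebesgue) \<noteq> \<infinity>"
      using Gfin by (subst nn_integral_suminf) auto
    then have "AE x in lebesgue. (\<Sum>k. ennreal (G k x powr p)) \<noteq> \<infinity>"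
      by (intro nn_integral_noteq_infinite) auto
    moreover have "AE x in lebesgue. \<forall>k. x \<notin> N k"
      unfolding AE_all_countable using Nn AE_notin_negligible by blast
    ultimately show ?thesis
    proof eventually_elim
      case (elim x)
      have "(\<Sum>k. ennreal (G k x powr p)) \<noteq> top" using elim(1) by (simp only: infinity_ennreal_def not_False_eq_True)
      then have "summable (\<lambda>k. G k x powr p)" by (intro summable_suminf_not_top powr_ge_zero)
      then have "summable (\<lambda>k. G k x)" by (rule summable_of_summable_powr[OF p(1) p1 G0])
      then show ?case using elim by (simp add: P_def)
    qed
  qed

  \<comment> \<open>The remainder of the series is bounded on the whole cone over a good point by
    the tail of the maximal series there. This drives the \<open>H\<^sup>p\<close> bounds and
    convergence.\<close>
  have coneT: "norm (F s z - (\<Sum>k<m. R k s z)) \<le> C \<alpha> * (\<Sum>k. G (k + m) x)"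
    if s: "s \<in> sign_vectors" and x: "P x" and z: "\<alpha> > 0" "z \<in> nt_cone s (vec \<alpha>) x" for s x z \<alpha> m
  proof -
    have b: "norm (R k s z) \<le> C \<alpha> * G k x" for k using cone[OF s _ z] x by (simp add: P_def)
    have sG: "summable (\<lambda>k. G k x)" using x by (simp add: P_def)
    then have sC: "summable (\<lambda>k. C \<alpha> * G k x)" by (rule summable_mult)
    have 2: "summable (\<lambda>k. R k s z)"
      by (rule summable_comparison_test'[OF sC]) (use b in auto)
    have sG': "summable (\<lambda>k. G (k + m) x)" using sG by (rule summable_ignore_initial_segment)
    have "F s z - (\<Sum>k<m. R k s z) = (\<Sum>k. R (k + m) s z)"
      unfolding F_def by (rule suminf_minus_initial_segment[OF 2, symmetric])
    also have "norm \<dots> \<le> (\<Sum>k. C \<alpha> * G (k + m) x)"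
      by (rule norm_suminf_le[OF b summable_mult[OF sG']])
    also have "\<dots> = C \<alpha> * (\<Sum>k. G (k + m) x)" by (rule suminf_mult[OF sG'])
    finally show "norm (F s z - (\<Sum>k<m. R k s z)) \<le> C \<alpha> * (\<Sum>k. G (k + m) x)" .
  qed

  \<comment> \<open>Subadditivity of the p-th power under infinite sums turns the integral of the
    tail into a geometric tail.\<close>
  have tail: "(\<integral>\<^sup>+x. ennreal ((C 1 * (\<Sum>k. G (k + m) x)) powr p) * indicator {x. P x} x \<partial>lebesgue)
      \<le> ennreal (K * (1/2) ^ m) * Lp_pnorm p f" for m
  proof -
    have "(\<integral>\<^sup>+x. ennreal ((C 1 * (\<Sum>k. G (k + m) x)) powr p) * indicator {x. P x} x \<partial>lebesgue)
       \<le> (\<integral>\<^sup>+x. ennreal (C 1 powr p) * (\<Sum>k. ennreal (G (k + m) x powr p)) \<partial>lebesgue)"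
    proof (rule nn_integral_mono)
      fix x
      show "ennreal ((C 1 * (\<Sum>k. G (k + m) x)) powr p) * indicator {x. P x} x
         \<le> ennreal (C 1 powr p) * (\<Sum>k. ennreal (G (k + m) x powr p))"
      proof (cases "P x")
        case True
        then have "summable (\<lambda>k. G k x)" by (simp add: P_def)
        then have "summable (\<lambda>k. G (k + m) x)" by (rule summable_ignore_initial_segment)
        then have "ennreal ((\<Sum>k. G (k + m) x) powr p) \<le> (\<Sum>k. ennreal (G (k + m) x powr p))"
          using p p1 G0 by (intro powr_suminf_le) auto
        then show ?thesis using True by (simp add: powr_mult ennreal_mult mult_left_mono)
      qed simp
    qed
    also have "\<dots> = ennreal (C 1 powr p) * (\<Sum>k. \<integral>\<^sup>+x. ennreal (G (k + m) x powr p) \<partial>lebesgue)"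
      by (simp add: nn_integral_cmult nn_integral_suminf)
    also have "\<dots> \<le> ennreal (C 1 powr p) * (ennreal (A * 2 * (1/2) ^ m) * Lp_pnorm p f)"
      by (intro mult_left_mono Gsum) auto
    also have "\<dots> = ennreal (K * (1/2) ^ m) * Lp_pnorm p f"
      using A by (subst em) (auto simp: K mult_ac)
    finally show ?thesis .
  qed
  have tail_le: "(\<integral>\<^sup>+x. ennreal (norm (u x) powr p) \<partial>lebesgue) \<le> ennreal (K * (1/2) ^ m) * Lp_pnorm p f"
    if u: "\<And>x. P x \<Longrightarrow> norm (u x) \<le> C 1 * (\<Sum>k. G (k + m) x)" for u :: "real^'n \<Rightarrow> complex" and m
  proof -
    have "(\<integral>\<^sup>+x. ennreal (norm (u x) powr p) \<partial>lebesgue)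
       \<le> (\<integral>\<^sup>+x. ennreal ((C 1 * (\<Sum>k. G (k + m) x)) powr p) * indicator {x. P x} x \<partial>lebesgue)"
    proof (rule nn_integral_mono_AE)
      show "AE x in lebesgue. ennreal (norm (u x) powr p)
          \<le> ennreal ((C 1 * (\<Sum>k. G (k + m) x)) powr p) * indicator {x. P x} x"
        using AEP
      proof eventually_elim
        case (elim x)
        then show ?case using u[OF elim] p by (auto intro!: ennreal_leI powr_mono2)
      qed
    qed
    then show ?thesis using tail order_trans by blast
  qed
  have K0: "K > 0" using C1 A by (simp add: K)
  have FHp: "Hp_pnorm p (octant s) (\<lambda>z. F s z - (\<Sum>k<m. R k s z)) \<le> ennreal (K * (1/2) ^ m) * Lp_pnorm p f"
    if s: "s \<in> sign_vectors" for s m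
    unfolding Hp_pnorm_def
  proof (rule SUP_least)
    fix y assume y: "y \<in> octant s"
    show "(\<integral>\<^sup>+x. ennreal (norm (F s (tpt x y) - (\<Sum>k<m. R k s (tpt x y))) powr p) \<partial>lebesgue)
        \<le> ennreal (K * (1/2) ^ m) * Lp_pnorm p f"
      by (rule tail_le) (use coneT[OF s _ _ tpt_in_nt_cone[OF y]] in auto)
  qed
  have RHp: "Hp_pnorm p (octant s) (R k s) \<le> ennreal (C 1 powr p * A * (1/2) ^ k) * Lp_pnorm p f"
    if s: "s \<in> sign_vectors" for s k
    unfolding Hp_pnorm_def
  proof (rule SUP_least)
    fix y assume y: "y \<in> octant s"
    have "(\<integral>\<^sup>+x. ennreal (norm (R k s (tpt x y)) powr p) \<partial>lebesgue)
       \<le> (\<integral>\<^sup>+x. ennreal (C 1 powr p) * ennreal (G k x powr p) \<partial>lebesgue)"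
    proof (rule nn_integral_mono_AE)
      show "AE x in lebesgue. ennreal (norm (R k s (tpt x y)) powr p)
          \<le> ennreal (C 1 powr p) * ennreal (G k x powr p)"
        using AE_notin_negligible[OF Nn[of k]]
      proof eventually_elim
        case (elim x)
        have "norm (R k s (tpt x y)) powr p \<le> (C 1 * G k x) powr p"
          using cone[OF s elim _ tpt_in_nt_cone[OF y], of 1] p by (intro powr_mono2) auto
        then show ?case by (simp add: powr_mult ennreal_leI flip: ennreal_mult)
      qed
    qed
    also have "\<dots> = ennreal (C 1 powr p) * (\<integral>\<^sup>+x. ennreal (G k x powr p) \<partial>lebesgue)"
      by (rule nn_integral_cmult) simp
    also have "\<dots> \<le> ennreal (C 1 powr p) * (ennreal (A * (1/2) ^ k) * Lp_pnorm p f)"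
      by (intro mult_left_mono Gp) auto
    also have "\<dots> = ennreal (C 1 powr p * A * (1/2) ^ k) * Lp_pnorm p f"
      using A by (subst em) (auto simp: mult_ac)
    finally show "(\<integral>\<^sup>+x. ennreal (norm (R k s (tpt x y)) powr p) \<partial>lebesgue)
        \<le> ennreal (C 1 powr p * A * (1/2) ^ k) * Lp_pnorm p f" .
  qed
  have fin': "ennreal c * Lp_pnorm p f < \<infinity>" for c using fin by (simp add: ennreal_mult_less_top)
  show "R k s \<in> Hp p (octant s)" if s: "s \<in> sign_vectors" for k s
    using rational_on_holomorphic_n[OF ratt[OF s]] le_less_trans[OF RHp[OF s] fin'] by (simp add: Hp_def)

  show "F s \<in> Hp p (octant s)" if s: "s \<in> sign_vectors" for s
  proof -
    have "Hp_pnorm p (octant s) (F s) < \<infinity>"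
      using le_less_trans[OF FHp[OF s, of 0] fin'] by simp
    moreover have "holomorphic_n (F s) {z0}" if z0: "z0 \<in> tube (octant s)" for z0
    proof -
      obtain r where r: "r > 0" "\<And>x1. x1 \<in> ball (\<chi> j. Re (z0$j)) r \<Longrightarrow> ball z0 r \<subseteq> nt_cone s (vec 1) x1"
        using octant_neighbourhood_in_cone[OF s z0] by blast
      \<comment> \<open>The real part of z0 may fail to be good, so a good vertex nearby is
        used.\<close>
      obtain x1 where x1: "x1 \<in> ball (\<chi> j. Re (z0$j)) r" "P x1"
        using AE_lebesgue_dense[OF AEP r(1)] by blast
      note sub = r(2)[OF x1(1)]
      show ?thesis unfolding F_def
      proof (rule holomorphic_n_suminf[OF _ r(1)])
        show "holomorphic_n (R k s) (ball z0 r)" for k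
          using rational_on_holomorphic_n[OF ratt[OF s, of k]] sub nt_cone_subset_tube
          unfolding holomorphic_n_def by blast
        show "norm (R k s w) \<le> C 1 * G k x1" if "w \<in> ball z0 r" for k w
          using cone[OF s, of x1 k 1 w] x1(2) sub that by (auto simp: P_def)
        show "summable (\<lambda>k. C 1 * G k x1)" using x1(2) by (simp add: P_def summable_mult)
      qed
    qed
    then have "holomorphic_n (F s) (tube (octant s))" by (simp add: holomorphic_n_def)
    ultimately show ?thesis by (simp add: Hp_def)
  qed

  let ?n = "real (card (sign_vectors :: (real^'n) set))"
  have "(\<Sum>k. \<Sum>s\<in>sign_vectors. Hp_pnorm p (octant s) (R k s))
     \<le> (\<Sum>k. ennreal (?n * (C 1 powr p * A) * (1/2) ^ (k + 0)) * Lp_pnorm p f)"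
  proof (intro suminf_le)
    fix k
    have "(\<Sum>s\<in>sign_vectors. Hp_pnorm p (octant s) (R k s))
       \<le> (\<Sum>s\<in>(sign_vectors :: (real^'n) set). ennreal (C 1 powr p * A * (1/2) ^ k) * Lp_pnorm p f)"
      by (intro sum_mono RHp)
    also have "\<dots> = ennreal ?n * (ennreal (C 1 powr p * A * (1/2) ^ k) * Lp_pnorm p f)"
      by (simp add: ennreal_of_nat_eq_real_of_nat)
    also have "\<dots> = ennreal (?n * (C 1 powr p * A) * (1/2) ^ (k + 0)) * Lp_pnorm p f"
      using A by (subst em) (auto simp: mult_ac)
    finally show "(\<Sum>s\<in>sign_vectors. Hp_pnorm p (octant s) (R k s))
        \<le> ennreal (?n * (C 1 powr p * A) * (1/2) ^ (k + 0)) * Lp_pnorm p f" .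
  qed auto
  also have "\<dots> = ennreal (?n * K) * Lp_pnorm p f"
    using A by (subst geo) (auto simp: K mult_ac)
  finally show "(\<Sum>k. \<Sum>s\<in>sign_vectors. Hp_pnorm p (octant s) (R k s)) \<le> ennreal (?n * K) * Lp_pnorm p f" .

  have half0: "(\<lambda>m. ennreal (c * (1/2) ^ m) * Lp_pnorm p f) \<longlonglongrightarrow> 0" if "c \<ge> 0" for c
  proof -
    define b where "b = enn2real (Lp_pnorm p f)"
    have b: "Lp_pnorm p f = ennreal b" "b \<ge> 0" using fin by (auto simp: b_def)
    have "(\<lambda>m. (c * b) * (1/2::real) ^ m) \<longlonglongrightarrow> (c * b) * 0"
      by (intro tendsto_mult tendsto_const LIMSEQ_realpow_zero) auto
    then have "(\<lambda>m. ennreal ((c * b) * (1/2::real) ^ m)) \<longlonglongrightarrow> ennreal ((c * b) * 0)"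
      by (rule tendsto_ennrealI)
    moreover have "ennreal (c * (1/2) ^ m) * Lp_pnorm p f = ennreal ((c * b) * (1/2) ^ m)" for m
      unfolding b(1) using that b(2) by (subst ennreal_mult[symmetric]) (auto simp: mult_ac)
    ultimately show ?thesis by simp
  qed
  have err0: "(\<lambda>m. Lp_pnorm p (\<lambda>x. f x - (\<Sum>k<m. boundary_sum (R k) x))) \<longlonglongrightarrow> 0"
    by (rule tendsto_sandwich[OF _ _ tendsto_const half0[of 1]]) (use err in auto)
  then show "(\<lambda>m. Lp_pnorm p (\<lambda>x. f x - (\<Sum>k<m. \<Sum>s\<in>sign_vectors. R k s (cvec x)))) \<longlonglongrightarrow> 0"
    by (simp add: boundary_sum_def)
  show "(\<lambda>m. Hp_pnorm p (octant s) (\<lambda>z. F s z - (\<Sum>k<m. R k s z))) \<longlonglongrightarrow> 0" if s: "s \<in> sign_vectors" for s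
    by (rule tendsto_sandwich[OF _ _ tendsto_const half0[OF less_imp_le[OF K0]]]) (use FHp[OF s] in auto)

  have bS: "summable (\<lambda>k. R k s (cvec x))"
    and gT: "norm (g s x) \<le> C 1 * (\<Sum>k. G (k + 0) x)"
    if s: "s \<in> sign_vectors" and x: "P x" for s x
  proof -
    have b: "norm (R k s (cvec x)) \<le> C 1 * G k x" for k using bdry[OF s] x by (simp add: P_def)
    have sG: "summable (\<lambda>k. G k x)" using x by (simp add: P_def)
    show "summable (\<lambda>k. R k s (cvec x))"
      by (rule summable_comparison_test'[OF summable_mult[OF sG, of "C 1"]]) (use b in auto)
    have "norm (g s x) \<le> (\<Sum>k. C 1 * G k x)"
      unfolding g_def by (rule norm_suminf_le[OF b summable_mult[OF sG]])
    then show "norm (g s x) \<le> C 1 * (\<Sum>k. G (k + 0) x)" using suminf_mult[OF sG, of "C 1"] by simp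
  qed
  show "AE x in lebesgue. nt_limit (F s) s x (g s x)" if s: "s \<in> sign_vectors" for s
    using AEP
  proof eventually_elim
    case (elim x)
    show ?case unfolding nt_limit_def
    proof (intro allI impI)
      fix \<alpha> :: "real^'n"
      let ?T = "nt_cone s \<alpha> x" and ?a = "norm \<alpha> + 1"
      have a: "?a > 0" using norm_ge_zero[of \<alpha>] by linarith
      \<comment> \<open>Interchange of limits: each partial sum is continuous at the real point, and
        the Weierstrass test with \<open>C ?a * G k x\<close> gives uniform convergence on the
        cone.\<close>
      show "(F s \<longlongrightarrow> g s x) (at (cvec x) within ?T)"
      proof (rule swap_uniform_limit'[where S="?T" and F=sequentially
            and f="\<lambda>n z. \<Sum>k<n. R k s z" and g="\<lambda>n. \<Sum>k<n. R k s (cvec x)"])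
        have "continuous (at (cvec x)) (R k s)" for k
          by (rule holomorphic_n_continuous_at[OF rational_on_holomorphic_n[OF rat[OF s, of k]]])
             (use elim in \<open>auto simp: P_def\<close>)
        then have "(R k s \<longlongrightarrow> R k s (cvec x)) (at (cvec x) within ?T)" for k
          by (meson continuous_at_imp_continuous_at_within continuous_within)
        then show "\<forall>\<^sub>F n in sequentially. ((\<lambda>z. \<Sum>k<n. R k s z) \<longlongrightarrow> (\<Sum>k<n. R k s (cvec x))) (at (cvec x) within ?T)"
          by (intro always_eventually allI tendsto_sum)
        show "(\<lambda>n. \<Sum>k<n. R k s (cvec x)) \<longlonglongrightarrow> g s x"
          unfolding g_def by (rule summable_LIMSEQ[OF bS[OF s elim]])
        show "uniform_limit ?T (\<lambda>n z. \<Sum>k<n. R k s z) (F s) sequentially"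
          unfolding F_def
        proof (rule Weierstrass_m_test)
          show "norm (R k s z) \<le> C ?a * G k x" if "z \<in> ?T" for k z
            using cone[OF s _ a, of x k z] elim that nt_cone_subset_uniform by (auto simp: P_def)
          show "summable (\<lambda>k. C ?a * G k x)" using elim by (simp add: P_def summable_mult)
        qed
        show "\<forall>\<^sub>F z in at (cvec x) within ?T. z \<in> ?T" by (simp add: eventually_at_filter)
      qed simp
    qed
  qed

  have gm: "g s \<in> borel_measurable lebesgue" if s: "s \<in> sign_vectors" for s
    unfolding g_def suminf_eq_lim by (intro borel_measurable_lim_metric borel_measurable_sum Rm s)
  let ?g = "\<lambda>x. \<Sum>s\<in>sign_vectors. g s x"
  have gsm[measurable]: "?g \<in> borel_measurable lebesgue" by (intro borel_measurable_sum gm)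
  have bsm[measurable]: "boundary_sum (R k) \<in> borel_measurable lebesgue" for k
    using ctl by (rule boundary_sum_borel)
  \<comment> \<open>At good points the partial sums converge to \<open>?g\<close>. By Fatou's lemma
    the distance of f to \<open>?g\<close> is at most the limit of the approximation errors, which
    is 0.\<close>
  have "Lp_pnorm p (\<lambda>x. f x - ?g x)
     = (\<integral>\<^sup>+x. liminf (\<lambda>m. ennreal (norm (f x - (\<Sum>k<m. boundary_sum (R k) x)) powr p)) \<partial>lebesgue)"
    unfolding Lp_pnorm_def
  proof (rule nn_integral_cong_AE)
    show "AE x in lebesgue. ennreal (norm (f x - ?g x) powr p)
       = liminf (\<lambda>m. ennreal (norm (f x - (\<Sum>k<m. boundary_sum (R k) x)) powr p))"
      using AEP
    proof eventually_elim
      case (elim x)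
      have "(\<lambda>m. \<Sum>s\<in>sign_vectors. \<Sum>k<m. R k s (cvec x)) \<longlonglongrightarrow> ?g x"
        unfolding g_def by (intro tendsto_sum summable_LIMSEQ bS elim)
      moreover have "(\<Sum>s\<in>sign_vectors. \<Sum>k<m. R k s (cvec x)) = (\<Sum>k<m. boundary_sum (R k) x)" for m
        unfolding boundary_sum_def by (rule sum.swap)
      ultimately have "(\<lambda>m. \<Sum>k<m. boundary_sum (R k) x) \<longlonglongrightarrow> ?g x" by simp
      then have "(\<lambda>m. ennreal (norm (f x - (\<Sum>k<m. boundary_sum (R k) x)) powr p))
          \<longlonglongrightarrow> ennreal (norm (f x - ?g x) powr p)"
        using p by (intro tendsto_ennrealI tendsto_powr' tendsto_norm tendsto_diff tendsto_const) auto
      then show ?case by (rule lim_imp_Liminf[OF trivial_limit_sequentially, symmetric])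
    qed
  qed
  also have "\<dots> \<le> liminf (\<lambda>m. Lp_pnorm p (\<lambda>x. f x - (\<Sum>k<m. boundary_sum (R k) x)))"
    unfolding Lp_pnorm_def by (rule nn_integral_liminf) simp
  also have "\<dots> = 0" by (rule lim_imp_Liminf[OF trivial_limit_sequentially err0])
  finally have "Lp_pnorm p (\<lambda>x. f x - ?g x) = 0" by simp
  then have "AE x in lebesgue. ennreal (norm (f x - ?g x) powr p) = 0"
    unfolding Lp_pnorm_def by (subst (asm) nn_integral_0_iff_AE) auto
  then show feq: "AE x in lebesgue. f x = ?g x"
    by eventually_elim simp
  have "Lp_pnorm p f = Lp_pnorm p ?g" by (rule Lp_pnorm_cong_AE[OF feq])
  also have "\<dots> \<le> (\<Sum>s\<in>sign_vectors. Lp_pnorm p (g s))"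
    by (rule Lp_pnorm_sum_le[OF p(1) p1 finite_sign_vectors gm])
  finally show "Lp_pnorm p f \<le> (\<Sum>s\<in>sign_vectors. Lp_pnorm p (g s))" .
  have "Lp_pnorm p (g s) \<le> ennreal (K * (1/2) ^ 0) * Lp_pnorm p f" if s: "s \<in> sign_vectors" for s
    unfolding Lp_pnorm_def[of p "g s"] by (rule tail_le[OF gT[OF s]])
  then have "(\<Sum>s\<in>sign_vectors. Lp_pnorm p (g s)) \<le> (\<Sum>s\<in>(sign_vectors :: (real^'n) set). ennreal K * Lp_pnorm p f)"
    by (intro sum_mono) simp
  also have "\<dots> = ennreal (?n * K) * Lp_pnorm p f"
    using K0 by (simp add: ennreal_of_nat_eq_real_of_nat ennreal_mult mult_ac)
  finally show "(\<Sum>s\<in>sign_vectors. Lp_pnorm p (g s)) \<le> ennreal (?n * K) * Lp_pnorm p f" .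
qed

theorem theorem3p1:
  fixes p :: real
  assumes "0 < p" and "p < 1"
  shows "(\<exists>A>0. \<forall>f \<in> (Lp p :: (real^'n \<Rightarrow> complex) set).
     \<exists>(R :: nat \<Rightarrow> real^'n \<Rightarrow> complex^'n \<Rightarrow> complex)
      (F :: real^'n \<Rightarrow> complex^'n \<Rightarrow> complex)
      (g :: real^'n \<Rightarrow> real^'n \<Rightarrow> complex).
       (\<forall>k. \<forall>s\<in>sign_vectors. rational_on (tube (octant s)) (R k s) \<and> R k s \<in> Hp p (octant s)) \<and>
       (\<forall>s\<in>sign_vectors. F s \<in> Hp p (octant s)) \<and>
       (\<Sum>k. \<Sum>s\<in>sign_vectors. Hp_pnorm p (octant s) (R k s)) \<le> ennreal A * Lp_pnorm p f \<and>
       ((\<lambda>m. Lp_pnorm p (\<lambda>x. f x - (\<Sum>k<m. \<Sum>s\<in>sign_vectors. R k s (cvec x)))) \<longlongrightarrow> 0) sequentially \<and>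
       (\<forall>s\<in>sign_vectors.
          ((\<lambda>m. Hp_pnorm p (octant s) (\<lambda>z. F s z - (\<Sum>k<m. R k s z))) \<longlongrightarrow> 0) sequentially) \<and>
       (\<forall>s\<in>sign_vectors. AE x in lebesgue. nt_limit (F s) s x (g s x)) \<and>
       (AE x in lebesgue. f x = (\<Sum>s\<in>sign_vectors. g s x)) \<and>
       Lp_pnorm p f \<le> (\<Sum>s\<in>sign_vectors. Lp_pnorm p (g s)) \<and>
       (\<Sum>s\<in>sign_vectors. Lp_pnorm p (g s)) \<le> ennreal A * Lp_pnorm p f)
   \<and> (Lp p :: (real^'n \<Rightarrow> complex) set) =
       {f. \<exists>h. (\<forall>s\<in>sign_vectors. h s \<in> Hp_boundary p s) \<and>
              (AE x in lebesgue. f x = (\<Sum>s\<in>sign_vectors. h s x))}"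
    (is "?A \<and> ?B")
proof -
  obtain C :: "real \<Rightarrow> real" and A where C: "\<And>\<alpha>. \<alpha> > 0 \<Longrightarrow> C \<alpha> > 0" and A: "A > 0"
    and half: "\<And>f :: real^'n \<Rightarrow> complex. f \<in> Lp p \<Longrightarrow> \<exists>R G. controlled C R G \<and>
       Lp_pnorm p (\<lambda>x. f x - boundary_sum R x) \<le> ennreal (1/2) * Lp_pnorm p f \<and>
       (\<integral>\<^sup>+x. ennreal (G x powr p) \<partial>lebesgue) \<le> ennreal A * Lp_pnorm p f"
    using half_approximation[OF assms, where 'n='n] by blast
  define K where "K = C 1 powr p * (2 * A)"
  have C1: "C 1 > 0" using C by simp
  \<comment> \<open>The number of octants. \<open>?n * K\<close> depends only on n and p, since
    \<open>C\<close> and \<open>A\<close> were obtained before any f.\<close>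
  let ?n = "real (card (sign_vectors :: (real^'n) set))"
  have "(vec 1 :: real^'n) \<in> sign_vectors" by (simp add: sign_vectors_def)
  then have "card (sign_vectors :: (real^'n) set) > 0"
    using finite_sign_vectors card_gt_0_iff by blast
  then have nK: "?n * K > 0" using C1 A by (simp add: K_def)
  have A1: ?A
  proof (intro exI[of _ "?n * K"] conjI nK ballI)
    fix f :: "real^'n \<Rightarrow> complex" assume f: "f \<in> Lp p"
    obtain R G N where RG: "\<And>k::nat. rationally_controlled C (R k) (G k) (N k)"
      "\<And>k. (\<integral>\<^sup>+x. ennreal (G k x powr p) \<partial>lebesgue) \<le> ennreal (A * (1/2) ^ k) * Lp_pnorm p f"
      "\<And>m. Lp_pnorm p (\<lambda>x. f x - (\<Sum>k<m. boundary_sum (R k) x)) \<le> ennreal ((1/2) ^ m) * Lp_pnorm p f"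
      using iterated_approximation[OF assms A half f] by blast
    note D = rational_decomposition[OF assms C1 A f RG K_def]
    show "\<exists>(R :: nat \<Rightarrow> real^'n \<Rightarrow> complex^'n \<Rightarrow> complex)
      (F :: real^'n \<Rightarrow> complex^'n \<Rightarrow> complex)
      (g :: real^'n \<Rightarrow> real^'n \<Rightarrow> complex).
       (\<forall>k. \<forall>s\<in>sign_vectors. rational_on (tube (octant s)) (R k s) \<and> R k s \<in> Hp p (octant s)) \<and>
       (\<forall>s\<in>sign_vectors. F s \<in> Hp p (octant s)) \<and>
       (\<Sum>k. \<Sum>s\<in>sign_vectors. Hp_pnorm p (octant s) (R k s)) \<le> ennreal (?n * K) * Lp_pnorm p f \<and>
       ((\<lambda>m. Lp_pnorm p (\<lambda>x. f x - (\<Sum>k<m. \<Sum>s\<in>sign_vectors. R k s (cvec x)))) \<longlongrightarrow> 0) sequentially \<and>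
       (\<forall>s\<in>sign_vectors.
          ((\<lambda>m. Hp_pnorm p (octant s) (\<lambda>z. F s z - (\<Sum>k<m. R k s z))) \<longlongrightarrow> 0) sequentially) \<and>
       (\<forall>s\<in>sign_vectors. AE x in lebesgue. nt_limit (F s) s x (g s x)) \<and>
       (AE x in lebesgue. f x = (\<Sum>s\<in>sign_vectors. g s x)) \<and>
       Lp_pnorm p f \<le> (\<Sum>s\<in>sign_vectors. Lp_pnorm p (g s)) \<and>
       (\<Sum>s\<in>sign_vectors. Lp_pnorm p (g s)) \<le> ennreal (?n * K) * Lp_pnorm p f"
      by (intro exI[of _ R] exI[of _ "\<lambda>s z. \<Sum>k. R k s z"] exI[of _ "\<lambda>s x. \<Sum>k. R k s (cvec x)"]
          conjI allI ballI D)
  qed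
  moreover have ?B
  proof (intro equalityI subsetI CollectI)
    fix f :: "real^'n \<Rightarrow> complex" assume "f \<in> Lp p"
    with A1 obtain F g where "\<forall>s\<in>sign_vectors. F s \<in> Hp p (octant s)"
       "\<forall>s\<in>sign_vectors. AE x in lebesgue. nt_limit (F s) s x (g s x)"
       "AE x in lebesgue. f x = (\<Sum>s\<in>sign_vectors. g s x)" by blast
    then show "\<exists>h. (\<forall>s\<in>sign_vectors. h s \<in> Hp_boundary p s) \<and>
              (AE x in lebesgue. f x = (\<Sum>s\<in>sign_vectors. h s x))"
      unfolding Hp_boundary_def by blast
  next
    fix f :: "real^'n \<Rightarrow> complex"
    assume "f \<in> {f. \<exists>h. (\<forall>s\<in>sign_vectors. h s \<in> Hp_boundary p s) \<and>
              (AE x in lebesgue. f x = (\<Sum>s\<in>sign_vectors. h s x))}"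
    then obtain h where h: "\<And>s. s \<in> sign_vectors \<Longrightarrow> h s \<in> Hp_boundary p s"
      and eq: "AE x in lebesgue. f x = (\<Sum>s\<in>sign_vectors. h s x)" by blast
    \<comment> \<open>The converse inclusion: by Fatou every boundary function is in
      \<open>L\<^sup>p\<close>, and finite sums stay there by subadditivity.\<close>
    have hL: "h s \<in> borel_measurable lebesgue" "Lp_pnorm p (h s) < \<infinity>" if "s \<in> sign_vectors" for s
      using Hp_boundary_subset_Lp[OF assms(1) that] h[OF that] by (auto simp: Lp_def)
    have "(\<lambda>x. \<Sum>s\<in>sign_vectors. h s x) \<in> borel_measurable lebesgue"
      by (intro borel_measurable_sum hL)
    then have fm: "f \<in> borel_measurable lebesgue"
      by (rule borel_measurable_AE) (use eq in auto)
    have "Lp_pnorm p f = Lp_pnorm p (\<lambda>x. \<Sum>s\<in>sign_vectors. h s x)" by (rule Lp_pnorm_cong_AE[OF eq])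
    also have "\<dots> \<le> (\<Sum>s\<in>sign_vectors. Lp_pnorm p (h s))"
      using assms by (intro Lp_pnorm_sum_le finite_sign_vectors hL) auto
    also have "\<dots> < \<infinity>" using hL(2) by (simp add: finite_sign_vectors)
    finally show "f \<in> Lp p" using fm by (simp add: Lp_def)
  qed
  ultimately show ?thesis by blast
qed

end
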